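(* Let $\beta_0\in(0,\infty)$, $T_0>0$, $\kappa_0,x_0\in\mathbb{R}$, and let $k$ be an integer with $k\ge k_{\beta_0}:=2+\beta_0^{-1}+\beta_0$. For all $0<\delta<1$ there exists $\epsilon>0$ such that for any real-valued $(f,g)\in H^{k+1}(\mathbb{R})\times H^k(\mathbb{R})$ with $\|(f,g)\|_{H^{k+1}(\mathbb{R})\times H^k(\mathbb{R})}\le\epsilon$ there exist parameters $\beta^*\in(0,\infty)$, $T^*>0$, $\kappa^*\in\mathbb{R}$ and a unique solution $u:\Gamma(T^*,x_0)\to\mathbb{R}$ of \[ \partial_{tt}u-\partial_{xx}u=(\partial_t u)^2-(\partial_x u)^2 \] with initial data \[ u(0,x)=u_{\beta_0,\kappa_0,T_0,x_0}(0,x)+f(x),\quad \partial_t u(0,x)=\partial_t u_{\beta_0,\kappa_0,T_0,x_0}(0,x)+g(x),\qquad x\in B_{T^*}(x_0), \] such that for all $0\le t<T^*$ \[ (T^*-t)^{-\frac12+s}\,\|u(t,\cdot)-u_{\beta^*,\kappa^*,T^*,x_0}(t,\cdot)\|_{\dot H^s(B_{T^*-t}(x_0))}\lesssim (T^*-t)^{1-\delta},\quad s=0,1,\dots,k+1, \] \[ (T^*-t)^{-\frac12+s}\,\|\partial_t u(t,\cdot)-\partial_t u_{\beta^*,\kappa^*,T^*,x_0}(t,\cdot)\|_{\dot H^{s-1}(B_{T^*-t}(x_0))}\lesssim (T^*-t)^{1-\delta},\quad s=1,\dots,k+1, \] and moreover \[ |\beta^*-\beta_0|+|\kappa^*-\kappa_0|+\Big|\frac{T^*}{T_0}-1\Big|\lesssim\epsilon.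 \]
   Context: For $\beta>0$, $T>0$, $\kappa,x_0\in\mathbb{R}$ define on $\Gamma(T,x_0):=\{(t,x)\in[0,T)\times\mathbb{R}:|x-x_0|\le T-t\}$, with $y=\frac{x-x_0}{T-t}$, \[ u_{\beta,\kappa,T,x_0}(t,x)=-\log\Big(1-\frac tT\Big)-\log\big((1+y)+\beta(1-y)\big)+\log(1+\beta)+\kappa, \] an explicit blow-up solution of $\partial_{tt}u-\partial_{xx}u=(\partial_tu)^2-(\partial_xu)^2$ (denoted $u_{1,\beta,\kappa,T,x_0}$ in the paper). $B_r(x_0)=(x_0-r,x_0+r)$. $A\lesssim B$ means $A\le CB$ for a constant $C$ independent of $t$ and of the data. *)

theory Defs
  imports "HOL-Analysis.Analysis"
begin

definition light_cone :: "real \<Rightarrow> real \<Rightarrow> (real \<times> real) set" where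
  "light_cone T x0 = {(t, x). 0 \<le> t \<and> t < T \<and> \<bar>x - x0\<bar> \<le> T - t}"

definition ubl :: "real \<Rightarrow> real \<Rightarrow> real \<Rightarrow> real \<Rightarrow> real \<Rightarrow> real \<Rightarrow> real" where
  "ubl \<beta> \<kappa> T x0 t x =
     (let y = (x - x0) / (T - t) in
      - ln (1 - t / T) - ln ((1 + y) + \<beta> * (1 - y)) + ln (1 + \<beta>) + \<kappa>)"

definition dt :: "(real \<Rightarrow> real \<Rightarrow> real) \<Rightarrow> real \<Rightarrow> real \<Rightarrow> real" where
  "dt u t x = vector_derivative (\<lambda>s. u s x) (at t within {0..})"

definition test_fun :: "real set \<Rightarrow> (real \<Rightarrow> real) \<Rightarrow> bool" where
  "test_fun B \<phi> \<longleftrightarrow>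
     (\<forall>n x. ((deriv ^^ n) \<phi>) differentiable (at x)) \<and>
     (\<exists>a b. {a..b} \<subseteq> B \<and> (\<forall>x. x \<notin> {a..b} \<longrightarrow> \<phi> x = 0))"

definition weak_deriv :: "real set \<Rightarrow> nat \<Rightarrow> (real \<Rightarrow> real) \<Rightarrow> (real \<Rightarrow> real) \<Rightarrow> bool" where
  "weak_deriv B n v w \<longleftrightarrow>
     (\<forall>a b. {a..b} \<subseteq> B \<longrightarrow> set_integrable lborel {a..b} v \<and> set_integrable lborel {a..b} w) \<and>
     (\<forall>\<phi>. test_fun B \<phi> \<longrightarrow>
        (LINT x:B|lborel. v x * (deriv ^^ n) \<phi> x) = (-1) ^ n * (LINT x:B|lborel. w x * \<phi> x))"

definition sq_int :: "real set \<Rightarrow> (real \<Rightarrow> real) \<Rightarrow> bool" where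
  "sq_int B w \<longleftrightarrow> set_borel_measurable lborel B w \<and> set_integrable lborel B (\<lambda>x. (w x)\<^sup>2)"

definition L2_norm_on :: "real set \<Rightarrow> (real \<Rightarrow> real) \<Rightarrow> real" where
  "L2_norm_on B w = sqrt (LINT x:B|lborel. (w x)\<^sup>2)"

definition has_Hdot :: "real set \<Rightarrow> nat \<Rightarrow> (real \<Rightarrow> real) \<Rightarrow> bool" where
  "has_Hdot B s v \<longleftrightarrow> (\<exists>w. weak_deriv B s v w \<and> sq_int B w)"

text \<open>The seminorm ||v||_{Hdot^s(B)} = ||d^s v||_{L^2(B)} (weak derivatives are unique a.e.).\<close>
definition Hdot_norm :: "real set \<Rightarrow> nat \<Rightarrow> (real \<Rightarrow> real) \<Rightarrow> real" where
  "Hdot_norm B s v = L2_norm_on B (SOME w. weak_deriv B s v w \<and> sq_int B w)"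

definition H_witness :: "nat \<Rightarrow> (real \<Rightarrow> real) \<Rightarrow> (nat \<Rightarrow> real \<Rightarrow> real) \<Rightarrow> bool" where
  "H_witness m f D \<longleftrightarrow> D 0 = f \<and> (\<forall>j\<le>m. weak_deriv UNIV j f (D j) \<and> sq_int UNIV (D j))"

definition H_sq :: "nat \<Rightarrow> (nat \<Rightarrow> real \<Rightarrow> real) \<Rightarrow> real" where
  "H_sq m D = (\<Sum>j\<le>m. LINT x|lborel. (D j x)\<^sup>2)"

definition data_small :: "nat \<Rightarrow> (real \<Rightarrow> real) \<Rightarrow> (real \<Rightarrow> real) \<Rightarrow> real \<Rightarrow> bool" where
  "data_small k f g \<epsilon> \<longleftrightarrow>
     (\<exists>Df Dg. H_witness (k + 1) f Df \<and> H_witness k g Dg \<and> sqrt (H_sq (k + 1) Df + H_sq k Dg) \<le> \<epsilon>)"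

text \<open>u is a C^2 (up to the boundary, derivatives taken within the light_cone) solution of
  u_tt - u_xx = u_t^2 - u_x^2 on light_cone T x0 with u(0,x) = u0 x, u_t(0,x) = u1 x for
  (almost every) x in B_T(x0). DU z = (u_t, u_x); D2U z (1,0) = (u_tt, u_xt), D2U z (0,1) = (u_tx, u_xx).\<close>
definition is_solution ::
  "real \<Rightarrow> real \<Rightarrow> (real \<Rightarrow> real \<Rightarrow> real) \<Rightarrow> (real \<Rightarrow> real) \<Rightarrow> (real \<Rightarrow> real) \<Rightarrow> bool" where
  "is_solution T x0 u u0 u1 \<longleftrightarrow>
     (\<exists>DU D2U.
        continuous_on (light_cone T x0) DU \<and>
        continuous_on (light_cone T x0) (\<lambda>z. D2U z (1, 0)) \<and>
        continuous_on (light_cone T x0) (\<lambda>z. D2U z (0, 1)) \<and>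
        (\<forall>z\<in>light_cone T x0.
           ((\<lambda>(t, x). u t x) has_derivative (\<lambda>h. DU z \<bullet> h)) (at z within light_cone T x0) \<and>
           (DU has_derivative D2U z) (at z within light_cone T x0) \<and>
           fst (D2U z (1, 0)) - snd (D2U z (0, 1)) = (fst (DU z))\<^sup>2 - (snd (DU z))\<^sup>2) \<and>
        (AE x in lborel. x \<in> ball x0 T \<longrightarrow> u 0 x = u0 x \<and> fst (DU (0, x)) = u1 x))"

end

theory Submission
  imports Defs
begin

text \<open>
  If \<open>u\<close> solves the equation, then \<open>w = exp (- u)\<close> solves the linear wave equation, so
  \<open>w (t, x) = F (x + t) + G (x - t)\<close>, and \<open>u\<close> blows up where \<open>w\<close> vanishes. For the explicit
  solutions, \<open>w\<close> is the affine function \<open>exp (- \<kappa>) / T * (T - t + (1 - \<beta>) / (1 + \<beta>) * (x - x0))\<close>.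
  For perturbed data, \<open>F'\<close> stays negative and \<open>G'\<close> positive, hence \<open>w\<close> has a zero \<open>(T*, x0)\<close> with
  \<open>T*\<close> near \<open>T0\<close> and is positive on the backward light cone of this point. The parameters \<open>\<beta>*\<close> and
  \<open>\<kappa>*\<close> are read off from the first order Taylor polynomial \<open>w*\<close> of \<open>w\<close> at \<open>(T*, x0)\<close>. Since
  \<open>w - w*\<close> is quadratically small and \<open>w*\<close> is comparable to \<open>T* - t\<close> in the cone,
  \<open>u - u* = - ln (w / w*)\<close> is of size \<open>T* - t\<close> in the scale-invariant norms, which is better than
  the claimed power \<open>1 - \<delta>\<close>.
\<close>

subsection \<open>Primitives of locally integrable functions\<close>

text \<open>The obstacle is regularity. The data lie in Sobolev spaces, so weak derivatives are
  given through test functions and the top one is merely square integrable, whereas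
  \<open>is_solution\<close> asks for C^2. Derivatives are therefore handled through
  \<open>primitive_on\<close>, that is, local absolute continuity: it admits a merely integrable
  derivative, agrees with the classical notion when the derivative is continuous, implies weak
  differentiability by parts, and obeys the chain and product rules.

  A second difficulty is that the ball shrinks with r = T - t, while no constant may depend on r.
  Hence the norms are weighted by powers of r, and every derivative below the top one carries a sup
  bound; products, inverses and logarithms are then controlled uniformly in r without an embedding
  theorem on the small ball.

  At the vertex the slopes p = F'(x0 + T) and q = G'(x0 - T) encode the parameters: \<beta> = - p /
  q and \<kappa> = - ln (T * (q - p)). The signs p < 0 < q make \<beta> positive and the vertex a
  simple zero of w in time.\<close>

definition primitive_on :: "real set \<Rightarrow> (real \<Rightarrow> real) \<Rightarrow> (real \<Rightarrow> real) \<Rightarrow> bool" where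
  "primitive_on B v w \<longleftrightarrow>
     (\<forall>a b. a \<le> b \<longrightarrow> {a..b} \<subseteq> B \<longrightarrow>
        set_integrable lborel {a..b} w \<and> (LINT x:{a..b}|lborel. w x) = v b - v a)"

lemma primitive_onD:
  assumes "primitive_on B v w" "a \<le> b" "{a..b} \<subseteq> B"
  shows "set_integrable lborel {a..b} w" "(LINT x:{a..b}|lborel. w x) = v b - v a"
  using assms unfolding primitive_on_def by auto

lemma primitive_on_integrable:
  assumes "primitive_on B v w" "{a..b} \<subseteq> B"
  shows "set_integrable lborel {a..b} w"
proof (cases "a \<le> b")
  case False
  then show ?thesis by simp
qed (use assms primitive_onD in blast)

lemma primitive_on_subset: "primitive_on B v w \<Longrightarrow> B' \<subseteq> B \<Longrightarrow> primitive_on B' v w"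
  unfolding primitive_on_def by blast

lemma primitive_on_cong:
  assumes "primitive_on B v w" "\<And>x. x \<in> B \<Longrightarrow> v x = v' x" "\<And>x. x \<in> B \<Longrightarrow> w x = w' x"
  shows "primitive_on B v' w'"
  unfolding primitive_on_def
proof (intro allI impI)
  fix a b :: real assume ab: "a \<le> b" "{a..b} \<subseteq> B"
  have "set_integrable lborel {a..b} w' \<longleftrightarrow> set_integrable lborel {a..b} w"
    using ab assms(3) by (intro set_integrable_cong) auto
  moreover have "(LINT x:{a..b}|lborel. w' x) = (LINT x:{a..b}|lborel. w x)"
    using ab assms(3) by (intro set_lebesgue_integral_cong) auto
  moreover have "v' a = v a" "v' b = v b"
    using ab assms(2) by (auto simp: subset_eq)
  ultimately show "set_integrable lborel {a..b} w' \<and> (LINT x:{a..b}|lborel. w' x) = v' b - v' a"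
    using primitive_onD[OF assms(1) ab] by simp
qed

lemma primitive_on_cong_AE:
  assumes "primitive_on B v w" "AE x in lborel. w x = w' x" "w' \<in> borel_measurable lborel" "w \<in> borel_measurable lborel"
  shows "primitive_on B v w'"
  unfolding primitive_on_def
proof (intro allI impI)
  fix a b :: real assume ab: "a \<le> b" "{a..b} \<subseteq> B"
  have m: "set_borel_measurable lborel {a..b} w" "set_borel_measurable lborel {a..b} w'"
    using assms(3,4) unfolding set_borel_measurable_def by measurable
  have "set_integrable lborel {a..b} w' \<longleftrightarrow> set_integrable lborel {a..b} w"
    using assms(2) m unfolding set_integrable_def set_borel_measurable_def
    by (intro integrable_cong_AE) auto
  moreover have "(LINT x:{a..b}|lborel. w' x) = (LINT x:{a..b}|lborel. w x)"
    using assms(2) m unfolding set_lebesgue_integral_def set_borel_measurable_def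
    by (intro integral_cong_AE) auto
  ultimately show "set_integrable lborel {a..b} w' \<and> (LINT x:{a..b}|lborel. w' x) = v b - v a"
    using primitive_onD[OF assms(1) ab] by simp
qed

lemma primitive_on_FTC:
  assumes "\<And>x. x \<in> B \<Longrightarrow> (v has_real_derivative w x) (at x)" "continuous_on B w"
  shows "primitive_on B v w"
  unfolding primitive_on_def
proof (intro allI impI)
  fix a b :: real assume ab: "a \<le> b" "{a..b} \<subseteq> B"
  have "has_bochner_integral lborel (\<lambda>x. indicator {a .. b} x *\<^sub>R w x) (v b - v a)"
  proof (rule has_bochner_integral_FTC_Icc[OF ab(1)])
    show "(v has_vector_derivative w x) (at x within {a..b})" if "a \<le> x" "x \<le> b" for x
    proof -
      have "x \<in> B" using ab that by auto
      then show ?thesis using assms(1)[of x]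
        by (auto simp: has_real_derivative_iff_has_vector_derivative intro: has_vector_derivative_at_within)
    qed
    show "continuous_on {a..b} w"
      using assms(2) ab(2) continuous_on_subset by blast
  qed
  then show "set_integrable lborel {a..b} w \<and> (LINT x:{a..b}|lborel. w x) = v b - v a"
    by (auto simp: has_bochner_integral_iff set_integrable_def set_lebesgue_integral_def)
qed

lemma primitive_on_add:
  assumes "primitive_on B v w" "primitive_on B v' w'"
  shows "primitive_on B (\<lambda>x. v x + v' x) (\<lambda>x. w x + w' x)"
  using assms unfolding primitive_on_def by simp

lemma primitive_on_cmult:
  assumes "primitive_on B v w"
  shows "primitive_on B (\<lambda>x. c * v x) (\<lambda>x. c * w x)"
  using assms unfolding primitive_on_def by (simp add: right_diff_distrib)

lemma primitive_on_add_const: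
  assumes "primitive_on B v w"
  shows "primitive_on B (\<lambda>x. v x + c) w"
  using assms unfolding primitive_on_def by simp

lemma set_integral_Icc_combine:
  fixes w :: "real \<Rightarrow> real"
  assumes "set_integrable lborel {a..c} w" "a \<le> b" "b \<le> c"
  shows "(LINT x:{a..b}|lborel. w x) + (LINT x:{b..c}|lborel. w x) = (LINT x:{a..c}|lborel. w x)"
proof -
  have "set_integrable lborel {a..b} w" "set_integrable lborel {b..c} w"
    using assms by (auto intro: set_integrable_subset)
  then show ?thesis
    using assms Henstock_Kurzweil_Integration.integral_combine[of a b c w]
    by (simp add: set_borel_integral_eq_integral)
qed

lemma primitive_on_continuous_Icc:
  assumes "primitive_on B v w" "{a..b} \<subseteq> B"
  shows "continuous_on {a..b} v"
proof (cases "a \<le> b")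
  case True
  have i: "set_integrable lborel {a..b} w" using primitive_onD[OF assms(1) True assms(2)] by simp
  have "continuous_on {a..b} (\<lambda>x. v a + integral {a..x} w)"
    by (intro continuous_intros indefinite_integral_continuous_1 set_borel_integral_eq_integral i)
  moreover have "v a + integral {a..x} w = v x" if "x \<in> {a..b}" for x
  proof -
    have "{a..x} \<subseteq> B" using that assms(2) by (auto simp: subset_eq)
    then show ?thesis
      using primitive_onD[OF assms(1), of a x] that set_borel_integral_eq_integral(2)[of "{a..x}" w] by simp
  qed
  ultimately show ?thesis by (rule continuous_on_eq)
qed auto

lemma primitive_on_continuous:
  assumes "primitive_on B v w" "open B"
  shows "continuous_on B v"
proof -
  have "isCont v x" if x: "x \<in> B" for x
  proof -
    obtain e where e: "e > 0" "cball x e \<subseteq> B" by (meson assms(2) x open_contains_cball)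
    then have "continuous_on {x-e..x+e} v"
      using primitive_on_continuous_Icc[OF assms(1)] unfolding cball_eq_atLeastAtMost by blast
    then show ?thesis by (rule continuous_on_interior) (use e in auto)
  qed
  then show ?thesis by (intro continuous_at_imp_continuous_on) auto
qed

section \<open>The chain rule and the product rule for primitives\<close>

lemma set_integrable_continuous_mult:
  fixes w h :: "real \<Rightarrow> real"
  assumes w: "set_integrable lborel {a..b} w" and h: "continuous_on {a..b} h"
  shows "set_integrable lborel {a..b} (\<lambda>x. h x * w x)"
proof -
  have "bounded (h ` {a..b})" using compact_continuous_image[OF h] by (simp add: compact_imp_bounded)
  then obtain K where K: "\<And>x. x \<in> {a..b} \<Longrightarrow> \<bar>h x\<bar> \<le> K"
    unfolding bounded_iff by (metis imageI real_norm_def)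
  have m1: "(\<lambda>x. indicator {a..b} x *\<^sub>R h x) \<in> borel_measurable borel"
    by (rule borel_measurable_continuous_on_indicator) (use h in auto)
  have m2: "(\<lambda>x. indicator {a..b} x *\<^sub>R w x) \<in> borel_measurable borel"
    using w unfolding set_integrable_def by (simp add: borel_measurable_integrable)
  have "(\<lambda>x. (indicator {a..b} x *\<^sub>R h x) * (indicator {a..b} x *\<^sub>R w x)) \<in> borel_measurable borel"
    using m1 m2 by measurable
  moreover have "(\<lambda>x. (indicator {a..b} x *\<^sub>R h x) * (indicator {a..b} x *\<^sub>R w x)) =
     (\<lambda>x. indicator {a..b} x *\<^sub>R (h x * w x))" by (auto simp: indicator_def)
  ultimately have m: "(\<lambda>x. indicator {a..b} x *\<^sub>R (h x * w x)) \<in> borel_measurable borel" by simp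
  show ?thesis
    unfolding set_integrable_def
  proof (rule Bochner_Integration.integrable_bound)
    show "integrable lborel (\<lambda>x. K * (indicator {a..b} x *\<^sub>R w x))"
      using w unfolding set_integrable_def by (intro integrable_mult_right)
    show "AE x in lborel. norm (indicator {a..b} x *\<^sub>R (h x * w x)) \<le> norm (K * (indicator {a..b} x *\<^sub>R w x))"
    proof (intro AE_I2)
      fix x
      show "norm (indicator {a..b} x *\<^sub>R (h x * w x)) \<le> norm (K * (indicator {a..b} x *\<^sub>R w x))"
      proof (cases "x \<in> {a..b}")
        case True
        then have "\<bar>h x\<bar> * \<bar>w x\<bar> \<le> \<bar>K\<bar> * \<bar>w x\<bar>"
          using K[OF True] by (intro mult_right_mono) auto
        then show ?thesis using True by (simp add: abs_mult)
      qed simp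
    qed
  qed (use m in simp)
qed

text \<open>The mean value theorem with the two points in either order or equal. The clause with the
  free centre \<open>c\<close> keeps the intermediate point as close to \<open>c\<close> as the
  farther end point, which is all that the continuity and Taylor arguments need.\<close>

lemma convex_mean_value:
  fixes H H' :: "real \<Rightarrow> real"
  assumes J: "convex J" and H: "\<And>y. y \<in> J \<Longrightarrow> (H has_real_derivative H' y) (at y)"
    and "p \<in> J" "q \<in> J"
  obtains \<xi> where "\<xi> \<in> J" "\<bar>\<xi> - c\<bar> \<le> max \<bar>p - c\<bar> \<bar>q - c\<bar>" "H q - H p = H' \<xi> * (q - p)"
proof -
  have *: "\<exists>\<xi>\<in>J. \<bar>\<xi> - c\<bar> \<le> max \<bar>p - c\<bar> \<bar>q - c\<bar> \<and> H q - H p = H' \<xi> * (q - p)"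
    if pq: "p \<in> J" "q \<in> J" "p < q" for p q
  proof -
    have sub: "{p..q} \<subseteq> J" using J pq
      by (metis closed_segment_eq_real_ivl closed_segment_subset less_imp_le)
    obtain z where "p < z" "z < q" "H q - H p = (q - p) * H' z"
      using MVT2[OF pq(3), of H H'] H sub by (metis atLeastAtMost_iff subset_eq)
    moreover have "z \<in> J" using sub \<open>p < z\<close> \<open>z < q\<close> by auto
    ultimately show ?thesis by (intro bexI[of _ z]) (auto simp: mult.commute)
  qed
  have "\<exists>\<xi>\<in>J. \<bar>\<xi> - c\<bar> \<le> max \<bar>p - c\<bar> \<bar>q - c\<bar> \<and> H q - H p = H' \<xi> * (q - p)"
  proof (cases p q rule: linorder_cases)
    case equal
    then show ?thesis using assms by auto
  next
    case greater
    then obtain \<xi> where x: "\<xi> \<in> J" "\<bar>\<xi> - c\<bar> \<le> max \<bar>q - c\<bar> \<bar>p - c\<bar>" "H p - H q = H' \<xi> * (p - q)"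
      using *[of q p] assms by blast
    then show ?thesis by (intro bexI[of _ \<xi>]) (auto simp: algebra_simps max.commute)
  qed (use *[of p q] assms in auto)
  then show thesis using that by blast
qed

text \<open>The defect of the chain rule on a short interval is at most \<open>e\<close> times the integral of
  \<open>\<bar>w\<bar>\<close>, and this estimate is additive over subdivisions.\<close>

lemma primitive_on_comp:
  fixes H H' :: "real \<Rightarrow> real"
  assumes p: "primitive_on B v w" and J: "convex J"
    and H: "\<And>y. y \<in> J \<Longrightarrow> (H has_real_derivative H' y) (at y)" and H': "continuous_on J H'"
    and vJ: "\<And>x. x \<in> B \<Longrightarrow> v x \<in> J"
  shows "primitive_on B (\<lambda>x. H (v x)) (\<lambda>x. H' (v x) * w x)"
  unfolding primitive_on_def
proof (intro allI impI)
  fix a b :: real assume ab: "a \<le> b" "{a..b} \<subseteq> B"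
  have cv: "continuous_on {a..b} v" by (rule primitive_on_continuous_Icc[OF p ab(2)])
  have vJ': "v x \<in> J" if "x \<in> {a..b}" for x using vJ that ab by auto
  have ch: "continuous_on {a..b} (\<lambda>x. H' (v x))"
    by (rule continuous_on_compose2[OF H' cv]) (use vJ' in auto)
  have wi: "set_integrable lborel {a..b} w" using primitive_onD[OF p ab] by simp
  have hi: "set_integrable lborel {a..b} (\<lambda>x. H' (v x) * w x)"
    by (rule set_integrable_continuous_mult[OF wi ch])
  have est: "\<bar>H (v b) - H (v a) - (LINT x:{a..b}|lborel. H' (v x) * w x)\<bar>
      \<le> e * (LINT x:{a..b}|lborel. \<bar>w x\<bar>)" if e: "e > 0" for e
  proof -
    define P where "P y z \<longleftrightarrow> (a \<le> y \<longrightarrow> z \<le> b \<longrightarrow> \<bar>H (v z) - H (v y) - (LINT x:{y..z}|lborel. H' (v x) * w x)\<bar>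
      \<le> e * (LINT x:{y..z}|lborel. \<bar>w x\<bar>))" for y z
    have "P a b"
      using ab(1)
    proof (induction rule: Bolzano)
      case (trans y1 y2 y3)
      show ?case unfolding P_def
      proof (intro impI)
        assume b: "a \<le> y1" "y3 \<le> b"
        have i: "set_integrable lborel {y1..y3} w" "set_integrable lborel {y1..y3} (\<lambda>x. H' (v x) * w x)"
          using wi hi b by (auto elim!: set_integrable_subset)
        have A: "e * (LINT x:{y1..y2}|lborel. \<bar>w x\<bar>) + e * (LINT x:{y2..y3}|lborel. \<bar>w x\<bar>)
            = e * (LINT x:{y1..y3}|lborel. \<bar>w x\<bar>)"
          using set_integral_Icc_combine[OF set_integrable_abs[OF i(1)] trans(3,4)]
          by (metis distrib_left)
        show "\<bar>H (v y3) - H (v y1) - (LINT x:{y1..y3}|lborel. H' (v x) * w x)\<bar>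
          \<le> e * (LINT x:{y1..y3}|lborel. \<bar>w x\<bar>)"
          using trans(1,2)[unfolded P_def] b trans(3,4) set_integral_Icc_combine[OF i(2) trans(3,4)] A
          by linarith
      qed
    next
      case (local x)
      then have x: "x \<in> {a..b}" by simp
      obtain \<eta> where \<eta>: "\<eta> > 0" "\<And>y. y \<in> J \<Longrightarrow> \<bar>y - v x\<bar> < \<eta> \<Longrightarrow> \<bar>H' y - H' (v x)\<bar> < e / 2"
        using H' vJ'[OF x] e unfolding continuous_on_iff dist_real_def
        by (metis half_gt_zero)
      obtain d where d: "d > 0" "\<And>s. s \<in> {a..b} \<Longrightarrow> \<bar>s - x\<bar> < d \<Longrightarrow> \<bar>v s - v x\<bar> < \<eta>"
        using cv x \<eta>(1) unfolding continuous_on_iff dist_real_def by metis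
      show ?case
      proof (intro exI conjI allI impI)
        fix y z assume yz: "y \<le> x \<and> x \<le> z \<and> z - y < d"
        show "P y z" unfolding P_def
        proof (intro impI)
          assume b: "a \<le> y" "z \<le> b"
          have near: "\<bar>v s - v x\<bar> < \<eta>" if "s \<in> {y..z}" for s
            using that yz b by (intro d) auto
          \<comment> \<open>One mean-value slope represents the whole increment, so the defect is
            the integral of \<open>(H' \<xi> - H' (v x)) * w x\<close>, whose first factor is at
            most \<open>e\<close> by continuity.\<close>
          obtain \<xi> where xi: "\<xi> \<in> J" "\<bar>\<xi> - v x\<bar> \<le> max \<bar>v y - v x\<bar> \<bar>v z - v x\<bar>"
              "H (v z) - H (v y) = H' \<xi> * (v z - v y)"
            using convex_mean_value[OF J H vJ'[of y] vJ'[of z], of "v x"] yz b by auto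
          have "\<bar>\<xi> - v x\<bar> < \<eta>" using near[of y] near[of z] xi(2) yz by auto
          then have h1: "\<bar>H' \<xi> - H' (v x)\<bar> < e / 2" using \<eta> xi(1) by auto
          have h2: "\<bar>H' \<xi> - H' (v s)\<bar> \<le> e" if "s \<in> {y..z}" for s
          proof -
            have "s \<in> {a..b}" using that b by auto
            then show ?thesis using h1 \<eta>(2)[OF vJ' near[OF that]] by linarith
          qed
          have sub: "{y..z} \<subseteq> B" "y \<le> z" using ab b yz by auto
          have i: "set_integrable lborel {y..z} w" "set_integrable lborel {y..z} (\<lambda>x. H' (v x) * w x)"
            using wi hi b by (auto elim!: set_integrable_subset)
          have "H (v z) - H (v y) - (LINT x:{y..z}|lborel. H' (v x) * w x)
             = (LINT x:{y..z}|lborel. H' \<xi> * w x - H' (v x) * w x)"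
            using primitive_onD[OF p sub(2,1)] xi(3) i by simp
          also have "\<bar>\<dots>\<bar> \<le> (LINT x:{y..z}|lborel. \<bar>H' \<xi> * w x - H' (v x) * w x\<bar>)"
            using integral_norm_bound[of lborel "\<lambda>x. indicator {y..z} x *\<^sub>R (H' \<xi> * w x - H' (v x) * w x)"]
            by (simp add: set_lebesgue_integral_def abs_mult)
          also have "\<dots> \<le> (LINT x:{y..z}|lborel. e * \<bar>w x\<bar>)"
          proof (rule set_integral_mono)
            show "set_integrable lborel {y..z} (\<lambda>x. \<bar>H' \<xi> * w x - H' (v x) * w x\<bar>)"
              using i by (intro set_integrable_abs set_integral_diff) auto
            show "set_integrable lborel {y..z} (\<lambda>x. e * \<bar>w x\<bar>)"
              using i by (intro set_integrable_mult_right) (auto intro: set_integrable_abs)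
            show "\<bar>H' \<xi> * w s - H' (v s) * w s\<bar> \<le> e * \<bar>w s\<bar>" if "s \<in> {y..z}" for s
              using mult_right_mono[OF h2[OF that], of "\<bar>w s\<bar>"]
              by (simp add: abs_mult left_diff_distrib[symmetric])
          qed
          finally show "\<bar>H (v z) - H (v y) - (LINT x:{y..z}|lborel. H' (v x) * w x)\<bar>
             \<le> e * (LINT x:{y..z}|lborel. \<bar>w x\<bar>)" by simp
        qed
      qed (rule d)
    qed
    then show ?thesis unfolding P_def by simp
  qed
  define K where "K = (LINT x:{a..b}|lborel. \<bar>w x\<bar>)"
  have "K \<ge> 0" unfolding K_def set_lebesgue_integral_def by (intro Bochner_Integration.integral_nonneg) auto
  have "\<bar>H (v b) - H (v a) - (LINT x:{a..b}|lborel. H' (v x) * w x)\<bar> \<le> 0 + e" if "e > 0" for e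
  proof -
    \<comment> \<open>The total integral \<open>K\<close> may vanish, hence the division by
      \<open>K + 1\<close>.\<close>
    have "\<bar>H (v b) - H (v a) - (LINT x:{a..b}|lborel. H' (v x) * w x)\<bar> \<le> e / (K + 1) * K"
      using est[of "e / (K + 1)"] that \<open>K \<ge> 0\<close> unfolding K_def[symmetric] by simp
    also have "\<dots> \<le> e" using that \<open>K \<ge> 0\<close> by (simp add: field_simps)
    finally show ?thesis by simp
  qed
  then have "\<bar>H (v b) - H (v a) - (LINT x:{a..b}|lborel. H' (v x) * w x)\<bar> \<le> 0"
    by (rule field_le_epsilon)
  then show "set_integrable lborel {a..b} (\<lambda>x. H' (v x) * w x) \<and>
      (LINT x:{a..b}|lborel. H' (v x) * w x) = H (v b) - H (v a)"
    using hi by simp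
qed

text \<open>Polarization: a product is a quarter of the difference of two squares, so the product
  rule follows from the chain rule for squaring.\<close>

lemma primitive_on_mult:
  assumes "primitive_on B v w" "primitive_on B v' w'"
  shows "primitive_on B (\<lambda>x. v x * v' x) (\<lambda>x. w x * v' x + v x * w' x)"
proof -
  have sq: "primitive_on B (\<lambda>x. (z x)\<^sup>2) (\<lambda>x. 2 * z x * y x)" if "primitive_on B z y" for z y
    by (rule primitive_on_comp[OF that, of UNIV "\<lambda>x. x\<^sup>2" "\<lambda>x. 2 * x"])
       (auto intro!: derivative_eq_intros continuous_intros)
  have "primitive_on B (\<lambda>x. v x + (-1) * v' x) (\<lambda>x. w x + (-1) * w' x)"
    by (intro primitive_on_add primitive_on_cmult assms)
  from primitive_on_add[OF primitive_on_cmult[OF sq[OF primitive_on_add[OF assms]], of "1/4"]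
    primitive_on_cmult[OF sq[OF this], of "-(1/4)"]]
  show ?thesis by (rule primitive_on_cong) (simp_all add: power2_eq_square algebra_simps)
qed

text \<open>The way back to classical calculus once the density is continuous; this is what makes
  the null profiles of class C^2.\<close>

lemma primitive_on_has_derivative:
  assumes p: "primitive_on B v w" and "open B" and w: "continuous_on B w" and x: "x \<in> B"
  shows "(v has_real_derivative w x) (at x)"
proof -
  obtain e where e: "e > 0" "cball x e \<subseteq> B" by (meson assms(2) x open_contains_cball)
  then have sub: "{x-e..x+e} \<subseteq> B" unfolding cball_eq_atLeastAtMost by blast
  have "((\<lambda>y. integral {x-e..y} w) has_vector_derivative w x) (at x within {x-e..x+e})"
    using e w sub by (intro integral_has_vector_derivative) (auto intro: continuous_on_subset)
  then have "((\<lambda>y. v (x-e) + integral {x-e..y} w) has_vector_derivative w x) (at x within {x-e..x+e})"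
    by (auto intro!: derivative_eq_intros)
  then have "(v has_vector_derivative w x) (at x within {x-e..x+e})"
  proof (rule has_vector_derivative_transform[rotated 2])
    show "v y = v (x-e) + integral {x-e..y} w" if "y \<in> {x-e..x+e}" for y
    proof -
      have "{x-e..y} \<subseteq> B" using that sub by (auto simp: subset_eq)
      then show ?thesis
        using primitive_onD[OF p, of "x-e" y] that set_borel_integral_eq_integral(2)[of "{x-e..y}" w] by simp
    qed
  qed (use e in auto)
  then show ?thesis
    using e at_within_interior[of x "{x-e..x+e}"]
    by (simp add: has_real_derivative_iff_has_vector_derivative)
qed

subsection \<open>Test functions\<close>

text \<open>Peeling off the innermost derivative lets closure under sums, products and affine
  substitutions be proved by induction with the functions generalized, without a formula for higher
  derivatives of a product.\<close>

primrec times_differentiable :: "nat \<Rightarrow> (real \<Rightarrow> real) \<Rightarrow> bool" where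
  "times_differentiable 0 f \<longleftrightarrow> True"
| "times_differentiable (Suc n) f \<longleftrightarrow> (\<forall>x. f differentiable (at x)) \<and> times_differentiable n (deriv f)"

lemma times_differentiable_iff:
  "times_differentiable n f \<longleftrightarrow> (\<forall>i<n. \<forall>x. ((deriv ^^ i) f) differentiable (at x))"
proof (induction n arbitrary: f)
  case (Suc n)
  have "(deriv ^^ Suc i) f = (deriv ^^ i) (deriv f)" for i by (simp add: funpow_swap1)
  then have "times_differentiable (Suc n) f \<longleftrightarrow> (\<forall>x. ((deriv ^^ 0) f) differentiable (at x)) \<and>
      (\<forall>i<n. \<forall>x. ((deriv ^^ Suc i) f) differentiable (at x))"
    by (simp add: Suc.IH)
  then show ?case by (auto simp: less_Suc_eq_0_disj simp del: funpow.simps(2))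
qed simp

lemma times_differentiable_SucI:
  assumes "\<And>x. (f has_real_derivative f' x) (at x)" "times_differentiable n f'"
  shows "times_differentiable (Suc n) f"
proof -
  have "deriv f = f'" using assms(1) DERIV_imp_deriv by blast
  then show ?thesis using assms by (auto simp: real_differentiable_def)
qed

lemma times_differentiable_SucE:
  assumes "times_differentiable (Suc n) f"
  obtains f' where "\<And>x. (f has_real_derivative f' x) (at x)" "times_differentiable n f'"
  using assms that[of "deriv f"] by (auto simp: DERIV_deriv_iff_real_differentiable)

lemma times_differentiable_SucD: "times_differentiable (Suc n) f \<Longrightarrow> times_differentiable n f"
  by (simp add: times_differentiable_iff)

lemma times_differentiable_add:
  "times_differentiable n f \<Longrightarrow> times_differentiable n g \<Longrightarrow> times_differentiable n (\<lambda>x. f x + g x)"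
proof (induction n arbitrary: f g)
  case (Suc n)
  obtain f' where f': "\<And>x. (f has_real_derivative f' x) (at x)" "times_differentiable n f'"
    using times_differentiable_SucE[OF Suc.prems(1)] by blast
  obtain g' where g': "\<And>x. (g has_real_derivative g' x) (at x)" "times_differentiable n g'"
    using times_differentiable_SucE[OF Suc.prems(2)] by blast
  show ?case
    by (rule times_differentiable_SucI[where f' = "\<lambda>x. f' x + g' x"])
       (auto intro!: derivative_eq_intros f' g' Suc.IH)
qed simp

lemma times_differentiable_cmult:
  "times_differentiable n f \<Longrightarrow> times_differentiable n (\<lambda>x. c * f x)"
proof (induction n arbitrary: f)
  case (Suc n)
  obtain f' where f': "\<And>x. (f has_real_derivative f' x) (at x)" "times_differentiable n f'"
    using times_differentiable_SucE[OF Suc.prems(1)] by blast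
  show ?case
    by (rule times_differentiable_SucI[where f' = "\<lambda>x. c * f' x"])
       (auto intro!: derivative_eq_intros f' Suc.IH)
qed simp

lemma times_differentiable_mult:
  "times_differentiable n f \<Longrightarrow> times_differentiable n g \<Longrightarrow> times_differentiable n (\<lambda>x. f x * g x)"
proof (induction n arbitrary: f g)
  case (Suc n)
  obtain f' where f': "\<And>x. (f has_real_derivative f' x) (at x)" "times_differentiable n f'"
    using times_differentiable_SucE[OF Suc.prems(1)] by blast
  obtain g' where g': "\<And>x. (g has_real_derivative g' x) (at x)" "times_differentiable n g'"
    using times_differentiable_SucE[OF Suc.prems(2)] by blast
  show ?case
  proof (rule times_differentiable_SucI)
    show "((\<lambda>x. f x * g x) has_real_derivative f' x * g x + f x * g' x) (at x)" for x
      by (auto intro!: derivative_eq_intros f' g')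
    show "times_differentiable n (\<lambda>x. f' x * g x + f x * g' x)"
      by (intro times_differentiable_add Suc.IH f' g' Suc.prems[THEN times_differentiable_SucD])
  qed
qed simp

lemma times_differentiable_affine:
  "times_differentiable n f \<Longrightarrow> times_differentiable n (\<lambda>x. f (c * x + d))"
proof (induction n arbitrary: f)
  case (Suc n)
  obtain f' where f': "\<And>x. (f has_real_derivative f' x) (at x)" "times_differentiable n f'"
    using times_differentiable_SucE[OF Suc.prems(1)] by blast
  show ?case
  proof (rule times_differentiable_SucI)
    show "((\<lambda>x. f (c * x + d)) has_real_derivative c * f' (c * x + d)) (at x)" for x
      by (rule DERIV_cong[OF DERIV_chain2[OF f'(1)]]) (auto intro!: derivative_eq_intros)
    show "times_differentiable n (\<lambda>x. c * f' (c * x + d))"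
      by (intro times_differentiable_cmult Suc.IH f')
  qed
qed simp

text \<open>The derivatives of exp (- 1 / x) extended by zero are linear combinations of these
  functions, so the family is closed under differentiation.\<close>

definition flat :: "nat \<Rightarrow> real \<Rightarrow> real" where
  "flat n x = (if x > 0 then (1 / x) ^ n * exp (- (1 / x)) else 0)"

lemma flat_tendsto_0: "(flat n \<longlongrightarrow> 0) (at 0)"
proof -
  have l: "(flat n \<longlongrightarrow> 0) (at_left 0)"
    by (rule tendsto_eventually) (auto simp: flat_def eventually_at_filter)
  have "((\<lambda>x::real. (inverse x) ^ n / exp (inverse x)) \<longlongrightarrow> 0) (at_right 0)"
    by (rule filterlim_compose[OF tendsto_power_div_exp_0 filterlim_inverse_at_top_right])
  then have r: "(flat n \<longlongrightarrow> 0) (at_right 0)"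
    by (rule Lim_transform_eventually)
       (auto simp: flat_def eventually_at_filter exp_minus divide_inverse)
  show ?thesis using filterlim_split_at[OF l r] .
qed

lemma flat_has_derivative:
  "(flat n has_real_derivative (- real n * flat (n + 1) x + flat (n + 2) x)) (at x)"
proof -
  consider "x > 0" | "x < 0" | "x = 0" by linarith
  then show ?thesis
  proof cases
    case 1
    have "((\<lambda>x. (1 / x) ^ n * exp (- (1 / x))) has_real_derivative
       (- real n * flat (n + 1) x + flat (n + 2) x)) (at x)"
    proof (cases n)
      case 0
      then show ?thesis using 1
        by (auto intro!: derivative_eq_intros simp: flat_def power2_eq_square field_simps)
    next
      case (Suc m)
      then show ?thesis using 1
        by (auto intro!: derivative_eq_intros simp: flat_def field_simps) (cases m; simp)
    qed
    moreover have "eventually (\<lambda>y. flat n y = (1 / y) ^ n * exp (- (1 / y))) (nhds x)"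
      using eventually_nhds_in_open[of "{0<..}" x] 1
      by (auto elim!: eventually_mono simp: flat_def)
    ultimately show ?thesis by (subst DERIV_cong_ev[OF refl _ refl])
  next
    case 2
    have "eventually (\<lambda>y. flat n y = 0) (nhds x)"
      using eventually_nhds_in_open[of "{..<0}" x] 2
      by (auto elim!: eventually_mono simp: flat_def)
    moreover have "((\<lambda>x. 0) has_real_derivative
       (- real n * flat (n + 1) x + flat (n + 2) x)) (at x)"
      using 2 by (auto simp: flat_def)
    ultimately show ?thesis by (subst DERIV_cong_ev[OF refl _ refl])
  next
    case 3
    \<comment> \<open>At the origin the difference quotient of \<open>flat n\<close> is
      \<open>flat (Suc n)\<close>, which tends to 0 from both sides.\<close>
    have "((\<lambda>h. (flat n (0 + h) - flat n 0) / h) \<longlongrightarrow> 0) (at 0)"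
      by (rule Lim_transform_eventually[OF flat_tendsto_0[of "Suc n"]])
         (auto simp: flat_def eventually_at_filter)
    then show ?thesis using 3 by (simp add: DERIV_def) (simp add: flat_def)
  qed
qed

lemma times_differentiable_flat: "times_differentiable m (flat n)"
proof (induction m arbitrary: n)
  case (Suc m)
  show ?case
    by (rule times_differentiable_SucI[OF flat_has_derivative])
       (intro times_differentiable_add times_differentiable_cmult Suc)
qed simp

text \<open>Since \<open>flat 0\<close> tends to 1 at infinity, stretching its argument by
  \<open>Suc n\<close> makes the bumps converge pointwise to the indicator of the open interval,
  with values in [0, 1] throughout.\<close>

definition bump :: "nat \<Rightarrow> real \<Rightarrow> real \<Rightarrow> real \<Rightarrow> real" where
  "bump n a b x = flat 0 (real (Suc n) * (x - a)) * flat 0 (real (Suc n) * (b - x))"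

lemma times_differentiable_bump: "times_differentiable m (bump n a b)"
proof -
  have "times_differentiable m (\<lambda>x. flat 0 (real (Suc n) * x + (- real (Suc n) * a)) *
      flat 0 ((- real (Suc n)) * x + real (Suc n) * b))"
    by (intro times_differentiable_mult times_differentiable_affine times_differentiable_flat)
  then show ?thesis unfolding bump_def[abs_def] by (simp add: algebra_simps)
qed

lemma flat_0_bounds: "0 \<le> flat 0 x" "flat 0 x \<le> 1" by (auto simp: flat_def)

lemma bump_bounds: "0 \<le> bump n a b x" "bump n a b x \<le> 1"
  unfolding bump_def by (auto intro!: mult_nonneg_nonneg mult_le_one flat_0_bounds)

lemma bump_eq_0: "x \<notin> {a<..<b} \<Longrightarrow> bump n a b x = 0"
  by (auto simp: bump_def flat_def zero_less_mult_iff)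

lemma bump_pos: "x \<in> {a<..<b} \<Longrightarrow> bump n a b x > 0"
  by (auto simp: bump_def flat_def)

lemma bump_tendsto:
  assumes "x \<in> {a<..<b}"
  shows "(\<lambda>n. bump n a b x) \<longlonglongrightarrow> 1"
proof -
  have *: "(\<lambda>n. exp (- (1 / (real (Suc n) * y)))) \<longlonglongrightarrow> 1" if "y > 0" for y :: real
  proof -
    have "(\<lambda>n. exp (- ((1 / y) * inverse (real (Suc n))))) \<longlonglongrightarrow> exp (- ((1/y) * 0))"
      by (intro tendsto_intros LIMSEQ_inverse_real_of_nat)
    then show ?thesis by (simp add: divide_inverse mult.commute)
  qed
  have "(\<lambda>n. exp (- (1 / (real (Suc n) * (x - a)))) * exp (- (1 / (real (Suc n) * (b - x))))) \<longlonglongrightarrow> 1 * 1"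
    by (intro tendsto_mult *) (use assms in auto)
  then show ?thesis using assms by (simp add: bump_def flat_def)
qed

lemma test_fun_iff:
  "test_fun B \<phi> \<longleftrightarrow> (\<forall>n. times_differentiable n \<phi>) \<and> (\<exists>a b. {a..b} \<subseteq> B \<and> (\<forall>x. x \<notin> {a..b} \<longrightarrow> \<phi> x = 0))"
proof -
  have "(\<forall>n. times_differentiable n \<phi>) \<longleftrightarrow> (\<forall>n x. ((deriv ^^ n) \<phi>) differentiable (at x))"
    unfolding times_differentiable_iff by (blast intro: lessI)
  then show ?thesis unfolding test_fun_def by simp
qed

lemma test_fun_bump:
  assumes "{a..b} \<subseteq> B"
  shows "test_fun B (bump n a b)"
proof -
  have "\<forall>x. x \<notin> {a..b} \<longrightarrow> bump n a b x = 0"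
    by (intro allI impI bump_eq_0) auto
  then show ?thesis unfolding test_fun_iff using times_differentiable_bump assms by blast
qed

lemma test_fun_derivative: "test_fun B \<phi> \<Longrightarrow> (\<phi> has_real_derivative deriv \<phi> x) (at x)"
  unfolding test_fun_def DERIV_deriv_iff_real_differentiable
  by (drule conjunct1, drule spec[of _ 0], drule spec[of _ x]) simp

lemma test_fun_continuous: "test_fun B \<phi> \<Longrightarrow> continuous_on A \<phi>"
  by (intro continuous_at_imp_continuous_on ballI DERIV_isCont[OF test_fun_derivative])

lemma deriv_zero_outside:
  fixes \<phi> :: "real \<Rightarrow> real"
  assumes "\<And>x. x \<notin> {a..b} \<Longrightarrow> \<phi> x = 0" "x \<notin> {a..b}"
  shows "deriv \<phi> x = 0"
proof -
  have "eventually (\<lambda>y. y \<in> - {a..b}) (nhds x)"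
    using assms(2) by (intro eventually_nhds_in_open) auto
  then have "eventually (\<lambda>y. \<phi> y = 0) (nhds x)"
    by eventually_elim (use assms(1) in blast)
  then have "(\<phi> has_real_derivative 0) (at x)"
    by (subst DERIV_cong_ev[OF refl _ refl]) auto
  then show ?thesis by (rule DERIV_imp_deriv)
qed

lemma test_fun_deriv:
  assumes "test_fun B \<phi>"
  shows "test_fun B (deriv \<phi>)"
proof -
  have td: "times_differentiable n (deriv \<phi>)" for n
    using assms unfolding test_fun_iff by (metis times_differentiable.simps(2))
  obtain a b where ab: "{a..b} \<subseteq> B" "\<And>x. x \<notin> {a..b} \<Longrightarrow> \<phi> x = 0"
    using assms unfolding test_fun_iff by blast
  then have "deriv \<phi> x = 0" if "x \<notin> {a..b}" for x
    using deriv_zero_outside[of a b \<phi>] that by blast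
  then show ?thesis using td ab unfolding test_fun_iff by blast
qed

lemma test_fun_deriv_funpow: "test_fun B \<phi> \<Longrightarrow> test_fun B ((deriv ^^ n) \<phi>)"
  by (induction n) (auto intro: test_fun_deriv)

text \<open>Approaching an end point from outside the support shows that the value there is 0 as
  well; this removes the boundary terms in integration by parts. The second alternative covers an
  empty supporting interval.\<close>

lemma test_fun_support:
  assumes "test_fun B \<phi>"
  obtains a b where "a \<le> b" "{a..b} \<subseteq> B" "\<And>x. x \<notin> {a..b} \<Longrightarrow> \<phi> x = 0" "\<phi> a = 0" "\<phi> b = 0"
  | "\<phi> = (\<lambda>x. 0)"
proof -
  obtain a b where ab: "{a..b} \<subseteq> B" "\<And>x. x \<notin> {a..b} \<Longrightarrow> \<phi> x = 0"
    using assms unfolding test_fun_iff by blast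
  show thesis
  proof (cases "a \<le> b")
    case False
    then have "\<phi> = (\<lambda>x. 0)" using ab(2) by auto
    then show thesis using that(2) by blast
  next
    case True
    have ct: "isCont \<phi> x" for x using test_fun_derivative[OF assms] DERIV_isCont by blast
    have "(\<phi> \<longlongrightarrow> \<phi> a) (at_left a)" using ct[of a] by (auto simp: isCont_def intro: filterlim_at_within_not_equal tendsto_within_subset)
    moreover have "(\<phi> \<longlongrightarrow> 0) (at_left a)"
      by (rule tendsto_eventually) (use ab(2) in \<open>auto simp: eventually_at_filter\<close>)
    ultimately have a0: "\<phi> a = 0" using tendsto_unique[OF trivial_limit_at_left_real] by blast
    have "(\<phi> \<longlongrightarrow> \<phi> b) (at_right b)" using ct[of b] by (auto simp: isCont_def intro: filterlim_at_within_not_equal tendsto_within_subset)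
    moreover have "(\<phi> \<longlongrightarrow> 0) (at_right b)"
      by (rule tendsto_eventually) (use ab(2) in \<open>auto simp: eventually_at_filter\<close>)
    ultimately have b0: "\<phi> b = 0" using tendsto_unique[OF trivial_limit_at_right_real] by blast
    show thesis using that(1)[OF True ab a0 b0] .
  qed
qed

lemma set_integral_shrink:
  fixes w \<phi> :: "real \<Rightarrow> real"
  assumes "{a..b} \<subseteq> B" "\<And>x. x \<notin> {a..b} \<Longrightarrow> \<phi> x = 0"
  shows "(LINT x:B|lborel. w x * \<phi> x) = (LINT x:{a..b}|lborel. \<phi> x * w x)"
    and "set_integrable lborel B (\<lambda>x. w x * \<phi> x) \<longleftrightarrow> set_integrable lborel {a..b} (\<lambda>x. \<phi> x * w x)"
proof -
  have "(\<lambda>x. indicator B x *\<^sub>R (w x * \<phi> x)) = (\<lambda>x. indicator {a..b} x *\<^sub>R (\<phi> x * w x))"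
    using assms by (auto simp: indicator_def fun_eq_iff subset_eq)
  then show "(LINT x:B|lborel. w x * \<phi> x) = (LINT x:{a..b}|lborel. \<phi> x * w x)"
    "set_integrable lborel B (\<lambda>x. w x * \<phi> x) \<longleftrightarrow> set_integrable lborel {a..b} (\<lambda>x. \<phi> x * w x)"
    unfolding set_lebesgue_integral_def set_integrable_def by simp_all
qed

lemma test_fun_set_integrable:
  assumes "test_fun B \<phi>" "\<And>a b. {a..b} \<subseteq> B \<Longrightarrow> set_integrable lborel {a..b} w"
  shows "set_integrable lborel B (\<lambda>x. w x * \<phi> x)"
proof -
  obtain a b where ab: "{a..b} \<subseteq> B" "\<And>x. x \<notin> {a..b} \<Longrightarrow> \<phi> x = 0"
    using assms unfolding test_fun_iff by blast
  then show ?thesis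
    using set_integral_shrink(2)[of a b B \<phi> w] assms(2)[OF ab(1)]
      set_integrable_continuous_mult[OF _ test_fun_continuous[OF assms(1)]] by blast
qed

lemma primitive_on_integral_by_parts:
  assumes p: "primitive_on B v w" and t: "test_fun B \<phi>"
  shows "(LINT x:B|lborel. v x * deriv \<phi> x) = - (LINT x:B|lborel. w x * \<phi> x)"
  using t
proof (cases rule: test_fun_support)
  case (1 a b)
  have d0: "deriv \<phi> x = 0" if "x \<notin> {a..b}" for x
    by (rule deriv_zero_outside[where a = a and b = b]) (use 1(3) that in auto)
  have "primitive_on B \<phi> (deriv \<phi>)"
    by (rule primitive_on_FTC) (auto intro: test_fun_derivative[OF t] test_fun_continuous[OF test_fun_deriv[OF t]])
  from primitive_onD[OF primitive_on_mult[OF p this] 1(1,2)]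
  have 0: "(LINT x:{a..b}|lborel. w x * \<phi> x + v x * deriv \<phi> x) = 0" using 1 by simp
  have i1: "set_integrable lborel {a..b} (\<lambda>x. w x * \<phi> x)"
    using set_integrable_continuous_mult[OF primitive_on_integrable[OF p 1(2)] test_fun_continuous[OF t]]
    by (simp add: mult.commute)
  have cv: "continuous_on {a..b} v" by (rule primitive_on_continuous_Icc[OF p 1(2)])
  have i2: "set_integrable lborel {a..b} (\<lambda>x. v x * deriv \<phi> x)"
    using cv test_fun_continuous[OF test_fun_deriv[OF t]] unfolding set_integrable_def
    by (intro borel_integrable_compact continuous_intros) auto
  have "(LINT x:B|lborel. w x * \<phi> x) = (LINT x:{a..b}|lborel. \<phi> x * w x)"
    by (rule set_integral_shrink(1)[OF 1(2)]) (use 1(3) in blast)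
  moreover have "(LINT x:B|lborel. v x * deriv \<phi> x) = (LINT x:{a..b}|lborel. deriv \<phi> x * v x)"
    by (rule set_integral_shrink(1)[OF 1(2)]) (use d0 in blast)
  ultimately show ?thesis
    using 0 i1 i2 by (simp add: mult.commute)
qed simp

subsection \<open>The fundamental lemma of the calculus of variations\<close>

text \<open>Testing with bumps and passing to the limit by dominated convergence gives a zero
  integral over every compact subinterval. Reading this as "a constant is a primitive of
  \<open>h\<close>" separates the analytic part from the measure-theoretic one.\<close>

lemma annihilator_primitive:
  assumes h: "\<And>a b. {a..b} \<subseteq> B \<Longrightarrow> set_integrable lborel {a..b} h"
    and z: "\<And>\<phi>. test_fun B \<phi> \<Longrightarrow> (LINT x:B|lborel. h x * \<phi> x) = 0"
  shows "primitive_on B (\<lambda>_. 0) h"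
  unfolding primitive_on_def
proof (intro allI impI conjI)
  fix a b :: real assume ab: "a \<le> b" "{a..b} \<subseteq> B"
  show hi: "set_integrable lborel {a..b} h" using h ab by blast
  have z': "(LINT x:{a..b}|lborel. bump n a b x * h x) = 0" for n
  proof -
    have "bump n a b x = 0" if "x \<notin> {a..b}" for x
      by (rule bump_eq_0) (use that in auto)
    then show ?thesis
      using z[OF test_fun_bump[OF ab(2), of n]] set_integral_shrink(1)[OF ab(2), of "bump n a b" h] by simp
  qed
  have "(\<lambda>n. LINT x|lborel. indicator {a..b} x *\<^sub>R (bump n a b x * h x)) \<longlonglongrightarrow> (LINT x|lborel. indicator {a..b} x *\<^sub>R h x)"
  proof (rule integral_dominated_convergence[where w = "\<lambda>x. indicator {a..b} x *\<^sub>R \<bar>h x\<bar>"])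
    show "(\<lambda>x. indicator {a..b} x *\<^sub>R h x) \<in> borel_measurable lborel"
      using hi unfolding set_integrable_def by (rule borel_measurable_integrable)
    show "(\<lambda>x. indicator {a..b} x *\<^sub>R (bump n a b x * h x)) \<in> borel_measurable lborel" for n
      using set_integrable_continuous_mult[OF hi test_fun_continuous[OF test_fun_bump[OF ab(2), of n]]]
      unfolding set_integrable_def by (rule borel_measurable_integrable)
    show "integrable lborel (\<lambda>x. indicator {a..b} x *\<^sub>R \<bar>h x\<bar>)"
      using set_integrable_abs[OF hi] unfolding set_integrable_def .
    show "AE x in lborel. (\<lambda>n. indicator {a..b} x *\<^sub>R (bump n a b x * h x)) \<longlonglongrightarrow> indicator {a..b} x *\<^sub>R h x"
      using AE_lborel_singleton[of a] AE_lborel_singleton[of b]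
    proof eventually_elim
      case (elim x)
      show ?case
      proof (cases "x \<in> {a<..<b}")
        case True
        have "(\<lambda>n. indicator {a..b} x *\<^sub>R (bump n a b x * h x)) \<longlonglongrightarrow> indicator {a..b} x *\<^sub>R (1 * h x)"
          by (intro tendsto_intros bump_tendsto True)
        then show ?thesis by simp
      next
        case False
        then show ?thesis using elim by (auto simp: indicator_def)
      qed
    qed
    show "AE x in lborel. norm (indicator {a..b} x *\<^sub>R (bump n a b x * h x)) \<le> indicator {a..b} x *\<^sub>R \<bar>h x\<bar>" for n
      using bump_bounds[of n a b]
      by (auto simp: indicator_def abs_mult intro!: AE_I2 mult_left_le_one_le)
  qed
  then show "(LINT x:{a..b}|lborel. h x) = 0 - 0"
    using z' unfolding set_lebesgue_integral_def by (simp add: LIMSEQ_const_iff)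
qed

text \<open>The positive and the negative part of \<open>g\<close> are densities of two measures
  that are finite and equal on all right half-lines. Hence the measures agree, and so do the
  densities almost everywhere; both parts can only be equal where \<open>g\<close> vanishes.\<close>

lemma AE_zero_if_tail_integrals_zero:
  fixes g :: "real \<Rightarrow> real"
  assumes g: "integrable lborel g" and z: "\<And>x. (LINT y|lborel. indicator {x<..} y * g y) = 0"
  shows "AE x in lborel. g x = 0"
proof -
  have gm[measurable]: "g \<in> borel_measurable borel" using g borel_measurable_integrable by auto
  let ?M = "density lborel (\<lambda>x. ennreal (g x))" and ?N = "density lborel (\<lambda>x. ennreal (- g x))"
  have gi: "integrable lborel (\<lambda>y. indicator {x<..} y * g y)" for x
    using integrable_mult_indicator[OF _ g, of "{x<..}"] by simp
  have eM: "emeasure ?M {x<..} = (\<integral>\<^sup>+y. ennreal (indicator {x<..} y * g y) \<partial>lborel)" for x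
    by (subst emeasure_density) (auto intro!: nn_integral_cong simp: indicator_def)
  have eN: "emeasure ?N {x<..} = (\<integral>\<^sup>+y. ennreal (- (indicator {x<..} y * g y)) \<partial>lborel)" for x
    by (subst emeasure_density) (auto intro!: nn_integral_cong simp: indicator_def)
  have fM: "emeasure ?M {x<..} < \<infinity>" for x
    using gi[of x] unfolding eM real_integrable_def by (simp add: top.not_eq_extremum)
  have fN: "emeasure ?N {x<..} < \<infinity>" for x
    using gi[of x] unfolding eN real_integrable_def by (simp add: top.not_eq_extremum)
  have eq: "emeasure ?M {x<..} = emeasure ?N {x<..}" for x
  proof -
    have "enn2real (emeasure ?M {x<..}) = enn2real (emeasure ?N {x<..})"
      using z[of x] real_lebesgue_integral_def[OF gi[of x]] unfolding eM eN by simp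
    then show ?thesis using fM[of x] fN[of x]
      by (metis ennreal_enn2real infinity_ennreal_def)
  qed
  have "?M = ?N"
    by (rule measure_eqI_lessThan) (use fM eq in auto)
  then have "AE x in lborel. ennreal (g x) = ennreal (- g x)"
    by (intro sigma_finite_measure.density_unique[OF sigma_finite_lborel]) auto
  then show ?thesis
  proof eventually_elim
    case (elim x)
    then show ?case
      by (cases "g x \<ge> 0") (auto simp: ennreal_neg ennreal_eq_0_iff dest!: sym[of "ennreal (g x)"])
  qed
qed

lemma primitive_on_const_AE_zero:
  assumes p: "primitive_on B (\<lambda>_. c) h" and B: "open B"
  shows "AE x in lborel. x \<in> B \<longrightarrow> h x = 0"
proof -
  have loc: "AE x in lborel. x \<in> {a..b} \<longrightarrow> h x = 0" if ab: "{a..b} \<subseteq> B" for a b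
  proof (cases "a \<le> b")
    case True
    define g where "g x = indicator {a..b} x *\<^sub>R h x" for x
    have gi: "integrable lborel g"
      using primitive_on_integrable[OF p ab] unfolding set_integrable_def g_def .
    have z: "(LINT y|lborel. indicator {x<..} y * g y) = 0" for x
    proof -
      have "(LINT y|lborel. indicator {x<..} y * g y) = (LINT y:{max x a..b}|lborel. h y)"
        unfolding set_lebesgue_integral_def
      proof (rule integral_cong_AE)
        show "(\<lambda>y. indicator {x<..} y * g y) \<in> borel_measurable lborel"
          using borel_measurable_integrable[OF gi] by measurable
        have "set_integrable lborel {max x a..b} h"
          by (rule primitive_on_integrable[OF p]) (use ab in auto)
        then show "(\<lambda>y. indicator {max x a..b} y *\<^sub>R h y) \<in> borel_measurable lborel"
          unfolding set_integrable_def by (rule borel_measurable_integrable)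
        show "AE y in lborel. indicator {x<..} y * g y = indicator {max x a..b} y *\<^sub>R h y"
          using AE_lborel_singleton[of x]
          by eventually_elim (auto simp: g_def indicator_def)
      qed
      also have "\<dots> = 0"
      proof (cases "max x a \<le> b")
        case True
        have "{max x a..b} \<subseteq> B" using ab by auto
        then show ?thesis using primitive_onD(2)[OF p True] by simp
      qed (simp add: set_lebesgue_integral_def)
      finally show ?thesis .
    qed
    from AE_zero_if_tail_integrals_zero[OF gi z] show ?thesis
      by eventually_elim (auto simp: g_def indicator_def split: if_splits)
  qed auto
  \<comment> \<open>An open set is the union of the rational compact intervals inside it; there are
    countably many, so the exceptional null sets can be united.\<close>
  have "AE x in lborel. \<forall>q::rat \<times> rat. {of_rat (fst q)..of_rat (snd q)} \<subseteq> B \<longrightarrow>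
      x \<in> {of_rat (fst q)..of_rat (snd q)} \<longrightarrow> h x = 0"
    unfolding AE_all_countable using loc by auto
  then show ?thesis
  proof eventually_elim
    case (elim x)
    show ?case
    proof
      assume x: "x \<in> B"
      obtain e where e: "e > 0" "cball x e \<subseteq> B" by (meson B x open_contains_cball)
      obtain a where a: "x - e < of_rat a" "of_rat a < x" using of_rat_dense[of "x-e" x] e by auto
      obtain b where b: "x < of_rat b" "of_rat b < x + e" using of_rat_dense[of x "x+e"] e by auto
      have "{of_rat a..of_rat b} \<subseteq> cball x e" using a b unfolding cball_eq_atLeastAtMost by auto
      then show "h x = 0" using elim[rule_format, of "(a, b)"] a b e(2) by auto
    qed
  qed
qed

lemma annihilator_AE_zero:
  assumes "open B" "\<And>a b. {a..b} \<subseteq> B \<Longrightarrow> set_integrable lborel {a..b} h"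
    and "\<And>\<phi>. test_fun B \<phi> \<Longrightarrow> (LINT x:B|lborel. h x * \<phi> x) = 0"
  shows "AE x in lborel. x \<in> B \<longrightarrow> h x = 0"
  using primitive_on_const_AE_zero[OF annihilator_primitive[OF assms(2,3)] assms(1)] .

text \<open>Makes the choice by \<open>SOME\<close> in \<open>Hdot_norm\<close> irrelevant.\<close>

lemma weak_deriv_unique:
  assumes "open B" "weak_deriv B n v w" "weak_deriv B n v w'"
  shows "AE x in lborel. x \<in> B \<longrightarrow> w x = w' x"
proof -
  have i: "set_integrable lborel {a..b} w" "set_integrable lborel {a..b} w'" if "{a..b} \<subseteq> B" for a b
    using assms that unfolding weak_deriv_def by auto
  have "AE x in lborel. x \<in> B \<longrightarrow> w x - w' x = 0"
  proof (rule annihilator_AE_zero[OF assms(1)])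
    show "set_integrable lborel {a..b} (\<lambda>x. w x - w' x)" if "{a..b} \<subseteq> B" for a b
      using i[OF that] by simp
    fix \<phi> assume t: "test_fun B \<phi>"
    have "(-1) ^ n * (LINT x:B|lborel. w x * \<phi> x) = (-1) ^ n * (LINT x:B|lborel. w' x * \<phi> x)"
      using assms(2,3) t unfolding weak_deriv_def by simp
    then have "(LINT x:B|lborel. w x * \<phi> x) = (LINT x:B|lborel. w' x * \<phi> x)" by simp
    then show "(LINT x:B|lborel. (w x - w' x) * \<phi> x) = 0"
      using test_fun_set_integrable[OF t i(1)] test_fun_set_integrable[OF t i(2)]
      by (simp add: left_diff_distrib)
  qed
  then show ?thesis by simp
qed

section \<open>Weakly differentiable functions on the line agree almost everywhere with
  primitives\<close>

lemma primitive_exists: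
  assumes "\<And>a b. set_integrable lborel {a..b} w"
  shows "\<exists>V. primitive_on UNIV V w"
proof -
  define V where "V x = (if x \<ge> 0 then (LINT y:{0..x}|lborel. w y) else - (LINT y:{x..0}|lborel. w y))" for x
  have "(LINT y:{a..b}|lborel. w y) = V b - V a" if "a \<le> b" for a b
  proof -
    consider "0 \<le> a" | "a < 0" "0 \<le> b" | "b < 0" by linarith
    then show ?thesis
    proof cases
      case 1
      then show ?thesis using that set_integral_Icc_combine[OF assms, of 0 a b] by (simp add: V_def)
    next
      case 2
      then show ?thesis using that set_integral_Icc_combine[OF assms, of a 0 b] by (simp add: V_def)
    next
      case 3
      then show ?thesis using that set_integral_Icc_combine[OF assms, of a b 0] by (simp add: V_def)
    qed
  qed
  then have "primitive_on UNIV V w" unfolding primitive_on_def using assms by auto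
  then show ?thesis by blast
qed

text \<open>The primitive that starts at the left end of the support vanishes again to the right of
  it precisely because the mean of \<open>\<zeta>\<close> is zero.\<close>

lemma test_fun_antiderivative:
  assumes t: "test_fun UNIV \<zeta>" and z: "(LINT x:UNIV|lborel. 1 * \<zeta> x) = 0"
  shows "\<exists>\<Phi>. test_fun UNIV \<Phi> \<and> deriv \<Phi> = \<zeta>"
proof -
  obtain L0 U where LU0: "\<And>x. x \<notin> {L0..U} \<Longrightarrow> \<zeta> x = 0"
    using t unfolding test_fun_iff by blast
  \<comment> \<open>The given interval may be empty; enlarging it ensures
    \<open>L \<le> U\<close>.\<close>
  define L where "L = min L0 U"
  have LU: "\<zeta> x = 0" if "x \<notin> {L..U}" for x using LU0 that unfolding L_def by auto
  have "L \<le> U" by (simp add: L_def)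
  have c: "continuous_on A \<zeta>" for A by (rule test_fun_continuous[OF t])
  have "set_integrable lborel {a..b} \<zeta>" for a b
    unfolding set_integrable_def by (intro borel_integrable_compact c) auto
  then obtain P where P: "primitive_on UNIV P \<zeta>" using primitive_exists by blast
  define \<Phi> where "\<Phi> x = P x + (- P L)" for x
  have p: "primitive_on UNIV \<Phi> \<zeta>" unfolding \<Phi>_def by (rule primitive_on_add_const[OF P])
  have d: "(\<Phi> has_real_derivative \<zeta> x) (at x)" for x
    by (rule primitive_on_has_derivative[OF p]) (auto intro: c)
  have dd: "deriv \<Phi> = \<zeta>" using d DERIV_imp_deriv by blast
  have "times_differentiable n \<Phi>" for n
  proof (cases n)
    case (Suc m)
    then show ?thesis using times_differentiable_SucI[OF d] t unfolding test_fun_iff by blast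
  qed simp
  moreover have "\<Phi> x = 0" if "x \<notin> {L..U}" for x
  proof (cases "x < L")
    case True
    have "(LINT y:{x..L}|lborel. \<zeta> y) = (LINT y:{x..L}|lborel. 0)"
      unfolding set_lebesgue_integral_def
    proof (rule integral_cong_AE)
      show "(\<lambda>y. indicator {x..L} y *\<^sub>R \<zeta> y) \<in> borel_measurable lborel"
        using borel_measurable_continuous_on_indicator[OF _ c, of "{x..L}"] by simp
      show "AE y in lborel. indicator {x..L} y *\<^sub>R \<zeta> y = indicator {x..L} y *\<^sub>R 0"
        using AE_lborel_singleton[of L]
        by eventually_elim (use LU in \<open>auto simp: indicator_def\<close>)
    qed simp
    then show ?thesis using primitive_onD(2)[OF P, of x L] True by (simp add: \<Phi>_def)
  next
    case False
    then have x: "U < x" "L \<le> x" using that \<open>L \<le> U\<close> by auto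
    have "(LINT y:{L..x}|lborel. \<zeta> y) = 0"
      using set_integral_shrink(1)[of L x UNIV \<zeta> "\<lambda>_. 1"] LU x z by force
    then show ?thesis using primitive_onD(2)[OF P x(2)] by (simp add: \<Phi>_def)
  qed
  ultimately show ?thesis unfolding test_fun_iff using dd by blast
qed

text \<open>The difference \<open>h\<close> of \<open>v\<close> and a primitive \<open>V\<close> of
  \<open>w\<close> annihilates all derivatives of test functions, that is, all test functions of
  mean zero. Subtracting a multiple of one fixed bump turns any test function into such a one, so
  \<open>h\<close> minus a constant annihilates everything and vanishes almost everywhere.\<close>

lemma du_Bois_Reymond:
  assumes v: "\<And>a b. set_integrable lborel {a..b} v" and w: "\<And>a b. set_integrable lborel {a..b} w"
    and e: "\<And>\<phi>. test_fun UNIV \<phi> \<Longrightarrow> (LINT x:UNIV|lborel. v x * deriv \<phi> x) = - (LINT x:UNIV|lborel. w x * \<phi> x)"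
  shows "\<exists>V. primitive_on UNIV V w \<and> (AE x in lborel. v x = V x)"
proof -
  obtain V where V: "primitive_on UNIV V w" using primitive_exists[OF w] by blast
  have Vi: "set_integrable lborel {a..b} V" for a b
    unfolding set_integrable_def
    by (intro borel_integrable_compact primitive_on_continuous_Icc[OF V]) auto
  define h where "h x = v x - V x" for x
  have hi: "set_integrable lborel {a..b} h" for a b unfolding h_def using v Vi by simp
  have h0: "(LINT x:UNIV|lborel. h x * deriv \<phi> x) = 0" if t: "test_fun UNIV \<phi>" for \<phi>
    using e[OF t] primitive_on_integral_by_parts[OF V t]
      test_fun_set_integrable[OF test_fun_deriv[OF t], of v] test_fun_set_integrable[OF test_fun_deriv[OF t], of V] v Vi
    unfolding h_def by (simp add: left_diff_distrib)
  define \<eta> where "\<eta> = bump 0 0 1"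
  have te: "test_fun UNIV \<eta>" unfolding \<eta>_def by (rule test_fun_bump) simp
  have one: "set_integrable lborel {a..b} (\<lambda>_. 1::real)" for a b :: real
    unfolding set_integrable_def by (intro borel_integrable_compact) auto
  define I where "I \<phi> = (LINT x:UNIV|lborel. 1 * \<phi> x)" for \<phi> :: "real \<Rightarrow> real"
  have "I \<eta> \<noteq> 0"
  proof
    assume "I \<eta> = 0"
    have i: "integrable lborel \<eta>"
      using test_fun_set_integrable[OF te one] by (simp add: set_integrable_def)
    have "AE x in lborel. \<eta> x = 0"
      using integral_nonneg_eq_0_iff_AE[OF i] \<open>I \<eta> = 0\<close> bump_bounds
      by (auto simp: I_def set_lebesgue_integral_def \<eta>_def)
    then have "AE x in lborel. x \<notin> {0<..<1::real}"
    proof eventually_elim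
      case (elim x)
      then show ?case using bump_pos[of x 0 1 0] unfolding \<eta>_def by auto
    qed
    then have "emeasure lborel {x \<in> space lborel. \<not> x \<notin> {0<..<1::real}} = 0"
      by (subst (asm) AE_iff_measurable[OF _ refl]) auto
    moreover have "{x \<in> space lborel. \<not> x \<notin> {0<..<1::real}} = {0<..<1}" by auto
    ultimately show False using emeasure_lborel_Ioo[of 0 1] by (metis diff_zero ennreal_eq_0_iff not_one_le_zero zero_le_one)
  qed
  define c where "c = (LINT x:UNIV|lborel. h x * \<eta> x) / I \<eta>"
  have "AE x in lborel. x \<in> UNIV \<longrightarrow> h x - c = 0"
  proof (rule annihilator_AE_zero)
    show "set_integrable lborel {a..b} (\<lambda>x. h x - c)" for a b
      using hi set_integrable_mult_right[of c lborel "{a..b}" "\<lambda>_. 1"] one by simp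
    fix \<psi> assume t: "test_fun UNIV \<psi>"
    \<comment> \<open>The multiple of the bump that brings the mean of \<open>\<zeta>\<close> to
      zero; the constant \<open>c\<close> above is the correspondingly weighted mean of
      \<open>h\<close>.\<close>
    define a where "a = - I \<psi> / I \<eta>"
    define \<zeta> where "\<zeta> x = \<psi> x + a * \<eta> x" for x
    have tx: "test_fun UNIV \<zeta>"
    proof -
      have "times_differentiable n \<zeta>" for n
        using t te unfolding test_fun_iff \<zeta>_def
        by (intro times_differentiable_add times_differentiable_cmult) auto
      moreover obtain p q where pq: "\<And>x. x \<notin> {p..q} \<Longrightarrow> \<psi> x = 0"
        using t unfolding test_fun_iff by blast
      have "\<zeta> x = 0" if "x \<notin> {min p 0..max q 1}" for x
      proof -
        have "\<psi> x = 0" by (rule pq) (use that in auto)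
        moreover have "\<eta> x = 0" unfolding \<eta>_def by (rule bump_eq_0) (use that in auto)
        ultimately show ?thesis by (simp add: \<zeta>_def)
      qed
      ultimately show ?thesis unfolding test_fun_iff by blast
    qed
    note ii = test_fun_set_integrable[OF t one] test_fun_set_integrable[OF te one]
      test_fun_set_integrable[OF t hi] test_fun_set_integrable[OF te hi]
    have "(LINT x:UNIV|lborel. 1 * \<zeta> x) = (LINT x:UNIV|lborel. 1 * \<psi> x + a * (1 * \<eta> x))"
      by (simp add: \<zeta>_def)
    also have "\<dots> = I \<psi> + a * I \<eta>"
      unfolding I_def using ii by (subst set_integral_add) auto
    also have "\<dots> = 0" using \<open>I \<eta> \<noteq> 0\<close> by (simp add: a_def)
    finally obtain \<Phi> where \<Phi>: "test_fun UNIV \<Phi>" "deriv \<Phi> = \<zeta>"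
      using test_fun_antiderivative[OF tx] by blast
    have "0 = (LINT x:UNIV|lborel. h x * \<zeta> x)" using h0[OF \<Phi>(1)] \<Phi>(2) by simp
    also have "\<dots> = (LINT x:UNIV|lborel. h x * \<psi> x + a * (h x * \<eta> x))"
      by (simp add: \<zeta>_def algebra_simps)
    also have "\<dots> = (LINT x:UNIV|lborel. h x * \<psi> x) + a * (LINT x:UNIV|lborel. h x * \<eta> x)"
      using ii by (subst set_integral_add) auto
    finally have "(LINT x:UNIV|lborel. h x * \<psi> x) = c * I \<psi>" by (simp add: a_def c_def)
    moreover have "(LINT x:UNIV|lborel. (h x - c) * \<psi> x) = (LINT x:UNIV|lborel. h x * \<psi> x - c * (1 * \<psi> x))"
      by (simp add: algebra_simps)
    moreover have "\<dots> = (LINT x:UNIV|lborel. h x * \<psi> x) - c * I \<psi>"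
      unfolding I_def using ii by (subst set_integral_diff) auto
    ultimately show "(LINT x:UNIV|lborel. (h x - c) * \<psi> x) = 0" by simp
  qed simp
  then have "AE x in lborel. v x = V x + c" by eventually_elim (simp add: h_def algebra_simps)
  then show ?thesis using primitive_on_add_const[OF V, of c] by blast
qed

subsection \<open>Scale-invariant Sobolev bounds on an interval\<close>

text \<open>For \<open>m > 0\<close> the bound says that \<open>r ^ j\<close> times the \<open>j\<close>-th derivative of \<open>v\<close> is at most \<open>M\<close> on
  the ball for \<open>j < m\<close>, and that \<open>r powr (m - 1/2)\<close> times the \<open>L2\<close> norm of the \<open>m\<close>-th weak
  derivative is at most \<open>M\<close>.\<close>

primrec sobolev_bound :: "real \<Rightarrow> real \<Rightarrow> nat \<Rightarrow> (real \<Rightarrow> real) \<Rightarrow> real \<Rightarrow> bool" where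
  "sobolev_bound c r 0 v M \<longleftrightarrow>
     sq_int (ball c r) v \<and> (LINT x:ball c r|lborel. (v x)\<^sup>2) \<le> M\<^sup>2 * r"
| "sobolev_bound c r (Suc m) v M \<longleftrightarrow>
     (\<forall>x\<in>ball c r. \<bar>v x\<bar> \<le> M) \<and>
     (\<exists>w. primitive_on (ball c r) v w \<and> sobolev_bound c r m w (M / r))"

lemma sobolev_bound_cong:
  assumes "sobolev_bound c r m v M" "\<And>x. x \<in> ball c r \<Longrightarrow> v x = v' x"
  shows "sobolev_bound c r m v' M"
proof (cases m)
  case 0
  have 1: "indicator (ball c r) x *\<^sub>R v x = indicator (ball c r) x *\<^sub>R v' x" for x
    using assms(2) by (auto simp: indicator_def)
  have 2: "indicator (ball c r) x *\<^sub>R (v x)\<^sup>2 = indicator (ball c r) x *\<^sub>R (v' x)\<^sup>2" for x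
    using assms(2) by (auto simp: indicator_def)
  show ?thesis
    using assms(1) 0
    by (simp add: sq_int_def set_borel_measurable_def set_integrable_def set_lebesgue_integral_def 1 2
        del: real_scaleR_def)
next
  case (Suc n)
  then obtain w where w: "primitive_on (ball c r) v w" "sobolev_bound c r n w (M / r)"
    using assms(1) by auto
  have "primitive_on (ball c r) v' w" by (rule primitive_on_cong[OF w(1)]) (use assms(2) in auto)
  then show ?thesis using Suc assms w by auto
qed

lemma sobolev_bound_mono:
  "sobolev_bound c r m v M \<Longrightarrow> 0 \<le> M \<Longrightarrow> M \<le> M' \<Longrightarrow> 0 < r \<Longrightarrow> sobolev_bound c r m v M'"
proof (induction m arbitrary: v M M')
  case 0
  have "M\<^sup>2 * r \<le> M'\<^sup>2 * r" using 0 by (intro mult_right_mono power_mono) auto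
  then show ?case using 0(1) by (auto intro: order_trans)
next
  case (Suc m)
  obtain w where w: "primitive_on (ball c r) v w" "sobolev_bound c r m w (M / r)"
    using Suc.prems by auto
  have "sobolev_bound c r m w (M' / r)"
    by (rule Suc.IH[OF w(2)]) (use Suc.prems in \<open>auto simp: divide_right_mono\<close>)
  then show ?case using Suc.prems w by force
qed

lemma sobolev_bound_continuous:
  "sobolev_bound c r (Suc m) v M \<Longrightarrow> continuous_on (ball c r) v"
  by (auto intro: primitive_on_continuous)

lemma sobolev_bound_sup: "sobolev_bound c r (Suc m) v M \<Longrightarrow> x \<in> ball c r \<Longrightarrow> \<bar>v x\<bar> \<le> M"
  by simp

lemma sobolev_bound_nonneg:
  assumes "sobolev_bound c r (Suc m) v M" "r > 0"
  shows "0 \<le> M"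
proof -
  have "\<bar>v c\<bar> \<le> M" using assms by auto
  then show ?thesis by linarith
qed

lemma emeasure_ball_real: "r > 0 \<Longrightarrow> emeasure lborel (ball c r :: real set) = ennreal (2 * r)"
  by (simp add: ball_eq_greaterThanLessThan)

lemma sobolev_bound_0_if_bounded:
  assumes "continuous_on (ball c r) v" "\<And>x. x \<in> ball c r \<Longrightarrow> \<bar>v x\<bar> \<le> M" "r > 0" "0 \<le> M"
  shows "sobolev_bound c r 0 v (2 * M)"
proof -
  have m1: "set_borel_measurable lborel (ball c r) v"
    unfolding set_borel_measurable_def
    using borel_measurable_continuous_on_indicator[OF _ assms(1)] by simp
  have m2: "set_borel_measurable lborel (ball c r) (\<lambda>x. (v x)\<^sup>2)"
    unfolding set_borel_measurable_def
    using borel_measurable_continuous_on_indicator[OF _ continuous_on_power[OF assms(1)]] by simp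
  have sq: "(v x)\<^sup>2 \<le> M\<^sup>2" if "x \<in> ball c r" for x
    using power_mono[OF assms(2)[OF that], of 2] by simp
  have ci: "set_integrable lborel (ball c r) (\<lambda>_. M\<^sup>2)"
    unfolding set_integrable_def using emeasure_ball_real[OF assms(3), of c] by simp
  have i: "set_integrable lborel (ball c r) (\<lambda>x. (v x)\<^sup>2)"
    by (rule set_integrable_bound[OF ci m2]) (use sq in auto)
  have "(LINT x:ball c r|lborel. (v x)\<^sup>2) \<le> (LINT x:ball c r|lborel. M\<^sup>2)"
    by (rule set_integral_mono[OF i ci sq])
  also have "\<dots> = M\<^sup>2 * (2 * r)"
    using emeasure_ball_real[OF assms(3), of c] assms(3)
    by (simp add: set_lebesgue_integral_def measure_def)
  also have "\<dots> \<le> (2 * M)\<^sup>2 * r"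
    using assms(3) by (simp add: power_mult_distrib)
  finally show ?thesis using m1 i by (simp add: sq_int_def)
qed

text \<open>Giving up one derivative turns the sup bound of the new top order into an L2 bound. The
  ball has length 2 * r, and sqrt 2 is rounded up to 2.\<close>

lemma sobolev_bound_lower:
  "sobolev_bound c r (Suc m) v M \<Longrightarrow> 0 < r \<Longrightarrow> sobolev_bound c r m v (2 * M)"
proof (induction m arbitrary: v M)
  case 0
  show ?case
    by (rule sobolev_bound_0_if_bounded[OF sobolev_bound_continuous[OF 0(1)] _ 0(2) sobolev_bound_nonneg[OF 0]])
      (use 0 in auto)
next
  case (Suc m)
  have "0 \<le> M" by (rule sobolev_bound_nonneg[OF Suc.prems])
  moreover obtain w where w: "primitive_on (ball c r) v w" "sobolev_bound c r (Suc m) w (M / r)"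
    using Suc.prems unfolding sobolev_bound.simps(2)[of _ _ "Suc m"] by blast
  moreover have "sobolev_bound c r m w (2 * M / r)" using Suc.IH[OF w(2)] Suc.prems by simp
  moreover have "\<bar>v x\<bar> \<le> 2 * M" if "x \<in> ball c r" for x
  proof -
    have "\<bar>v x\<bar> \<le> M" using Suc.prems(1) that by simp
    then show ?thesis using \<open>0 \<le> M\<close> by linarith
  qed
  ultimately show ?case by auto
qed

section \<open>The scale-invariant bounds form an algebra\<close>

lemma sobolev_bound_add:
  "sobolev_bound c r m v M1 \<Longrightarrow> sobolev_bound c r m z M2 \<Longrightarrow> 0 \<le> M1 \<Longrightarrow> 0 \<le> M2 \<Longrightarrow> 0 < r \<Longrightarrow>
    sobolev_bound c r m (\<lambda>x. v x + z x) (2 * (M1 + M2))"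
proof (induction m arbitrary: v z M1 M2)
  case 0
  let ?B = "ball c r"
  have v: "set_borel_measurable lborel ?B v" "set_integrable lborel ?B (\<lambda>x. (v x)\<^sup>2)"
      "(LINT x:?B|lborel. (v x)\<^sup>2) \<le> M1\<^sup>2 * r"
    and z: "set_borel_measurable lborel ?B z" "set_integrable lborel ?B (\<lambda>x. (z x)\<^sup>2)"
      "(LINT x:?B|lborel. (z x)\<^sup>2) \<le> M2\<^sup>2 * r"
    using 0 by (auto simp: sq_int_def)
  have m: "set_borel_measurable lborel ?B (\<lambda>x. v x + z x)"
    using v(1) z(1) unfolding set_borel_measurable_def scaleR_add_right by measurable
  have "(\<lambda>x. (indicator ?B x *\<^sub>R (v x + z x))\<^sup>2) \<in> borel_measurable lborel"
    using m unfolding set_borel_measurable_def by measurable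
  moreover have "(\<lambda>x. (indicator ?B x *\<^sub>R (v x + z x))\<^sup>2) = (\<lambda>x. indicator ?B x *\<^sub>R (v x + z x)\<^sup>2)"
    by (auto simp: indicator_def)
  ultimately have m2: "set_borel_measurable lborel ?B (\<lambda>x. (v x + z x)\<^sup>2)"
    unfolding set_borel_measurable_def by simp
  have di: "set_integrable lborel ?B (\<lambda>x. 2 * (v x)\<^sup>2 + 2 * (z x)\<^sup>2)"
    using v z by (intro set_integral_add) auto
  \<comment> \<open>This is where the factor 2 comes from; the induction passes it on unchanged, so
    it does not accumulate with the order.\<close>
  have le: "(v x + z x)\<^sup>2 \<le> 2 * (v x)\<^sup>2 + 2 * (z x)\<^sup>2" for x
    using zero_le_power2[of "v x - z x"] unfolding power2_diff power2_sum by linarith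
  have i: "set_integrable lborel ?B (\<lambda>x. (v x + z x)\<^sup>2)"
    by (rule set_integrable_bound[OF di m2]) (use le in \<open>auto simp: abs_of_nonneg\<close>)
  have "(LINT x:?B|lborel. (v x + z x)\<^sup>2) \<le> (LINT x:?B|lborel. 2 * (v x)\<^sup>2 + 2 * (z x)\<^sup>2)"
    by (rule set_integral_mono[OF i di le])
  also have "\<dots> = 2 * (LINT x:?B|lborel. (v x)\<^sup>2) + 2 * (LINT x:?B|lborel. (z x)\<^sup>2)"
    using v z by (subst set_integral_add) auto
  also have "\<dots> \<le> 2 * (M1\<^sup>2 * r) + 2 * (M2\<^sup>2 * r)" using v z by linarith
  also have "\<dots> = (2 * M1\<^sup>2 + 2 * M2\<^sup>2) * r" by (simp add: algebra_simps)
  also have "\<dots> \<le> (2 * (M1 + M2))\<^sup>2 * r"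
  proof (rule mult_right_mono)
    have "0 \<le> M1 * M2" "0 \<le> M1\<^sup>2" "0 \<le> M2\<^sup>2" using 0 by auto
    moreover have "(2 * (M1 + M2))\<^sup>2 = 4 * M1\<^sup>2 + 4 * M2\<^sup>2 + 8 * (M1 * M2)"
      by (simp add: power2_eq_square algebra_simps)
    ultimately show "2 * M1\<^sup>2 + 2 * M2\<^sup>2 \<le> (2 * (M1 + M2))\<^sup>2" by linarith
  qed (use 0 in auto)
  finally show ?case using m i by (simp add: sq_int_def)
next
  case (Suc m)
  obtain w where w: "primitive_on (ball c r) v w" "sobolev_bound c r m w (M1 / r)"
    using Suc.prems by auto
  obtain y where y: "primitive_on (ball c r) z y" "sobolev_bound c r m y (M2 / r)"
    using Suc.prems by auto
  have "sobolev_bound c r m (\<lambda>x. w x + y x) (2 * (M1 / r + M2 / r))"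
    by (rule Suc.IH[OF w(2) y(2)]) (use Suc.prems in auto)
  then have "sobolev_bound c r m (\<lambda>x. w x + y x) (2 * (M1 + M2) / r)"
    by (simp add: add_divide_distrib)
  moreover have "\<bar>v x + z x\<bar> \<le> 2 * (M1 + M2)" if "x \<in> ball c r" for x
  proof -
    have "\<bar>v x\<bar> \<le> M1" "\<bar>z x\<bar> \<le> M2" using Suc.prems that by auto
    then have "\<bar>v x + z x\<bar> \<le> M1 + M2" by (intro order_trans[OF abs_triangle_ineq] add_mono)
    also have "\<dots> \<le> 2 * (M1 + M2)" using Suc.prems(3,4) by simp
    finally show ?thesis .
  qed
  ultimately show ?case using primitive_on_add[OF w(1) y(1)] by auto
qed

lemma sobolev_bound_0_mult:
  assumes v: "sobolev_bound c r 0 v M1" and z: "continuous_on (ball c r) z" "\<And>x. x \<in> ball c r \<Longrightarrow> \<bar>z x\<bar> \<le> M2"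
    and "r > 0"
  shows "sobolev_bound c r 0 (\<lambda>x. v x * z x) (M1 * M2)"
proof -
  let ?B = "ball c r"
  have v: "set_borel_measurable lborel ?B v" "set_integrable lborel ?B (\<lambda>x. (v x)\<^sup>2)"
      "(LINT x:?B|lborel. (v x)\<^sup>2) \<le> M1\<^sup>2 * r"
    using assms by (auto simp: sq_int_def)
  have z1: "set_borel_measurable lborel ?B z"
    unfolding set_borel_measurable_def
    using borel_measurable_continuous_on_indicator[OF _ z(1)] by simp
  have "(\<lambda>x. (indicator ?B x *\<^sub>R v x) * (indicator ?B x *\<^sub>R z x)) \<in> borel_measurable lborel"
    using v(1) z1 unfolding set_borel_measurable_def by measurable
  moreover have "(\<lambda>x. (indicator ?B x *\<^sub>R v x) * (indicator ?B x *\<^sub>R z x)) = (\<lambda>x. indicator ?B x *\<^sub>R (v x * z x))"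
    by (auto simp: indicator_def)
  ultimately have m: "set_borel_measurable lborel ?B (\<lambda>x. v x * z x)"
    unfolding set_borel_measurable_def by simp
  have "(\<lambda>x. (indicator ?B x *\<^sub>R (v x * z x))\<^sup>2) \<in> borel_measurable lborel"
    using m unfolding set_borel_measurable_def by measurable
  moreover have "(\<lambda>x. (indicator ?B x *\<^sub>R (v x * z x))\<^sup>2) = (\<lambda>x. indicator ?B x *\<^sub>R (v x * z x)\<^sup>2)"
    by (auto simp: indicator_def)
  ultimately have m2: "set_borel_measurable lborel ?B (\<lambda>x. (v x * z x)\<^sup>2)"
    unfolding set_borel_measurable_def by simp
  have di: "set_integrable lborel ?B (\<lambda>x. M2\<^sup>2 * (v x)\<^sup>2)"
    using v by auto
  have le: "(v x * z x)\<^sup>2 \<le> M2\<^sup>2 * (v x)\<^sup>2" if "x \<in> ?B" for x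
  proof -
    have "(z x)\<^sup>2 \<le> M2\<^sup>2" using power_mono[OF z(2)[OF that], of 2] by simp
    then show ?thesis using mult_right_mono[of "(z x)\<^sup>2" "M2\<^sup>2" "(v x)\<^sup>2"] by (simp add: power_mult_distrib mult.commute)
  qed
  have i: "set_integrable lborel ?B (\<lambda>x. (v x * z x)\<^sup>2)"
    by (rule set_integrable_bound[OF di m2]) (use le in \<open>auto intro!: AE_I2\<close>)
  have "(LINT x:?B|lborel. (v x * z x)\<^sup>2) \<le> (LINT x:?B|lborel. M2\<^sup>2 * (v x)\<^sup>2)"
    by (rule set_integral_mono[OF i di le])
  also have "\<dots> = M2\<^sup>2 * (LINT x:?B|lborel. (v x)\<^sup>2)" by simp
  also have "\<dots> \<le> M2\<^sup>2 * (M1\<^sup>2 * r)" using v by (intro mult_left_mono) auto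
  also have "\<dots> = (M1 * M2)\<^sup>2 * r" by (simp add: power_mult_distrib)
  finally show ?thesis using m i by (simp add: sq_int_def)
qed

lemma sobolev_bound_cmult:
  "sobolev_bound c r m v M \<Longrightarrow> 0 < r \<Longrightarrow> sobolev_bound c r m (\<lambda>x. a * v x) (\<bar>a\<bar> * M)"
proof (induction m arbitrary: v M)
  case 0
  have "sobolev_bound c r 0 (\<lambda>x. v x * a) (M * \<bar>a\<bar>)"
    by (rule sobolev_bound_0_mult) (use 0 in \<open>auto intro!: continuous_intros\<close>)
  then show ?case by (simp add: mult.commute)
next
  case (Suc m)
  obtain w where w: "primitive_on (ball c r) v w" "sobolev_bound c r m w (M / r)"
    using Suc.prems by auto
  have "sobolev_bound c r m (\<lambda>x. a * w x) (\<bar>a\<bar> * M / r)" using Suc.IH[OF w(2)] Suc.prems by simp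
  moreover have "\<bar>a * v x\<bar> \<le> \<bar>a\<bar> * M" if "x \<in> ball c r" for x
    using Suc.prems(1) that by (auto simp: abs_mult intro!: mult_left_mono)
  ultimately show ?case using primitive_on_cmult[OF w(1)] by auto
qed

text \<open>The second factor has one derivative more, so at order zero it is bounded and continuous
  while the first is only L2. In the product rule the roles are exchanged in the term containing the
  derivative of \<open>z\<close>. The 8 per order comes from two lowerings by a factor 2, which add
  up to 4, and the factor 2 of the sum.\<close>

lemma sobolev_bound_mult_Suc:
  "sobolev_bound c r m v M1 \<Longrightarrow> sobolev_bound c r (Suc m) z M2 \<Longrightarrow> 0 \<le> M1 \<Longrightarrow> 0 < r \<Longrightarrow>
    sobolev_bound c r m (\<lambda>x. v x * z x) (8 ^ m * (M1 * M2))"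
proof (induction m arbitrary: v z M1 M2)
  case 0
  have "sobolev_bound c r 0 (\<lambda>x. v x * z x) (M1 * M2)"
    by (rule sobolev_bound_0_mult[OF 0(1) sobolev_bound_continuous[OF 0(2)]]) (use 0 in auto)
  then show ?case by simp
next
  case (Suc m)
  note r = \<open>0 < r\<close>
  have M2: "0 \<le> M2" using sobolev_bound_nonneg Suc.prems by blast
  obtain w where w: "primitive_on (ball c r) v w" "sobolev_bound c r m w (M1 / r)"
    using Suc.prems by auto
  obtain y where y: "primitive_on (ball c r) z y" "sobolev_bound c r (Suc m) y (M2 / r)"
    using Suc.prems(2) unfolding sobolev_bound.simps(2)[of _ _ "Suc m"] by blast
  have 1: "sobolev_bound c r m (\<lambda>x. w x * z x) (8 ^ m * (M1 / r * (2 * M2)))"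
    using Suc.IH[OF w(2) sobolev_bound_lower[OF Suc.prems(2) r]] Suc.prems r by simp
  have 2: "sobolev_bound c r m (\<lambda>x. y x * v x) (8 ^ m * (2 * (M2 / r) * M1))"
    using Suc.IH[OF sobolev_bound_lower[OF y(2) r] Suc.prems(1)] M2 r by simp
  have "sobolev_bound c r m (\<lambda>x. w x * z x + y x * v x)
      (2 * (8 ^ m * (M1 / r * (2 * M2)) + 8 ^ m * (2 * (M2 / r) * M1)))"
    by (rule sobolev_bound_add[OF 1 2]) (use Suc.prems M2 in auto)
  moreover have "2 * (8 ^ m * (M1 / r * (2 * M2)) + 8 ^ m * (2 * (M2 / r) * M1)) = 8 ^ Suc m * (M1 * M2) / r"
    using r by (simp add: field_simps)
  ultimately have "sobolev_bound c r m (\<lambda>x. w x * z x + y x * v x) (8 ^ Suc m * (M1 * M2) / r)"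
    by (simp only:)
  then have b: "sobolev_bound c r m (\<lambda>x. w x * z x + v x * y x) (8 ^ Suc m * (M1 * M2) / r)"
    by (rule sobolev_bound_cong) (simp add: mult.commute)
  have "\<bar>v x * z x\<bar> \<le> 8 ^ Suc m * (M1 * M2)" if "x \<in> ball c r" for x
  proof -
    have "\<bar>v x * z x\<bar> \<le> M1 * M2"
      using Suc.prems that unfolding abs_mult by (intro mult_mono) auto
    also have "\<dots> \<le> 8 ^ Suc m * (M1 * M2)"
      using mult_right_mono[of 1 "8 ^ Suc m" "M1 * M2"] Suc.prems M2 one_le_power[of "8::real" "Suc m"] by simp
    finally show ?thesis .
  qed
  then show ?case using b primitive_on_mult[OF w(1) y(1)] by auto
qed

text \<open>In each term of the product rule only one factor has lost a derivative, so the
  unequal-order estimate applies to both terms.\<close>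

lemma sobolev_bound_mult:
  assumes v: "sobolev_bound c r (Suc m) v M1" and z: "sobolev_bound c r (Suc m) z M2" and r: "0 < r"
  shows "sobolev_bound c r (Suc m) (\<lambda>x. v x * z x) (8 ^ Suc m * (M1 * M2))"
proof -
  have M: "0 \<le> M1" "0 \<le> M2" using sobolev_bound_nonneg assms by blast+
  obtain w where w: "primitive_on (ball c r) v w" "sobolev_bound c r m w (M1 / r)"
    using v by auto
  obtain y where y: "primitive_on (ball c r) z y" "sobolev_bound c r m y (M2 / r)"
    using z by auto
  have 1: "sobolev_bound c r m (\<lambda>x. w x * z x) (8 ^ m * (M1 / r * M2))"
    using sobolev_bound_mult_Suc[OF w(2) z] M r by simp
  have 2: "sobolev_bound c r m (\<lambda>x. y x * v x) (8 ^ m * (M2 / r * M1))"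
    using sobolev_bound_mult_Suc[OF y(2) v] M r by simp
  have b: "sobolev_bound c r m (\<lambda>x. w x * z x + y x * v x) (2 * (8 ^ m * (M1 / r * M2) + 8 ^ m * (M2 / r * M1)))"
    by (rule sobolev_bound_add[OF 1 2]) (use M r in auto)
  have "0 \<le> 8 ^ m * (M1 * M2)" using M by auto
  then have "sobolev_bound c r m (\<lambda>x. w x * z x + y x * v x) (8 ^ Suc m * (M1 * M2) / r)"
    by (intro sobolev_bound_mono[OF b]) (use M r in \<open>auto simp: field_simps\<close>)
  then have b: "sobolev_bound c r m (\<lambda>x. w x * z x + v x * y x) (8 ^ Suc m * (M1 * M2) / r)"
    by (rule sobolev_bound_cong) (simp add: mult.commute)
  have "\<bar>v x * z x\<bar> \<le> 8 ^ Suc m * (M1 * M2)" if "x \<in> ball c r" for x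
  proof -
    have "\<bar>v x * z x\<bar> \<le> M1 * M2"
      using v z that M unfolding abs_mult by (intro mult_mono) auto
    also have "\<dots> \<le> 8 ^ Suc m * (M1 * M2)"
      using mult_right_mono[of 1 "8 ^ Suc m" "M1 * M2"] M one_le_power[of "8::real" "Suc m"] by simp
    finally show ?thesis .
  qed
  then show ?thesis using b primitive_on_mult[OF w(1) y(1)] by auto
qed

lemma sobolev_bound_const:
  assumes "0 < r"
  shows "sobolev_bound c r m (\<lambda>_. a) (2 * \<bar>a\<bar>)"
proof -
  have z: "sobolev_bound c r m (\<lambda>_. 0) 0" for m
  proof (induction m)
    case 0
    show ?case by (simp add: sq_int_def set_borel_measurable_def set_integrable_def)
  next
    case (Suc m)
    have "primitive_on (ball c r) (\<lambda>_. 0) (\<lambda>_. 0)"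
      by (rule primitive_on_FTC) (auto intro!: derivative_eq_intros)
    then show ?case using Suc by auto
  qed
  show ?thesis
  proof (cases m)
    case 0
    show ?thesis unfolding 0
      by (rule sobolev_bound_0_if_bounded) (use assms in auto)
  next
    case (Suc n)
    have "primitive_on (ball c r) (\<lambda>_. a) (\<lambda>_. 0)"
      by (rule primitive_on_FTC) (auto intro!: derivative_eq_intros)
    moreover have "sobolev_bound c r n (\<lambda>_. 0) (2 * \<bar>a\<bar> / r)"
      by (rule sobolev_bound_mono[OF z]) (use assms in auto)
    ultimately show ?thesis unfolding Suc by auto
  qed
qed

lemma sobolev_bound_power:
  assumes "sobolev_bound c r (Suc m) v M" "0 < r"
  shows "sobolev_bound c r (Suc m) (\<lambda>x. v x ^ p) (2 * (8 ^ Suc m * M) ^ p)"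
proof (induction p)
  case 0
  show ?case using sobolev_bound_const[OF assms(2), of c "Suc m" 1] by simp
next
  case (Suc p)
  have "sobolev_bound c r (Suc m) (\<lambda>x. v x * v x ^ p) (8 ^ Suc m * (M * (2 * (8 ^ Suc m * M) ^ p)))"
    by (rule sobolev_bound_mult[OF assms(1) Suc assms(2)])
  then show ?case by (simp add: mult_ac)
qed

section \<open>Composition with the exponential, the inverse and the logarithm\<close>

lemma sobolev_bound_SucI:
  assumes "primitive_on (ball c r) v w" "sobolev_bound c r m w (K / r)" "\<And>x. x \<in> ball c r \<Longrightarrow> \<bar>v x\<bar> \<le> K'"
    "0 < r" "0 \<le> K" "0 \<le> K'"
  shows "sobolev_bound c r (Suc m) v (K + K')"
proof -
  have "sobolev_bound c r m w ((K + K') / r)"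
    by (rule sobolev_bound_mono[OF assms(2)]) (use assms in \<open>auto simp: divide_right_mono\<close>)
  moreover have "\<bar>v x\<bar> \<le> K + K'" if "x \<in> ball c r" for x using assms(3)[OF that] assms(5) by linarith
  ultimately show ?thesis using assms(1) by auto
qed

text \<open>For a function with H' = q * H^p, the derivative of the composition involves only a
  power of the composition itself. Induction and the algebra property then suffice, and no formula
  for iterated derivatives of a composition is needed. The cases in use are exp (q = p = 1) and the
  inverse (q = -1, p = 2). The constant does not depend on the ball.\<close>

lemma sobolev_bound_comp_ode:
  fixes H :: "real \<Rightarrow> real"
  assumes J: "convex J" "\<And>y. y \<in> J \<Longrightarrow> (H has_real_derivative q * H y ^ p) (at y)"
    and K: "\<And>y. y \<in> J \<Longrightarrow> \<bar>H y\<bar> \<le> K" and K0: "0 \<le> K"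
  shows "\<exists>C\<ge>0. \<forall>c r v. 0 < r \<longrightarrow> sobolev_bound c r (Suc m) v M \<longrightarrow> (\<forall>x\<in>ball c r. v x \<in> J) \<longrightarrow>
    sobolev_bound c r (Suc m) (\<lambda>x. H (v x)) C"
proof -
  have cH: "continuous_on J (\<lambda>y. q * H y ^ p)"
    by (intro continuous_intros continuous_at_imp_continuous_on ballI DERIV_isCont[OF J(2)])
  have prim: "primitive_on (ball c r) (\<lambda>x. H (v x)) (\<lambda>x. w x * (q * H (v x) ^ p))"
    if "primitive_on (ball c r) v w" "\<forall>x\<in>ball c r. v x \<in> J" for c r v w
    using primitive_on_comp[OF that(1) J cH] that(2) by (simp add: mult.commute)
  show ?thesis
  proof (induction m arbitrary: M)
    case 0
    define N where "N = \<bar>M\<bar> * (\<bar>q\<bar> * K ^ p)"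
    show ?case
    proof (intro exI[of _ "N + K"] conjI allI impI)
      show "0 \<le> N + K" using K0 unfolding N_def by auto
      fix c r :: real and v assume r: "0 < r" and v: "sobolev_bound c r (Suc 0) v M" and vJ: "\<forall>x\<in>ball c r. v x \<in> J"
      have M: "0 \<le> M" by (rule sobolev_bound_nonneg[OF v r])
      obtain w where w: "primitive_on (ball c r) v w" "sobolev_bound c r 0 w (M / r)"
        using v by auto
      have "continuous_on (ball c r) (\<lambda>x. q * H (v x) ^ p)"
        using continuous_on_compose2[OF cH sobolev_bound_continuous[OF v]] vJ by auto
      moreover have "\<bar>q * H (v x) ^ p\<bar> \<le> \<bar>q\<bar> * K ^ p" if "x \<in> ball c r" for x
        using K[of "v x"] vJ that by (simp add: abs_mult power_abs mult_left_mono power_mono)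
      ultimately have "sobolev_bound c r 0 (\<lambda>x. w x * (q * H (v x) ^ p)) (M / r * (\<bar>q\<bar> * K ^ p))"
        by (rule sobolev_bound_0_mult[OF w(2)]) (use r in auto)
      then have "sobolev_bound c r 0 (\<lambda>x. w x * (q * H (v x) ^ p)) (N / r)"
        unfolding N_def using M by simp
      then show "sobolev_bound c r (Suc 0) (\<lambda>x. H (v x)) (N + K)"
        by (rule sobolev_bound_SucI[OF prim[OF w(1) vJ]]) (use K vJ r K0 in \<open>auto simp: N_def\<close>)
    qed
  next
    case (Suc m)
    obtain C where C: "C \<ge> 0" "\<And>c r v. 0 < r \<Longrightarrow> sobolev_bound c r (Suc m) v (2 * M) \<Longrightarrow> (\<forall>x\<in>ball c r. v x \<in> J) \<Longrightarrow>
      sobolev_bound c r (Suc m) (\<lambda>x. H (v x)) C"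
      \<comment> \<open>Lowering the order of \<open>v\<close> doubles its bound.\<close>
      using Suc.IH[of "2 * M"] by blast
    define N where "N = 8 ^ Suc m * (\<bar>M\<bar> * (\<bar>q\<bar> * (2 * (8 ^ Suc m * C) ^ p)))"
    show ?case
    proof (intro exI[of _ "N + K"] conjI allI impI)
      show "0 \<le> N + K" using K0 C unfolding N_def by auto
      fix c r :: real and v assume r: "0 < r" and v: "sobolev_bound c r (Suc (Suc m)) v M" and vJ: "\<forall>x\<in>ball c r. v x \<in> J"
      have M: "0 \<le> M" by (rule sobolev_bound_nonneg[OF v r])
      obtain w where w: "primitive_on (ball c r) v w" "sobolev_bound c r (Suc m) w (M / r)"
        using v unfolding sobolev_bound.simps(2)[of _ _ "Suc m"] by blast
      have "sobolev_bound c r (Suc m) (\<lambda>x. H (v x)) C"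
        by (rule C(2)[OF r sobolev_bound_lower[OF v r] vJ])
      then have "sobolev_bound c r (Suc m) (\<lambda>x. q * H (v x) ^ p) (\<bar>q\<bar> * (2 * (8 ^ Suc m * C) ^ p))"
        using r by (intro sobolev_bound_cmult sobolev_bound_power)
      then have "sobolev_bound c r (Suc m) (\<lambda>x. w x * (q * H (v x) ^ p))
          (8 ^ Suc m * (M / r * (\<bar>q\<bar> * (2 * (8 ^ Suc m * C) ^ p))))"
        by (rule sobolev_bound_mult[OF w(2) _ r])
      then have "sobolev_bound c r (Suc m) (\<lambda>x. w x * (q * H (v x) ^ p)) (N / r)"
        unfolding N_def using M by simp
      then show "sobolev_bound c r (Suc (Suc m)) (\<lambda>x. H (v x)) (N + K)"
        by (rule sobolev_bound_SucI[OF prim[OF w(1) vJ]]) (use K vJ r K0 C in \<open>auto simp: N_def\<close>)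
    qed
  qed
qed

lemma sobolev_bound_exp:
  "\<exists>C\<ge>0. \<forall>c r v. 0 < r \<longrightarrow> sobolev_bound c r (Suc m) v M \<longrightarrow> sobolev_bound c r (Suc m) (\<lambda>x. exp (v x)) C"
proof -
  obtain C where C: "C \<ge> 0" "\<And>c r v. 0 < r \<Longrightarrow> sobolev_bound c r (Suc m) v M \<Longrightarrow> (\<forall>x\<in>ball c r. v x \<in> {..M}) \<Longrightarrow>
      sobolev_bound c r (Suc m) (\<lambda>x. exp (v x)) C"
    using sobolev_bound_comp_ode[of "{..M}" exp 1 1 "exp M" m M] by (auto intro: DERIV_exp)
  have "\<forall>x\<in>ball c r. v x \<in> {..M}" if "sobolev_bound c r (Suc m) v M" for c r v
    using that by force
  then show ?thesis using C by blast
qed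

lemma sobolev_bound_inverse:
  assumes "a > 0"
  shows "\<exists>C\<ge>0. \<forall>c r v. 0 < r \<longrightarrow> sobolev_bound c r (Suc m) v M \<longrightarrow> (\<forall>x\<in>ball c r. a \<le> v x) \<longrightarrow>
    sobolev_bound c r (Suc m) (\<lambda>x. inverse (v x)) C"
proof -
  have d: "(inverse has_real_derivative (-1) * inverse y ^ 2) (at y)" if "y \<in> {a..}" for y
    using that assms by (auto intro!: derivative_eq_intros simp: power2_eq_square)
  have b: "\<bar>inverse y\<bar> \<le> inverse a" if "y \<in> {a..}" for y
    using that assms by (simp add: le_imp_inverse_le)
  show ?thesis using sobolev_bound_comp_ode[of "{a..}" inverse "-1" 2 "inverse a" m M] d b assms
    by auto
qed

lemma abs_ln_le:
  assumes "0 < a" "a \<le> 1" "a \<le> (q::real)"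
  shows "\<bar>ln q\<bar> \<le> \<bar>q - 1\<bar> / a"
proof (cases "q \<ge> 1")
  case True
  then have "\<bar>ln q\<bar> \<le> \<bar>q - 1\<bar>" using ln_le_minus_one[of q] ln_ge_zero[of q] by linarith
  also have "\<dots> \<le> \<bar>q - 1\<bar> / a" using mult_right_mono[of a 1 "\<bar>q - 1\<bar>"] assms by (simp add: field_simps)
  finally show ?thesis .
next
  case False
  have "- ln q = ln (1 / q)" using assms by (simp add: ln_div)
  also have "\<dots> \<le> 1 / q - 1" using assms by (intro ln_le_minus_one) auto
  also have "\<dots> = (1 - q) / q" using assms by (simp add: field_simps)
  also have "\<dots> \<le> (1 - q) / a" using assms False by (intro divide_left_mono) auto
  finally show ?thesis using False assms by (simp add: abs_if ln_le_zero_iff)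
qed

text \<open>The bound is linear in the size \<rho> of the perturbation, with a constant uniform for
  \<rho> up to \<open>M\<close>; this linearity carries the decay rate to the solution. One
  differentiation reduces the logarithm to the inverse, where mere boundedness is enough.\<close>

lemma sobolev_bound_ln:
  assumes "0 < a" "a \<le> 1"
  shows "\<exists>C\<ge>0. \<forall>c r v \<rho>. 0 < r \<longrightarrow> \<rho> \<le> M \<longrightarrow> sobolev_bound c r (Suc m) v \<rho> \<longrightarrow> (\<forall>x\<in>ball c r. a \<le> 1 + v x) \<longrightarrow>
    sobolev_bound c r (Suc m) (\<lambda>x. ln (1 + v x)) (C * \<rho>)"
proof -
  \<comment> \<open>The size of \<open>1 + v\<close>: the constant 1 counts as 2, \<open>v\<close>
    counts at most \<open>M\<close>, and the sum rule doubles the total.\<close>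
  obtain C where C: "C \<ge> 0" "\<And>c r v. 0 < r \<Longrightarrow> sobolev_bound c r (Suc m) v (2 * (2 + M)) \<Longrightarrow> (\<forall>x\<in>ball c r. a \<le> v x) \<Longrightarrow>
    sobolev_bound c r (Suc m) (\<lambda>x. inverse (v x)) C"
    using sobolev_bound_inverse[OF assms(1), of m "2 * (2 + M)"] by blast
  have "sobolev_bound c r (Suc m) (\<lambda>x. ln (1 + v x)) ((8 ^ m * C + 1 / a) * \<rho>)"
    if r: "0 < r" and \<rho>: "\<rho> \<le> M" and v: "sobolev_bound c r (Suc m) v \<rho>" and ge: "\<forall>x\<in>ball c r. a \<le> 1 + v x" for c r v \<rho>
  proof -
    have r0: "0 \<le> \<rho>" by (rule sobolev_bound_nonneg[OF v r])
    have "sobolev_bound c r (Suc m) (\<lambda>x. 1 + v x) (2 * (2 * \<bar>1\<bar> + \<rho>))"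
      by (rule sobolev_bound_add[OF sobolev_bound_const[OF r] v]) (use r r0 in auto)
    then have "sobolev_bound c r (Suc m) (\<lambda>x. 1 + v x) (2 * (2 + M))"
      by (rule sobolev_bound_mono) (use \<rho> r r0 in auto)
    then have i: "sobolev_bound c r (Suc m) (\<lambda>x. inverse (1 + v x)) C"
      using C(2) r ge by blast
    obtain w where w: "primitive_on (ball c r) v w" "sobolev_bound c r m w (\<rho> / r)"
      using v by auto
    have "sobolev_bound c r m (\<lambda>x. w x * inverse (1 + v x)) (8 ^ m * (\<rho> / r * C))"
      by (rule sobolev_bound_mult_Suc[OF w(2) i]) (use r r0 in auto)
    then have b: "sobolev_bound c r m (\<lambda>x. w x * inverse (1 + v x)) (8 ^ m * C * \<rho> / r)"
      by (simp add: mult_ac)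
    have "primitive_on (ball c r) (\<lambda>x. ln (1 + v x)) (\<lambda>x. inverse (1 + v x) * w x)"
    proof (rule primitive_on_comp[OF w(1), of "{-1<..}" "\<lambda>y. ln (1 + y)" "\<lambda>y. inverse (1 + y)"])
      show "((\<lambda>y. ln (1 + y)) has_real_derivative inverse (1 + y)) (at y)" if "y \<in> {-1<..}" for y :: real
        using that by (auto intro!: derivative_eq_intros simp: divide_inverse)
      show "continuous_on {-1<..} (\<lambda>y::real. inverse (1 + y))"
        by (intro continuous_intros) auto
      show "v x \<in> {-1<..}" if "x \<in> ball c r" for x using ge that assms by force
    qed simp
    then have "primitive_on (ball c r) (\<lambda>x. ln (1 + v x)) (\<lambda>x. w x * inverse (1 + v x))"
      by (simp add: mult.commute)
    then have "sobolev_bound c r (Suc m) (\<lambda>x. ln (1 + v x)) (8 ^ m * C * \<rho> + \<rho> / a)"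
    proof (rule sobolev_bound_SucI[OF _ b])
      show "\<bar>ln (1 + v x)\<bar> \<le> \<rho> / a" if "x \<in> ball c r" for x
      proof -
        have "\<bar>ln (1 + v x)\<bar> \<le> \<bar>v x\<bar> / a" using abs_ln_le[OF assms, of "1 + v x"] ge that by auto
        also have "\<dots> \<le> \<rho> / a" using v that assms by (intro divide_right_mono) auto
        finally show ?thesis .
      qed
    qed (use r r0 C assms in auto)
    then show ?thesis by (simp add: distrib_right)
  qed
  moreover have "0 \<le> 8 ^ m * C + 1 / a" using C assms by auto
  ultimately show ?thesis by blast
qed

section \<open>Translation and restriction to smaller balls\<close>

lemma set_integral_shift:
  fixes f :: "real \<Rightarrow> real"
  shows "set_integrable lborel {a..b} (\<lambda>x. f (x + \<tau>)) \<longleftrightarrow> set_integrable lborel {a + \<tau>..b + \<tau>} f"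
    and "(LINT x:{a..b}|lborel. f (x + \<tau>)) = (LINT x:{a + \<tau>..b + \<tau>}|lborel. f x)"
proof -
  have e: "(\<lambda>x. indicator {a..b} x *\<^sub>R f (x + \<tau>)) = (\<lambda>x. (\<lambda>y. indicator {a + \<tau>..b + \<tau>} y *\<^sub>R f y) (\<tau> + 1 * x))"
    by (auto simp: indicator_def add.commute)
  show "set_integrable lborel {a..b} (\<lambda>x. f (x + \<tau>)) \<longleftrightarrow> set_integrable lborel {a + \<tau>..b + \<tau>} f"
    unfolding set_integrable_def e by (subst lborel_integrable_real_affine_iff) auto
  show "(LINT x:{a..b}|lborel. f (x + \<tau>)) = (LINT x:{a + \<tau>..b + \<tau>}|lborel. f x)"
    unfolding set_lebesgue_integral_def e
    by (subst (2) lborel_integral_real_affine[of 1 _ \<tau>]) auto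
qed

lemma primitive_on_shift:
  assumes "primitive_on B v w" "\<And>x. x \<in> B' \<Longrightarrow> x + \<tau> \<in> B"
  shows "primitive_on B' (\<lambda>x. v (x + \<tau>)) (\<lambda>x. w (x + \<tau>))"
  unfolding primitive_on_def
proof (intro allI impI)
  fix a b :: real assume ab: "a \<le> b" "{a..b} \<subseteq> B'"
  have "{a + \<tau>..b + \<tau>} \<subseteq> B"
  proof
    fix y assume "y \<in> {a + \<tau>..b + \<tau>}"
    then have "y - \<tau> \<in> B'" using ab by auto
    then show "y \<in> B" using assms(2)[of "y - \<tau>"] by simp
  qed
  then show "set_integrable lborel {a..b} (\<lambda>x. w (x + \<tau>)) \<and> (LINT x:{a..b}|lborel. w (x + \<tau>)) = v (b + \<tau>) - v (a + \<tau>)"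
    using primitive_onD[OF assms(1), of "a + \<tau>" "b + \<tau>"] ab set_integral_shift[of a b w \<tau>] by auto
qed

text \<open>The squared integral over a smaller ball does not grow, but it is now measured against
  \<open>r\<close> instead of \<open>R\<close>; this costs sqrt (R / r), which is unbounded as
  \<open>r\<close> tends to 0.\<close>

lemma sobolev_bound_localize_weak:
  "sobolev_bound c R m F M \<Longrightarrow> 0 < r \<Longrightarrow> r \<le> R \<Longrightarrow> 0 \<le> M \<Longrightarrow> (\<And>x. x \<in> ball c r \<Longrightarrow> x + \<tau> \<in> ball c R) \<Longrightarrow>
    sobolev_bound c r m (\<lambda>x. F (x + \<tau>)) (M * sqrt (R / r))"
proof (induction m arbitrary: F M)
  case 0
  let ?B = "ball c R" and ?b = "ball c r"
  have F: "(\<lambda>x. indicator ?B x *\<^sub>R F x) \<in> borel_measurable borel"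
      "integrable lborel (\<lambda>x. indicator ?B x *\<^sub>R (F x)\<^sup>2)"
      "(LINT x|lborel. indicator ?B x *\<^sub>R (F x)\<^sup>2) \<le> M\<^sup>2 * R"
    using 0 by (auto simp: sq_int_def set_borel_measurable_def set_integrable_def set_lebesgue_integral_def)
  have "(\<lambda>x. indicator ?b x *\<^sub>R (\<lambda>y. indicator ?B y *\<^sub>R F y) (x + \<tau>)) \<in> borel_measurable borel"
    by (rule borel_measurable_scaleR[OF borel_measurable_indicator measurable_compose[OF _ F(1)]]) auto
  moreover have "(\<lambda>x. indicator ?b x *\<^sub>R (\<lambda>y. indicator ?B y *\<^sub>R F y) (x + \<tau>)) = (\<lambda>x. indicator ?b x *\<^sub>R F (x + \<tau>))"
    using 0(5) by (fastforce simp: indicator_def)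
  ultimately have m: "(\<lambda>x. indicator ?b x *\<^sub>R F (x + \<tau>)) \<in> borel_measurable borel" by simp
  have "(\<lambda>x. (indicator ?b x *\<^sub>R F (x + \<tau>))\<^sup>2) \<in> borel_measurable borel" using m by measurable
  moreover have "(\<lambda>x. (indicator ?b x *\<^sub>R F (x + \<tau>))\<^sup>2) = (\<lambda>x. indicator ?b x *\<^sub>R (F (x + \<tau>))\<^sup>2)"
    by (auto simp: indicator_def)
  ultimately have m2: "(\<lambda>x. indicator ?b x *\<^sub>R (F (x + \<tau>))\<^sup>2) \<in> borel_measurable borel" by simp
  define G where "G y = indicator ?B y *\<^sub>R (F y)\<^sup>2" for y
  have Gi: "integrable lborel (\<lambda>x. G (\<tau> + 1 * x))"
    using F(2) unfolding G_def[symmetric] by (subst lborel_integrable_real_affine_iff) auto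
  have le: "indicator ?b x *\<^sub>R (F (x + \<tau>))\<^sup>2 \<le> G (\<tau> + 1 * x)" for x
    using 0(5)[of x] by (auto simp: G_def indicator_def add.commute)
  have i: "integrable lborel (\<lambda>x. indicator ?b x *\<^sub>R (F (x + \<tau>))\<^sup>2)"
    by (rule Bochner_Integration.integrable_bound[OF Gi]) (use m2 le in \<open>auto intro!: AE_I2 simp: G_def abs_mult\<close>)
  have "(LINT x|lborel. indicator ?b x *\<^sub>R (F (x + \<tau>))\<^sup>2) \<le> (LINT x|lborel. G (\<tau> + 1 * x))"
    by (rule integral_mono[OF i Gi le])
  also have "\<dots> = (LINT x|lborel. G x)"
    by (subst lborel_integral_real_affine[of 1 G \<tau>]) auto
  also have "\<dots> \<le> M\<^sup>2 * R" using F(3) unfolding G_def .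
  also have "\<dots> = (M * sqrt (R / r))\<^sup>2 * r"
    using 0 by (simp add: power_mult_distrib)
  finally show ?case
    using m i by (simp add: sq_int_def set_borel_measurable_def set_integrable_def set_lebesgue_integral_def)
next
  case (Suc m)
  obtain w where w: "primitive_on (ball c R) F w" "sobolev_bound c R m w (M / R)"
    using Suc.prems by auto
  have R: "0 < R" "1 \<le> R / r" using Suc.prems by auto
  then have s: "1 \<le> sqrt (R / r)" by (simp add: real_sqrt_ge_1_iff)
  have b: "sobolev_bound c r m (\<lambda>x. w (x + \<tau>)) (M / R * sqrt (R / r))"
    by (rule Suc.IH[OF w(2)]) (use Suc.prems R in auto)
  have "sobolev_bound c r m (\<lambda>x. w (x + \<tau>)) (M * sqrt (R / r) / r)"
  proof (rule sobolev_bound_mono[OF b])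
    have "M / R \<le> M / r" using Suc.prems R by (intro divide_left_mono) auto
    then show "M / R * sqrt (R / r) \<le> M * sqrt (R / r) / r"
      using mult_right_mono[of "M / R" "M / r" "sqrt (R / r)"] s by simp
  qed (use Suc.prems R in auto)
  moreover have "\<bar>F (x + \<tau>)\<bar> \<le> M * sqrt (R / r)" if "x \<in> ball c r" for x
  proof -
    have "\<bar>F (x + \<tau>)\<bar> \<le> M" using Suc.prems that by auto
    also have "\<dots> \<le> M * sqrt (R / r)" using mult_left_mono[OF s, of M] Suc.prems by simp
    finally show ?thesis .
  qed
  moreover have "primitive_on (ball c r) (\<lambda>x. F (x + \<tau>)) (\<lambda>x. w (x + \<tau>))"
    by (rule primitive_on_shift[OF w(1)]) (use Suc.prems in auto)
  ultimately show ?case by auto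
qed

text \<open>With at least one derivative the loss disappears: the bound on the derivative improves
  from \<open>M / R\<close> to the permitted \<open>M / r\<close>, and the gain R / r absorbs sqrt
  (R / r). This is why \<open>C2_profile\<close> keeps a positive order for the second
  derivative.\<close>

lemma sobolev_bound_localize:
  assumes "sobolev_bound c R (Suc m) F M" "0 < r" "r \<le> R" "\<And>x. x \<in> ball c r \<Longrightarrow> x + \<tau> \<in> ball c R"
  shows "sobolev_bound c r (Suc m) (\<lambda>x. F (x + \<tau>)) M"
proof -
  obtain w where w: "primitive_on (ball c R) F w" "sobolev_bound c R m w (M / R)"
    using assms by auto
  have R: "0 < R" "1 \<le> R / r" using assms by auto
  have M: "0 \<le> M" using sobolev_bound_nonneg[OF assms(1) R(1)] .
  have b: "sobolev_bound c r m (\<lambda>x. w (x + \<tau>)) (M / R * sqrt (R / r))"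
    by (rule sobolev_bound_localize_weak[OF w(2)]) (use assms R M in auto)
  have "sobolev_bound c r m (\<lambda>x. w (x + \<tau>)) (M / r)"
  proof (rule sobolev_bound_mono[OF b])
    have "sqrt (R / r) \<le> R / r" using mult_right_mono[OF R(2), of "R / r"] R by (intro real_le_lsqrt) (auto simp: power2_eq_square)
    then have "M / R * sqrt (R / r) \<le> M / R * (R / r)" using M R by (intro mult_left_mono) auto
    then show "M / R * sqrt (R / r) \<le> M / r" using R by simp
  qed (use assms R M in auto)
  moreover have "\<bar>F (x + \<tau>)\<bar> \<le> M" if "x \<in> ball c r" for x using assms that by auto
  moreover have "primitive_on (ball c r) (\<lambda>x. F (x + \<tau>)) (\<lambda>x. w (x + \<tau>))"
    by (rule primitive_on_shift[OF w(1)]) (use assms in auto)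
  ultimately show ?thesis by auto
qed

section \<open>From the bounds to weak derivatives and homogeneous Sobolev seminorms\<close>

lemma weak_deriv_Suc:
  assumes p: "primitive_on B v v1" and "open B" and wd: "weak_deriv B n v1 w"
  shows "weak_deriv B (Suc n) v w"
  unfolding weak_deriv_def
proof (intro conjI allI impI)
  fix a b assume "{a..b} \<subseteq> B"
  then show "set_integrable lborel {a..b} v"
    unfolding set_integrable_def
    by (intro borel_integrable_compact primitive_on_continuous_Icc[OF p]) auto
  show "set_integrable lborel {a..b} w" using wd \<open>{a..b} \<subseteq> B\<close> unfolding weak_deriv_def by blast
next
  fix \<phi> assume t: "test_fun B \<phi>"
  have "(LINT x:B|lborel. v x * (deriv ^^ Suc n) \<phi> x) = - (LINT x:B|lborel. v1 x * (deriv ^^ n) \<phi> x)"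
    using primitive_on_integral_by_parts[OF p test_fun_deriv_funpow[OF t]] by simp
  also have "\<dots> = (-1) ^ Suc n * (LINT x:B|lborel. w x * \<phi> x)"
    using wd t unfolding weak_deriv_def by simp
  finally show "(LINT x:B|lborel. v x * (deriv ^^ Suc n) \<phi> x) = (-1) ^ Suc n * (LINT x:B|lborel. w x * \<phi> x)" .
qed

lemma sq_int_set_integrable:
  assumes "sq_int B w" "{a..b} \<subseteq> B"
  shows "set_integrable lborel {a..b} w"
proof -
  have m: "set_borel_measurable lborel {a..b} w"
    using assms unfolding sq_int_def by (auto intro: set_borel_measurable_subset)
  have "set_integrable lborel {a..b} (\<lambda>x. (w x)\<^sup>2)"
    using assms unfolding sq_int_def by (auto intro: set_integrable_subset)
  moreover have "set_integrable lborel {a..b} (\<lambda>x. 1::real)"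
    unfolding set_integrable_def by (intro borel_integrable_compact) auto
  ultimately have i: "set_integrable lborel {a..b} (\<lambda>x. 1 + (w x)\<^sup>2)" by simp
  show ?thesis
  proof (rule set_integrable_bound[OF i m])
    have "\<bar>y\<bar> \<le> 1 + y\<^sup>2" for y :: real
      using zero_le_power2[of "\<bar>y\<bar> - 1"] unfolding power2_diff power2_abs by simp
    then show "AE x in lborel. x \<in> {a..b} \<longrightarrow> norm (w x) \<le> norm (1 + (w x)\<^sup>2)"
      by (auto simp: abs_of_nonneg)
  qed
qed

text \<open>Peeling off \<open>s\<close> derivatives leaves either the top-order L2 bound or a sup
  bound, and only the latter has to be converted; the factor 2 covers both cases.\<close>

lemma sobolev_bound_weak_deriv:
  "sobolev_bound c r m v M \<Longrightarrow> s \<le> m \<Longrightarrow> 0 < r \<Longrightarrow> 0 \<le> M \<Longrightarrow>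
    \<exists>w. weak_deriv (ball c r) s v w \<and> sq_int (ball c r) w \<and> (LINT x:ball c r|lborel. (w x)\<^sup>2) \<le> (2 * M / r ^ s)\<^sup>2 * r"
proof (induction s arbitrary: m v M)
  case 0
  have b: "sobolev_bound c r 0 v (2 * M)"
  proof (cases m)
    case 0
    show ?thesis using sobolev_bound_mono[of c r 0 v M "2 * M"] \<open>sobolev_bound c r m v M\<close> 0 \<open>0 < r\<close> \<open>0 \<le> M\<close> by simp
  next
    case (Suc n)
    then have *: "sobolev_bound c r (Suc n) v M" using 0 by simp
    show ?thesis
      by (rule sobolev_bound_0_if_bounded[OF sobolev_bound_continuous[OF *]]) (use * 0 in auto)
  qed
  then have "sq_int (ball c r) v" by simp
  then have "weak_deriv (ball c r) 0 v v"
    unfolding weak_deriv_def using sq_int_set_integrable by auto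
  then show ?case using b by auto
next
  case (Suc s)
  obtain n where n: "m = Suc n" "s \<le> n" using Suc.prems by (cases m) auto
  obtain v1 where v1: "primitive_on (ball c r) v v1" "sobolev_bound c r n v1 (M / r)"
    using Suc.prems n by auto
  obtain w where w: "weak_deriv (ball c r) s v1 w" "sq_int (ball c r) w"
      "(LINT x:ball c r|lborel. (w x)\<^sup>2) \<le> (2 * (M / r) / r ^ s)\<^sup>2 * r"
    using Suc.IH[OF v1(2) n(2)] Suc.prems by auto
  have "weak_deriv (ball c r) (Suc s) v w" by (rule weak_deriv_Suc[OF v1(1) _ w(1)]) simp
  moreover have "2 * (M / r) / r ^ s = 2 * M / r ^ Suc s" by simp
  ultimately show ?case using w(2,3) by (metis (no_types))
qed

lemma L2_norm_on_cong_AE: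
  assumes "AE x in lborel. x \<in> B \<longrightarrow> w x = w' x" "sq_int B w" "sq_int B w'"
  shows "L2_norm_on B w = L2_norm_on B w'"
proof -
  have "(LINT x:B|lborel. (w x)\<^sup>2) = (LINT x:B|lborel. (w' x)\<^sup>2)"
    unfolding set_lebesgue_integral_def
  proof (rule integral_cong_AE)
    show "AE x in lborel. indicator B x *\<^sub>R (w x)\<^sup>2 = indicator B x *\<^sub>R (w' x)\<^sup>2"
      using assms(1) by eventually_elim (auto simp: indicator_def)
  qed (use assms borel_measurable_integrable in \<open>unfold sq_int_def set_integrable_def, blast+\<close>)
  then show ?thesis by (simp add: L2_norm_on_def)
qed

text \<open>The weight r powr (s - 1 / 2) exactly cancels sqrt r / r^s, so the scale-invariant
  seminorm is bounded by a constant free of \<open>r\<close> and \<open>s\<close>.\<close>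

lemma sobolev_bound_Hdot:
  assumes "sobolev_bound c r m v M" "s \<le> m" "0 < r" "0 \<le> M"
  shows "has_Hdot (ball c r) s v" "r powr (real s - 1 / 2) * Hdot_norm (ball c r) s v \<le> 2 * M"
proof -
  obtain w where w: "weak_deriv (ball c r) s v w" "sq_int (ball c r) w"
      "(LINT x:ball c r|lborel. (w x)\<^sup>2) \<le> (2 * M / r ^ s)\<^sup>2 * r"
    using sobolev_bound_weak_deriv[OF assms] by blast
  show "has_Hdot (ball c r) s v" using w unfolding has_Hdot_def by blast
  define w' where "w' = (SOME w. weak_deriv (ball c r) s v w \<and> sq_int (ball c r) w)"
  have w': "weak_deriv (ball c r) s v w' \<and> sq_int (ball c r) w'"
    unfolding w'_def by (rule someI[of _ w]) (use w in blast)
  have "Hdot_norm (ball c r) s v = L2_norm_on (ball c r) w"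
    unfolding Hdot_norm_def w'_def[symmetric]
    by (rule L2_norm_on_cong_AE[OF weak_deriv_unique]) (use w w' in auto)
  also have "\<dots> \<le> sqrt ((2 * M / r ^ s)\<^sup>2 * r)"
    unfolding L2_norm_on_def using w(3) by simp
  also have "\<dots> = 2 * M * (sqrt r / r ^ s)"
    using assms by (simp add: real_sqrt_mult)
  also have "sqrt r / r ^ s = r powr (1 / 2 - real s)"
    using assms by (simp add: powr_diff powr_half_sqrt powr_realpow)
  finally have "r powr (real s - 1 / 2) * Hdot_norm (ball c r) s v
      \<le> r powr (real s - 1 / 2) * (2 * M * r powr (1 / 2 - real s))"
    by (intro mult_left_mono) auto
  also have "\<dots> = 2 * M * (r powr (real s - 1 / 2) * r powr (1 / 2 - real s))" by simp
  also have "\<dots> = 2 * M"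
    using assms by (simp add: powr_add[symmetric])
  finally show "r powr (real s - 1 / 2) * Hdot_norm (ball c r) s v \<le> 2 * M" .
qed

subsection \<open>Regular representatives of the data\<close>

text \<open>Cauchy-Schwarz on an interval of length 1, in the pointwise form \<bar>y\<bar> \<le>
  \<epsilon> / 2 + y^2 / (2 * \<epsilon>).\<close>

lemma integral_abs_le_L2:
  assumes w: "sq_int UNIV w" "(LINT x|lborel. (w x)\<^sup>2) \<le> \<epsilon>\<^sup>2" and e: "\<epsilon> > 0"
  shows "(LINT y:{x..x+1}|lborel. \<bar>w y\<bar>) \<le> \<epsilon>"
proof -
  have wi: "set_integrable lborel {x..x+1} w" by (rule sq_int_set_integrable[OF w(1)]) auto
  have i2: "integrable lborel (\<lambda>x. (w x)\<^sup>2)" using w(1) by (simp add: sq_int_def set_integrable_def)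
  have s2: "set_integrable lborel {x..x+1} (\<lambda>x. (w x)\<^sup>2)"
    using w(1) unfolding sq_int_def by (auto intro: set_integrable_subset)
  have s1: "set_integrable lborel {x..x+1} (\<lambda>x. \<epsilon> / 2)"
    unfolding set_integrable_def by (intro borel_integrable_compact) auto
  have "\<bar>y\<bar> \<le> \<epsilon> / 2 + 1 / (2 * \<epsilon>) * y\<^sup>2" for y :: real
  proof -
    have "0 \<le> (\<bar>y\<bar> - \<epsilon>)\<^sup>2" by simp
    then have "2 * \<epsilon> * \<bar>y\<bar> \<le> \<epsilon>\<^sup>2 + y\<^sup>2" unfolding power2_diff by (simp add: algebra_simps)
    then show ?thesis using e by (simp add: field_simps power2_eq_square)
  qed
  then have "(LINT y:{x..x+1}|lborel. \<bar>w y\<bar>) \<le> (LINT y:{x..x+1}|lborel. \<epsilon> / 2 + 1 / (2 * \<epsilon>) * (w y)\<^sup>2)"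
    by (intro set_integral_mono set_integrable_abs[OF wi] set_integral_add s1 set_integrable_mult_right s2) auto
  also have "\<dots> = (LINT y:{x..x+1}|lborel. \<epsilon> / 2) + 1 / (2 * \<epsilon>) * (LINT y:{x..x+1}|lborel. (w y)\<^sup>2)"
    by (subst set_integral_add(2)[OF s1 set_integrable_mult_right[OF s2]]) simp
  also have "(LINT y:{x..x+1}|lborel. \<epsilon> / 2) = \<epsilon> / 2"
    by (simp add: set_lebesgue_integral_def)
  also have "(LINT y:{x..x+1}|lborel. (w y)\<^sup>2) \<le> (LINT y|lborel. (w y)\<^sup>2)"
    unfolding set_lebesgue_integral_def
    using s2 i2 by (intro integral_mono) (auto simp: set_integrable_def indicator_def)
  then have "\<epsilon> / 2 + 1 / (2 * \<epsilon>) * (LINT y:{x..x+1}|lborel. (w y)\<^sup>2) \<le> \<epsilon> / 2 + 1 / (2 * \<epsilon>) * \<epsilon>\<^sup>2"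
    using w(2) e by (intro add_left_mono mult_left_mono) auto
  also have "\<dots> = \<epsilon>" using e by (simp add: power2_eq_square)
  finally show ?thesis .
qed

text \<open>The one-dimensional Sobolev embedding: within a unit interval the values of
  \<open>V\<close> differ by at most \<epsilon>, and averaging \<bar>V x\<bar> \<le> \<bar>V y\<bar>
  + \<epsilon> over y brings in the L2 norm of \<open>V\<close>. Embedding is used only here, on
  intervals of fixed length.\<close>

lemma primitive_sup_le_L2:
  assumes p: "primitive_on UNIV V W" and v: "sq_int UNIV V" "(LINT x|lborel. (V x)\<^sup>2) \<le> \<epsilon>\<^sup>2"
    and w: "sq_int UNIV W" "(LINT x|lborel. (W x)\<^sup>2) \<le> \<epsilon>\<^sup>2" and e: "\<epsilon> > 0"
  shows "\<bar>V x\<bar> \<le> 2 * \<epsilon>"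
proof -
  have wi: "set_integrable lborel {x..x+1} (\<lambda>y. \<bar>W y\<bar>)"
    by (rule set_integrable_abs[OF sq_int_set_integrable[OF w(1)]]) auto
  have vi: "set_integrable lborel {x..x+1} (\<lambda>y. \<bar>V y\<bar>)"
    by (rule set_integrable_abs[OF sq_int_set_integrable[OF v(1)]]) auto
  have ci: "set_integrable lborel {x..x+1} (\<lambda>y. a)" for a :: real
    unfolding set_integrable_def by (intro borel_integrable_compact) auto
  have le: "\<bar>V x\<bar> \<le> \<bar>V y\<bar> + \<epsilon>" if y: "y \<in> {x..x+1}" for y
  proof -
    have "\<bar>V y - V x\<bar> = \<bar>LINT s:{x..y}|lborel. W s\<bar>"
      using primitive_onD(2)[OF p, of x y] y by simp
    also have "\<dots> \<le> (LINT s:{x..y}|lborel. \<bar>W s\<bar>)"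
      using integral_norm_bound[of lborel "\<lambda>s. indicator {x..y} s *\<^sub>R W s"]
      by (simp add: set_lebesgue_integral_def abs_mult)
    also have "\<dots> \<le> (LINT s:{x..x+1}|lborel. \<bar>W s\<bar>)"
      unfolding set_lebesgue_integral_def
    proof (rule integral_mono)
      show "integrable lborel (\<lambda>s. indicator {x..y} s *\<^sub>R \<bar>W s\<bar>)"
        using set_integrable_subset[OF wi, of "{x..y}"] y unfolding set_integrable_def by auto
      show "integrable lborel (\<lambda>s. indicator {x..x+1} s *\<^sub>R \<bar>W s\<bar>)"
        using wi unfolding set_integrable_def .
    qed (use y in \<open>auto simp: indicator_def\<close>)
    also have "\<dots> \<le> \<epsilon>" by (rule integral_abs_le_L2[OF w e])
    finally show ?thesis by linarith
  qed
  have "\<bar>V x\<bar> = (LINT y:{x..x+1}|lborel. \<bar>V x\<bar>)"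
    by (simp add: set_lebesgue_integral_def)
  also have "\<dots> \<le> (LINT y:{x..x+1}|lborel. \<bar>V y\<bar> + \<epsilon>)"
    by (intro set_integral_mono ci set_integral_add vi le)
  also have "\<dots> = (LINT y:{x..x+1}|lborel. \<bar>V y\<bar>) + (LINT y:{x..x+1}|lborel. \<epsilon>)"
    by (rule set_integral_add(2)[OF vi ci])
  also have "(LINT y:{x..x+1}|lborel. \<epsilon>) = \<epsilon>" by (simp add: set_lebesgue_integral_def)
  also have "(LINT y:{x..x+1}|lborel. \<bar>V y\<bar>) \<le> \<epsilon>" by (rule integral_abs_le_L2[OF v e])
  finally show ?thesis by simp
qed

lemma H_witness_integrable:
  assumes "H_witness m f D" "j \<le> m"
  shows "set_integrable lborel {a..b} (D j)"
  using assms unfolding H_witness_def weak_deriv_def by simp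

text \<open>Each \<open>D j\<close> is defined as a weak derivative of \<open>f\<close>. Testing the
  identity of order \<open>j\<close> with the derivative of a test function shows that consecutive
  ones are weak derivatives of each other.\<close>

lemma H_witness_step:
  assumes H: "H_witness m f D" and j: "j < m"
  shows "\<exists>V. primitive_on UNIV V (D (Suc j)) \<and> (AE x in lborel. D j x = V x)"
proof (rule du_Bois_Reymond)
  fix \<phi> assume t: "test_fun UNIV \<phi>"
  have "weak_deriv UNIV j f (D j)" "weak_deriv UNIV (Suc j) f (D (Suc j))"
    using H j unfolding H_witness_def by auto
  then have "(LINT x:UNIV|lborel. f x * (deriv ^^ j) (deriv \<phi>) x) = (-1) ^ j * (LINT x:UNIV|lborel. D j x * deriv \<phi> x)"
     "(LINT x:UNIV|lborel. f x * (deriv ^^ Suc j) \<phi> x) = (-1) ^ Suc j * (LINT x:UNIV|lborel. D (Suc j) x * \<phi> x)"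
    using t test_fun_deriv[OF t] unfolding weak_deriv_def by blast+
  moreover have "(deriv ^^ Suc j) \<phi> = (deriv ^^ j) (deriv \<phi>)" by (simp add: funpow_swap1)
  ultimately have "(-1) ^ j * (LINT x:UNIV|lborel. D j x * deriv \<phi> x) = (-1) ^ Suc j * (LINT x:UNIV|lborel. D (Suc j) x * \<phi> x)"
    by simp
  then have "(-1) ^ j * (LINT x:UNIV|lborel. D j x * deriv \<phi> x) = (-1) ^ j * (- (LINT x:UNIV|lborel. D (Suc j) x * \<phi> x))"
    by simp
  then show "(LINT x:UNIV|lborel. D j x * deriv \<phi> x) = - (LINT x:UNIV|lborel. D (Suc j) x * \<phi> x)"
    by (subst (asm) mult_cancel_left) simp
qed (use H_witness_integrable[OF H] j in auto)

lemma sobolev_bound_of_chain: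
  assumes R: "R > 0"
  shows "\<exists>K\<ge>0. \<forall>c F \<delta>. \<delta> \<ge> 0 \<longrightarrow> (\<forall>i<m. primitive_on UNIV (F i) (F (Suc i)) \<and> (\<forall>x. \<bar>F i x\<bar> \<le> \<delta>)) \<longrightarrow>
     sq_int UNIV (F m) \<longrightarrow> (LINT x|lborel. (F m x)\<^sup>2) \<le> \<delta>\<^sup>2 \<longrightarrow> sobolev_bound c R m (F (0::nat)) (K * \<delta>)"
proof (induction m)
  case 0
  show ?case
  \<comment> \<open>The bound of order zero compares the squared integral with
    \<open>M\<^sup>2 * R\<close>, hence this normalization.\<close>
  proof (intro exI[of _ "1 / sqrt R"] conjI allI impI)
    show "0 \<le> 1 / sqrt R" using R by simp
    fix c :: real and F \<delta> assume F: "sq_int UNIV (F (0::nat))" "(LINT x|lborel. (F 0 x)\<^sup>2) \<le> \<delta>\<^sup>2"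
    have i: "integrable lborel (\<lambda>x. (F 0 x)\<^sup>2)" using F(1) by (simp add: sq_int_def set_integrable_def)
    have s: "set_integrable lborel (ball c R) (\<lambda>x. (F 0 x)\<^sup>2)"
      using F(1) unfolding sq_int_def by (auto intro: set_integrable_subset)
    have "set_borel_measurable lborel (ball c R) (F 0)"
      using F(1) unfolding sq_int_def by (auto intro: set_borel_measurable_subset)
    moreover have "(LINT x:ball c R|lborel. (F 0 x)\<^sup>2) \<le> (LINT x|lborel. (F 0 x)\<^sup>2)"
      unfolding set_lebesgue_integral_def
      using s i by (intro integral_mono) (auto simp: set_integrable_def indicator_def)
    moreover have "(1 / sqrt R * \<delta>)\<^sup>2 * R = \<delta>\<^sup>2" using R by (simp add: power_divide)
    ultimately show "sobolev_bound c R 0 (F 0) (1 / sqrt R * \<delta>)"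
      using s F(2) by (simp add: sq_int_def)
  qed
next
  case (Suc m)
  obtain K where K: "K \<ge> 0" "\<And>c F \<delta>. \<delta> \<ge> 0 \<Longrightarrow> (\<forall>i<m. primitive_on UNIV (F i) (F (Suc i)) \<and> (\<forall>x. \<bar>F i x\<bar> \<le> \<delta>)) \<Longrightarrow>
     sq_int UNIV (F m) \<Longrightarrow> (LINT x|lborel. (F m x)\<^sup>2) \<le> \<delta>\<^sup>2 \<Longrightarrow> sobolev_bound c R m (F (0::nat)) (K * \<delta>)"
    using Suc.IH by blast
  show ?case
  proof (intro exI[of _ "R * K + 1"] conjI allI impI)
    show "0 \<le> R * K + 1" using R K by simp
    fix c :: real and F :: "nat \<Rightarrow> real \<Rightarrow> real" and \<delta> :: real
    assume d: "\<delta> \<ge> 0" and F: "\<forall>i<Suc m. primitive_on UNIV (F i) (F (Suc i)) \<and> (\<forall>x. \<bar>F i x\<bar> \<le> \<delta>)"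
      "sq_int UNIV (F (Suc m))" "(LINT x|lborel. (F (Suc m) x)\<^sup>2) \<le> \<delta>\<^sup>2"
    have "sobolev_bound c R m (F (Suc 0)) (K * \<delta>)"
      using K(2)[OF d, of "\<lambda>i. F (Suc i)" c] F by auto
    then have b: "sobolev_bound c R m (F (Suc 0)) (R * K * \<delta> / R)" using R by simp
    have p: "primitive_on (ball c R) (F 0) (F (Suc 0))"
      using F(1) by (auto intro: primitive_on_subset)
    have "sobolev_bound c R (Suc m) (F 0) (R * K * \<delta> + \<delta>)"
      by (rule sobolev_bound_SucI[OF p b]) (use F R K d in auto)
    then show "sobolev_bound c R (Suc m) (F 0) ((R * K + 1) * \<delta>)" by (simp add: distrib_right)
  qed
qed

text \<open>The initial conditions are imposed almost everywhere, so \<open>f\<close> may be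
  exchanged for a regular representative. \<open>K\<close> depends on \<open>R\<close> and the order
  only, which keeps all later constants independent of the data.\<close>

lemma H_witness_representative:
  assumes R: "R > 0"
  shows "\<exists>K\<ge>0. \<forall>c f D \<epsilon>. \<epsilon> > 0 \<longrightarrow> H_witness (Suc m) f D \<longrightarrow> H_sq (Suc m) D \<le> \<epsilon>\<^sup>2 \<longrightarrow>
     (\<exists>h. (AE x in lborel. f x = h x) \<and> sobolev_bound c R (Suc m) h (K * \<epsilon>))"
proof -
  obtain K where K: "K \<ge> 0" "\<And>c F \<delta>. \<delta> \<ge> 0 \<Longrightarrow> (\<forall>i<Suc m. primitive_on UNIV (F i) (F (Suc i)) \<and> (\<forall>x. \<bar>F i x\<bar> \<le> \<delta>)) \<Longrightarrow>
     sq_int UNIV (F (Suc m)) \<Longrightarrow> (LINT x|lborel. (F (Suc m) x)\<^sup>2) \<le> \<delta>\<^sup>2 \<Longrightarrow> sobolev_bound c R (Suc m) (F (0::nat)) (K * \<delta>)"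
    using sobolev_bound_of_chain[OF R, of "Suc m"] by blast
  have "\<exists>h. (AE x in lborel. f x = h x) \<and> sobolev_bound c R (Suc m) h (2 * K * \<epsilon>)"
    if e: "\<epsilon> > 0" and H: "H_witness (Suc m) f D" and sq: "H_sq (Suc m) D \<le> \<epsilon>\<^sup>2" for c f D \<epsilon>
  proof -
    have Dsq: "sq_int UNIV (D j)" if "j \<le> Suc m" for j using H that unfolding H_witness_def by auto
    have Dm: "D j \<in> borel_measurable lborel" if "j \<le> Suc m" for j
      using Dsq[OF that] by (simp add: sq_int_def set_borel_measurable_def)
    have Db: "(LINT x|lborel. (D j x)\<^sup>2) \<le> \<epsilon>\<^sup>2" if "j \<le> Suc m" for j
    proof -
      have "(LINT x|lborel. (D j x)\<^sup>2) \<le> H_sq (Suc m) D"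
        unfolding H_sq_def using that by (intro member_le_sum) auto
      then show ?thesis using sq by simp
    qed
    obtain V where V: "\<And>j. j < Suc m \<Longrightarrow> primitive_on UNIV (V j) (D (Suc j)) \<and> (AE x in lborel. D j x = V j x)"
      using H_witness_step[OF H] by metis
    \<comment> \<open>Below the top order the continuous representatives are used, so that each is
      an exact primitive of the next; the top derivative stays a mere L2 function.\<close>
    define F where "F j = (if j < Suc m then V j else D j)" for j
    have Fm: "F j \<in> borel_measurable lborel" if "j \<le> Suc m" for j
    proof (cases "j < Suc m")
      case True
      have "continuous_on UNIV (V j)" using V[OF True] primitive_on_continuous by blast
      then show ?thesis using True by (simp add: F_def borel_measurable_continuous_onI)
    qed (use Dm that in \<open>simp add: F_def\<close>)
    have ae: "AE x in lborel. D j x = F j x" if "j \<le> Suc m" for j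
      using V[of j] by (auto simp: F_def)
    have FI: "(LINT x|lborel. (F j x)\<^sup>2) \<le> \<epsilon>\<^sup>2" if "j \<le> Suc m" for j
    proof -
      have "(LINT x|lborel. (F j x)\<^sup>2) = (LINT x|lborel. (D j x)\<^sup>2)"
        using ae[OF that] Fm[OF that] Dm[OF that] by (intro integral_cong_AE) auto
      then show ?thesis using Db[OF that] by simp
    qed
    have Fsq: "sq_int UNIV (F j)" if "j \<le> Suc m" for j
    proof -
      have "integrable lborel (\<lambda>x. (F j x)\<^sup>2) \<longleftrightarrow> integrable lborel (\<lambda>x. (D j x)\<^sup>2)"
        using ae[OF that] Fm[OF that] Dm[OF that] by (intro integrable_cong_AE) auto
      then show ?thesis using Dsq[OF that] Fm[OF that]
        by (simp add: sq_int_def set_integrable_def set_borel_measurable_def)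
    qed
    have prim: "primitive_on UNIV (F j) (F (Suc j))" if "j < Suc m" for j
    proof (rule primitive_on_cong_AE)
      show "primitive_on UNIV (F j) (D (Suc j))" using V[OF that] that by (simp add: F_def)
      show "AE x in lborel. D (Suc j) x = F (Suc j) x" "F (Suc j) \<in> borel_measurable lborel" "D (Suc j) \<in> borel_measurable lborel"
        using ae Fm Dm that by auto
    qed
    have sup: "\<bar>F j x\<bar> \<le> 2 * \<epsilon>" if "j < Suc m" for j x
      by (rule primitive_sup_le_L2[OF prim[OF that]]) (use that Fsq FI e in auto)
    have "sobolev_bound c R (Suc m) (F 0) (K * (2 * \<epsilon>))"
    proof (rule K(2))
      have "\<epsilon>\<^sup>2 \<le> (2 * \<epsilon>)\<^sup>2" using e by (intro power_mono) auto
      then show "(LINT x|lborel. (F (Suc m) x)\<^sup>2) \<le> (2 * \<epsilon>)\<^sup>2" using FI[of "Suc m"] by linarith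
    qed (use prim sup Fsq e in auto)
    moreover have "AE x in lborel. f x = F 0 x" using ae[of 0] H by (simp add: H_witness_def)
    ultimately show ?thesis by (auto simp: mult_ac)
  qed
  then show ?thesis using K(1) by (intro exI[of _ "2 * K"]) auto
qed

subsection \<open>Uniqueness\<close>

lemma has_derivative_along_line:
  fixes U :: "'a::real_normed_vector \<Rightarrow> 'b::real_normed_vector"
  assumes "(U has_derivative L) (at (p + s *\<^sub>R d) within S)" "\<And>\<sigma>. \<sigma> \<in> I \<Longrightarrow> p + \<sigma> *\<^sub>R d \<in> S"
  shows "((\<lambda>\<sigma>. U (p + \<sigma> *\<^sub>R d)) has_vector_derivative L d) (at s within I)"
proof -
  have l: "((\<lambda>\<sigma>. p + \<sigma> *\<^sub>R d) has_derivative (\<lambda>h. h *\<^sub>R d)) (at s within I)"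
    by (auto intro!: derivative_eq_intros)
  have "(U has_derivative L) (at (p + s *\<^sub>R d) within (\<lambda>\<sigma>. p + \<sigma> *\<^sub>R d) ` I)"
    using assms by (auto intro: has_derivative_subset)
  from has_derivative_in_compose[OF l this]
  have "((\<lambda>\<sigma>. U (p + \<sigma> *\<^sub>R d)) has_derivative (\<lambda>h. L (h *\<^sub>R d))) (at s within I)" .
  moreover have "linear L" using assms(1) has_derivative_linear by blast
  ultimately show ?thesis
    unfolding has_vector_derivative_def by (simp add: linear_cmul)
qed

text \<open>Two applications of the mean value theorem to the second difference over a
  parallelogram, along \<open>d\<close> and then along \<open>e\<close>. The left-hand side is
  symmetric in \<open>d\<close> and \<open>e\<close>, the right-hand side is not visibly so.\<close>

lemma mixed_difference_quotient:
  fixes u :: "'a::real_inner \<Rightarrow> real"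
  assumes h: "0 < h"
    and U: "\<And>z. z \<in> S \<Longrightarrow> (u has_derivative (\<lambda>k. DU z \<bullet> k)) (at z)"
    and DU: "\<And>z. z \<in> S \<Longrightarrow> (DU has_derivative D2U z) (at z)"
    and sq: "\<And>a b. 0 \<le> a \<Longrightarrow> a \<le> h \<Longrightarrow> 0 \<le> b \<Longrightarrow> b \<le> h \<Longrightarrow> p + a *\<^sub>R d + b *\<^sub>R e \<in> S"
  shows "\<exists>a b. 0 < a \<and> a < h \<and> 0 < b \<and> b < h \<and>
     u (p + h *\<^sub>R d + h *\<^sub>R e) - u (p + h *\<^sub>R d) - u (p + h *\<^sub>R e) + u p
       = h * h * (D2U (p + a *\<^sub>R d + b *\<^sub>R e) e \<bullet> d)"
proof -
  define \<phi> where "\<phi> a = u ((p + h *\<^sub>R e) + a *\<^sub>R d) - u (p + a *\<^sub>R d)" for a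
  have 1: "(\<phi> has_real_derivative (DU ((p + h *\<^sub>R e) + a *\<^sub>R d) \<bullet> d - DU (p + a *\<^sub>R d) \<bullet> d)) (at a)"
    if a: "0 \<le> a" "a \<le> h" for a
  proof -
    have "p + a *\<^sub>R d + h *\<^sub>R e \<in> S" "p + a *\<^sub>R d + 0 *\<^sub>R e \<in> S"
      by (rule sq; use a h in simp)+
    then have "(p + h *\<^sub>R e) + a *\<^sub>R d \<in> S" "p + a *\<^sub>R d \<in> S" by (simp_all add: add_ac)
    then show ?thesis unfolding \<phi>_def has_real_derivative_iff_has_vector_derivative
      by (intro has_vector_derivative_diff has_derivative_along_line[where S = UNIV] U) auto
  qed
  obtain a where a: "0 < a" "a < h" "\<phi> h - \<phi> 0 = (h - 0) * (DU ((p + h *\<^sub>R e) + a *\<^sub>R d) \<bullet> d - DU (p + a *\<^sub>R d) \<bullet> d)"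
    using MVT2[OF h 1] by blast
  define \<psi> where "\<psi> b = DU ((p + a *\<^sub>R d) + b *\<^sub>R e) \<bullet> d" for b
  have 2: "(\<psi> has_real_derivative (D2U ((p + a *\<^sub>R d) + b *\<^sub>R e) e \<bullet> d)) (at b)"
    if b: "0 \<le> b" "b \<le> h" for b
  proof -
    have "(p + a *\<^sub>R d) + b *\<^sub>R e \<in> S" using sq a b by auto
    then have "((\<lambda>b. DU ((p + a *\<^sub>R d) + b *\<^sub>R e)) has_vector_derivative D2U ((p + a *\<^sub>R d) + b *\<^sub>R e) e) (at b)"
      by (intro has_derivative_along_line[where S = UNIV] DU) auto
    then show ?thesis unfolding \<psi>_def has_real_derivative_iff_has_vector_derivative
      by (rule bounded_linear.has_vector_derivative[OF bounded_linear_inner_left])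
  qed
  obtain b where b: "0 < b" "b < h" "\<psi> h - \<psi> 0 = (h - 0) * (D2U ((p + a *\<^sub>R d) + b *\<^sub>R e) e \<bullet> d)"
    using MVT2[OF h 2] by blast
  have "\<psi> h - \<psi> 0 = DU ((p + h *\<^sub>R e) + a *\<^sub>R d) \<bullet> d - DU (p + a *\<^sub>R d) \<bullet> d"
    unfolding \<psi>_def by (simp add: add_ac)
  then have "\<phi> h - \<phi> 0 = h * h * (D2U (p + a *\<^sub>R d + b *\<^sub>R e) e \<bullet> d)" using a(3) b(3) by simp
  moreover have "\<phi> h - \<phi> 0 = u (p + h *\<^sub>R d + h *\<^sub>R e) - u (p + h *\<^sub>R d) - u (p + h *\<^sub>R e) + u p"
    unfolding \<phi>_def by (simp add: add_ac)
  ultimately show ?thesis using a(1,2) b(1,2) by metis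
qed

text \<open>Evaluating the same second difference in both orders gives equal mixed derivatives at
  two nearby points; continuity brings both points to \<open>p\<close>. The definition of a solution
  does not build in this symmetry, yet the factorization of the wave operator depends on it.\<close>

lemma second_derivative_symmetric:
  fixes u :: "'a::real_inner \<Rightarrow> real"
  assumes S: "open S" "p \<in> S"
    and U: "\<And>z. z \<in> S \<Longrightarrow> (u has_derivative (\<lambda>k. DU z \<bullet> k)) (at z)"
    and DU: "\<And>z. z \<in> S \<Longrightarrow> (DU has_derivative D2U z) (at z)"
    and cd: "continuous_on S (\<lambda>z. D2U z d)" and ce: "continuous_on S (\<lambda>z. D2U z e)"
  shows "D2U p d \<bullet> e = D2U p e \<bullet> d"
proof -
  have "\<bar>D2U p d \<bullet> e - D2U p e \<bullet> d\<bar> \<le> 0 + \<epsilon>" if eps: "\<epsilon> > 0" for \<epsilon>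
  proof -
    have c1: "continuous_on S (\<lambda>z. D2U z d \<bullet> e)" and c2: "continuous_on S (\<lambda>z. D2U z e \<bullet> d)"
      by (intro continuous_intros cd ce)+
    obtain \<rho>1 where r1: "\<rho>1 > 0" "\<And>z. z \<in> S \<Longrightarrow> dist z p < \<rho>1 \<Longrightarrow> \<bar>D2U z d \<bullet> e - D2U p d \<bullet> e\<bar> < \<epsilon> / 2"
      using c1 S(2) eps unfolding continuous_on_iff dist_real_def by (metis half_gt_zero)
    obtain \<rho>2 where r2: "\<rho>2 > 0" "\<And>z. z \<in> S \<Longrightarrow> dist z p < \<rho>2 \<Longrightarrow> \<bar>D2U z e \<bullet> d - D2U p e \<bullet> d\<bar> < \<epsilon> / 2"
      using c2 S(2) eps unfolding continuous_on_iff dist_real_def by (metis half_gt_zero)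
    obtain \<rho>3 where r3: "\<rho>3 > 0" "ball p \<rho>3 \<subseteq> S" using S open_contains_ball by blast
    define \<rho> where "\<rho> = min \<rho>1 (min \<rho>2 \<rho>3)"
    \<comment> \<open>Keeps the whole parallelogram within \<rho> of \<open>p\<close>; the summand 1
      prevents division by zero and makes the estimate strict.\<close>
    define h where "h = \<rho> / (norm d + norm e + 1)"
    have \<rho>: "\<rho> > 0" using r1 r2 r3 by (simp add: \<rho>_def)
    have n: "norm d + norm e + 1 > 0" by (smt (verit) norm_ge_zero)
    then have h: "h > 0" using \<rho> by (simp add: h_def)
    have near: "dist (p + a *\<^sub>R d + b *\<^sub>R e) p < \<rho>" if "0 \<le> a" "a \<le> h" "0 \<le> b" "b \<le> h" for a b
    proof -
      have "dist (p + a *\<^sub>R d + b *\<^sub>R e) p = norm (a *\<^sub>R d + b *\<^sub>R e)" by (simp add: dist_norm add.assoc)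
      also have "\<dots> \<le> a * norm d + b * norm e" using norm_triangle_ineq[of "a *\<^sub>R d" "b *\<^sub>R e"] that by simp
      also have "\<dots> \<le> h * norm d + h * norm e" using that by (intro add_mono mult_right_mono) auto
      also have "\<dots> < h * (norm d + norm e + 1)" using h by (simp add: distrib_left)
      also have "\<dots> = \<rho>" using n by (simp add: h_def)
      finally show ?thesis .
    qed
    have inS: "p + a *\<^sub>R d + b *\<^sub>R e \<in> S" if "0 \<le> a" "a \<le> h" "0 \<le> b" "b \<le> h" for a b
      using near[OF that] r3 by (auto simp: \<rho>_def dist_commute subset_eq)
    obtain a b where ab: "0 < a" "a < h" "0 < b" "b < h"
      "u (p + h *\<^sub>R d + h *\<^sub>R e) - u (p + h *\<^sub>R d) - u (p + h *\<^sub>R e) + u p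
       = h * h * (D2U (p + a *\<^sub>R d + b *\<^sub>R e) e \<bullet> d)"
      using mixed_difference_quotient[OF h U DU inS] by blast
    have inS': "p + a *\<^sub>R e + b *\<^sub>R d \<in> S" if "0 \<le> a" "a \<le> h" "0 \<le> b" "b \<le> h" for a b
      using inS[of b a] that by (simp add: add_ac)
    obtain a' b' where ab': "0 < a'" "a' < h" "0 < b'" "b' < h"
      "u (p + h *\<^sub>R e + h *\<^sub>R d) - u (p + h *\<^sub>R e) - u (p + h *\<^sub>R d) + u p
       = h * h * (D2U (p + a' *\<^sub>R e + b' *\<^sub>R d) d \<bullet> e)"
      using mixed_difference_quotient[OF h U DU inS'] by blast
    define z1 where "z1 = p + a *\<^sub>R d + b *\<^sub>R e"
    define z2 where "z2 = p + b' *\<^sub>R d + a' *\<^sub>R e"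
    have z2: "z2 = p + a' *\<^sub>R e + b' *\<^sub>R d" by (simp add: z2_def add_ac)
    have "u (p + h *\<^sub>R e + h *\<^sub>R d) = u (p + h *\<^sub>R d + h *\<^sub>R e)" by (simp add: add_ac)
    then have "h * h * (D2U z1 e \<bullet> d) = h * h * (D2U z2 d \<bullet> e)"
      using ab(5) ab'(5) unfolding z2 z1_def by linarith
    then have eq: "D2U z1 e \<bullet> d = D2U z2 d \<bullet> e" using h by simp
    have "\<bar>D2U z1 e \<bullet> d - D2U p e \<bullet> d\<bar> < \<epsilon> / 2"
      using near[of a b] inS[of a b] ab unfolding z1_def by (intro r2) (auto simp: \<rho>_def)
    moreover have "\<bar>D2U z2 d \<bullet> e - D2U p d \<bullet> e\<bar> < \<epsilon> / 2"
      using near[of b' a'] inS[of b' a'] ab' unfolding z2_def by (intro r1) (auto simp: \<rho>_def)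
    ultimately show ?thesis using eq by linarith
  qed
  then have "\<bar>D2U p d \<bullet> e - D2U p e \<bullet> d\<bar> \<le> 0" by (rule field_le_epsilon)
  then show ?thesis by simp
qed

section \<open>Passage from dense subsets, and the geometry of the light cone\<close>

lemma continuous_eq_dense_subset:
  fixes f g :: "'a::topological_space \<Rightarrow> 'b::real_normed_vector"
  assumes "continuous_on S f" "continuous_on S g" "S \<subseteq> closure A" "\<And>x. x \<in> A \<Longrightarrow> x \<in> S \<Longrightarrow> f x = g x" "A \<subseteq> S" "x \<in> S"
  shows "f x = g x"
proof -
  have "closedin (top_of_set S) {x \<in> S. f x - g x = 0}"
    by (intro continuous_closedin_preimage_constant continuous_intros assms)
  then obtain K where K: "closed K" "{x \<in> S. f x - g x = 0} = S \<inter> K" unfolding closedin_closed by auto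
  have "A \<subseteq> K" using assms K by auto
  then have "closure A \<subseteq> K" using K(1) by (rule closure_minimal)
  then have "x \<in> S \<inter> K" using assms by blast
  then show ?thesis using K(2) by auto
qed

text \<open>A nonempty open set is not negligible, so it cannot consist of exceptional points only.
  Together with continuity this turns initial conditions holding almost everywhere into pointwise
  ones.\<close>

lemma AE_imp_dense:
  fixes a b :: real
  assumes "AE x in lborel. x \<in> {a<..<b} \<longrightarrow> P x"
  shows "{a<..<b} \<subseteq> closure {x \<in> {a<..<b}. P x}"
proof (rule ccontr)
  let ?A = "{x \<in> {a<..<b}. P x}"
  assume "\<not> {a<..<b} \<subseteq> closure ?A"
  then have ne: "{a<..<b} - closure ?A \<noteq> {}" by blast
  have op: "open ({a<..<b} - closure ?A)" by (intro open_Diff) auto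
  obtain N where N: "N \<in> null_sets lborel" "{x \<in> space lborel. \<not> (x \<in> {a<..<b} \<longrightarrow> P x)} \<subseteq> N"
    using assms by (auto simp: eventually_ae_filter)
  have "{a<..<b} - closure ?A \<subseteq> N" using N(2) closure_subset[of ?A] by (auto simp: subset_iff)
  moreover have "negligible N" using N(1) by (simp add: negligible_iff_null_sets null_sets_completionI)
  ultimately have "negligible ({a<..<b} - closure ?A)" using negligible_subset by blast
  then show False using open_not_negligible[OF op ne] by blast
qed

lemma light_cone_iff: "(t, x) \<in> light_cone T x0 \<longleftrightarrow> 0 \<le> t \<and> t < T \<and> \<bar>x - x0\<bar> \<le> T - t"
  by (simp add: light_cone_def)

lemma convex_light_cone: "convex (light_cone T x0)"
proof -
  have "light_cone T x0 = {z. (-1, 0) \<bullet> z \<le> 0} \<inter> {z. (1, 0) \<bullet> z < T} \<inter> {z. (1, 1) \<bullet> z \<le> T + x0} \<inter> {z. (1, -1) \<bullet> z \<le> T - x0}"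
    by (auto simp: light_cone_def)
  then show ?thesis by (simp add: convex_Int convex_halfspace_le convex_halfspace_lt)
qed

lemma light_cone_closure_interior:
  assumes "T > 0"
  shows "light_cone T x0 \<subseteq> closure (interior (light_cone T x0))"
proof -
  let ?O = "{z. (-1, 0) \<bullet> z < 0} \<inter> {z. (1, 0) \<bullet> z < T} \<inter> {z. (1, 1) \<bullet> z < T + x0} \<inter> {z. (1, -1) \<bullet> z < T - x0}"
  have "open ?O" by (intro open_Int open_halfspace_lt)
  moreover have "?O \<subseteq> light_cone T x0" by (auto simp: light_cone_def)
  ultimately have "?O \<subseteq> interior (light_cone T x0)" by (rule interior_maximal[rotated])
  moreover have "(T / 2, x0) \<in> ?O" using assms by auto
  ultimately have "interior (light_cone T x0) \<noteq> {}" by blast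
  then show ?thesis using convex_closure_interior[OF convex_light_cone] closure_subset by blast
qed

text \<open>The part of \<open>is_solution\<close> that does not mention the data, with the
  witnesses exposed so that the gradients of two solutions can be compared.\<close>

definition C2_wave_on :: "(real \<times> real) set \<Rightarrow> (real \<times> real \<Rightarrow> real) \<Rightarrow> (real \<times> real \<Rightarrow> real \<times> real) \<Rightarrow>
    (real \<times> real \<Rightarrow> real \<times> real \<Rightarrow> real \<times> real) \<Rightarrow> bool" where
  "C2_wave_on S U DU D2U \<longleftrightarrow>
     continuous_on S DU \<and> continuous_on S (\<lambda>z. D2U z (1, 0)) \<and> continuous_on S (\<lambda>z. D2U z (0, 1)) \<and>
     (\<forall>z\<in>S. (U has_derivative (\<lambda>h. DU z \<bullet> h)) (at z within S) \<and> (DU has_derivative D2U z) (at z within S) \<and>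
        fst (D2U z (1, 0)) - snd (D2U z (0, 1)) = (fst (DU z))\<^sup>2 - (snd (DU z))\<^sup>2)"

lemma C2_wave_on_symmetric:
  assumes "C2_wave_on (light_cone T x0) U DU D2U" "T > 0" "z \<in> light_cone T x0"
  shows "snd (D2U z (1, 0)) = fst (D2U z (0, 1))"
proof (rule continuous_eq_dense_subset[OF _ _ light_cone_closure_interior[OF assms(2)] _ interior_subset assms(3)])
  let ?S = "light_cone T x0"
  show "continuous_on ?S (\<lambda>z. snd (D2U z (1, 0)))" "continuous_on ?S (\<lambda>z. fst (D2U z (0, 1)))"
    using assms(1) unfolding C2_wave_on_def by (auto intro!: continuous_intros)
  fix p assume p: "p \<in> interior ?S"
  have at: "at z within ?S = at z" if "z \<in> interior ?S" for z using that by (rule at_within_interior)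
  have "D2U p (1, 0) \<bullet> (0, 1) = D2U p (0, 1) \<bullet> (1, 0)"
  proof (rule second_derivative_symmetric[OF open_interior p, of U DU])
    show "(U has_derivative (\<lambda>k. DU z \<bullet> k)) (at z)" "(DU has_derivative D2U z) (at z)" if "z \<in> interior ?S" for z
      using assms(1) that at[OF that] interior_subset unfolding C2_wave_on_def by (metis subsetD)+
    show "continuous_on (interior ?S) (\<lambda>z. D2U z (1, 0))" "continuous_on (interior ?S) (\<lambda>z. D2U z (0, 1))"
      using assms(1) interior_subset continuous_on_subset unfolding C2_wave_on_def by blast+
  qed
  then show "snd (D2U p (1, 0)) = fst (D2U p (0, 1))"
    by (cases "D2U p (1, 0)"; cases "D2U p (0, 1)") simp
qed

text \<open>\<open>exp (- u)\<close> solves the linear wave equation, so its derivative in one null direction is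
  transported along the other.\<close>

lemma null_derivative_transport:
  assumes w: "C2_wave_on (light_cone T x0) U DU D2U" and T: "T > 0" and z: "(t, x) \<in> light_cone T x0"
    and \<sigma>: "\<sigma> = 1 \<or> \<sigma> = -1"
  shows "exp (- U (t, x)) * (DU (t, x) \<bullet> (1, - \<sigma>)) = exp (- U (0, x - \<sigma> * t)) * (DU (0, x - \<sigma> * t) \<bullet> (1, - \<sigma>))"
proof -
  let ?S = "light_cone T x0"
  let ?p = "(0, x - \<sigma> * t)" and ?d = "(1, \<sigma>)" and ?e = "(1, - \<sigma>)"
  define \<gamma> :: "real \<Rightarrow> real \<times> real" where "\<gamma> s = ?p + s *\<^sub>R ?d" for s
  have tx: "0 \<le> t" "t < T" "\<bar>x - x0\<bar> \<le> T - t" using z by (auto simp: light_cone_iff)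
  have in_S: "\<gamma> s \<in> ?S" if "s \<in> {0..t}" for s
    using that tx \<sigma> by (auto simp: \<gamma>_def light_cone_iff)
  \<comment> \<open>Up to sign, this is the derivative of exp (- U) in the null direction
    \<open>?e\<close>, followed along the characteristic in the other null direction
    \<open>?d\<close>.\<close>
  define A where "A s = exp (- U (\<gamma> s)) * (DU (\<gamma> s) \<bullet> ?e)" for s
  have "(A has_vector_derivative 0) (at s within {0..t})" if s: "s \<in> {0..t}" for s
  proof -
    have zS: "\<gamma> s \<in> ?S" by (rule in_S[OF s])
    have uD: "(U has_derivative (\<lambda>h. DU (\<gamma> s) \<bullet> h)) (at (\<gamma> s) within ?S)"
      and dD: "(DU has_derivative D2U (\<gamma> s)) (at (\<gamma> s) within ?S)"
      and eq: "fst (D2U (\<gamma> s) (1, 0)) - snd (D2U (\<gamma> s) (0, 1)) = (fst (DU (\<gamma> s)))\<^sup>2 - (snd (DU (\<gamma> s)))\<^sup>2"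
      using w zS unfolding C2_wave_on_def by blast+
    have sym: "snd (D2U (\<gamma> s) (1, 0)) = fst (D2U (\<gamma> s) (0, 1))" by (rule C2_wave_on_symmetric[OF w T zS])
    have 1: "((\<lambda>s. U (\<gamma> s)) has_vector_derivative (DU (\<gamma> s) \<bullet> ?d)) (at s within {0..t})"
      using has_derivative_along_line[OF uD[unfolded \<gamma>_def], of "{0..t}"] in_S unfolding \<gamma>_def by blast
    have 2: "((\<lambda>s. DU (\<gamma> s)) has_vector_derivative D2U (\<gamma> s) ?d) (at s within {0..t})"
      using has_derivative_along_line[OF dD[unfolded \<gamma>_def], of "{0..t}"] in_S unfolding \<gamma>_def by blast
    have 3: "((\<lambda>s. DU (\<gamma> s) \<bullet> ?e) has_vector_derivative D2U (\<gamma> s) ?d \<bullet> ?e) (at s within {0..t})"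
      by (rule bounded_linear.has_vector_derivative[OF bounded_linear_inner_left 2])
    have 4: "((\<lambda>s. exp (- U (\<gamma> s))) has_real_derivative exp (- U (\<gamma> s)) * (- (DU (\<gamma> s) \<bullet> ?d))) (at s within {0..t})"
      using 1 unfolding has_real_derivative_iff_has_vector_derivative[symmetric]
      by (auto intro!: derivative_eq_intros)
    have A': "(A has_real_derivative (exp (- U (\<gamma> s)) * (- (DU (\<gamma> s) \<bullet> ?d))) * (DU (\<gamma> s) \<bullet> ?e)
        + (D2U (\<gamma> s) ?d \<bullet> ?e) * exp (- U (\<gamma> s))) (at s within {0..t})"
      unfolding A_def by (rule DERIV_mult[OF 4 3[folded has_real_derivative_iff_has_vector_derivative]])
    have "?d = (1, 0) + \<sigma> *\<^sub>R (0, 1)" by simp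
    then have "D2U (\<gamma> s) ?d = D2U (\<gamma> s) (1, 0) + \<sigma> *\<^sub>R D2U (\<gamma> s) (0, 1)"
      using has_derivative_linear[OF dD] by (metis linear_add linear_cmul)
    then have "D2U (\<gamma> s) ?d \<bullet> ?e = fst (D2U (\<gamma> s) (1, 0)) - \<sigma> * snd (D2U (\<gamma> s) (1, 0)) + \<sigma> * fst (D2U (\<gamma> s) (0, 1))
       - \<sigma> * \<sigma> * snd (D2U (\<gamma> s) (0, 1))"
      by (simp add: inner_prod_def algebra_simps)
    also have "\<dots> = (fst (DU (\<gamma> s)))\<^sup>2 - (snd (DU (\<gamma> s)))\<^sup>2"
      using \<sigma> sym eq by auto
    \<comment> \<open>The quadratic nonlinearity factors into the two null derivatives and thus
      cancels the term that comes from differentiating the exponential.\<close>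
    also have "\<dots> = (DU (\<gamma> s) \<bullet> ?d) * (DU (\<gamma> s) \<bullet> ?e)"
      using \<sigma> by (auto simp: inner_prod_def power2_eq_square algebra_simps)
    finally show ?thesis using A' by (simp add: has_real_derivative_iff_has_vector_derivative mult_ac)
  qed
  then have "A t = A 0"
    using has_vector_derivative_zero_constant[of "{0..t}" A] tx(1)
    by (metis atLeastAtMost_iff convex_real_interval(5) order_refl)
  then show ?thesis by (simp add: A_def \<gamma>_def)
qed

text \<open>Both null derivatives of exp (- U) and exp (- V) agree with their values at time 0,
  which coincide. The time derivative is the mean of the two, so the difference of the exponentials
  is constant along vertical lines, which remain in the cone.\<close>

lemma C2_wave_on_unique:
  assumes u: "C2_wave_on (light_cone T x0) U DU D2U" and v: "C2_wave_on (light_cone T x0) V DV D2V" and T: "T > 0"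
    and i0: "\<And>x. \<bar>x - x0\<bar> \<le> T \<Longrightarrow> U (0, x) = V (0, x)" and i1: "\<And>x. \<bar>x - x0\<bar> \<le> T \<Longrightarrow> DU (0, x) = DV (0, x)"
    and z: "(t, x) \<in> light_cone T x0"
  shows "U (t, x) = V (t, x)"
proof -
  let ?S = "light_cone T x0"
  have tx: "0 \<le> t" "t < T" "\<bar>x - x0\<bar> \<le> T - t" using z by (auto simp: light_cone_iff)
  define d where "d s = exp (- U ((0, x) + s *\<^sub>R (1, 0))) - exp (- V ((0, x) + s *\<^sub>R (1, 0)))" for s
  have eq: "exp (- U (s, x)) * (DU (s, x) \<bullet> (1, 0)) = exp (- V (s, x)) * (DV (s, x) \<bullet> (1, 0))"
    if sS: "(s, x) \<in> ?S" for s
  proof -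
    have e: "exp (- U (s, x)) * (DU (s, x) \<bullet> (1, -\<sigma>)) = exp (- V (s, x)) * (DV (s, x) \<bullet> (1, -\<sigma>))" if \<sigma>: "\<sigma> = 1 \<or> \<sigma> = -1" for \<sigma>
    proof -
      have "\<bar>x - \<sigma> * s - x0\<bar> \<le> T" using sS \<sigma> by (auto simp: light_cone_iff)
      then show ?thesis
        using null_derivative_transport[OF u T sS \<sigma>] null_derivative_transport[OF v T sS \<sigma>] i0 i1 by simp
    qed
    have dec: "y * (D \<bullet> (1, 0)) = (y * (D \<bullet> (1, -1)) + y * (D \<bullet> (1, -(-1)))) / 2" for y :: real and D :: "real \<times> real"
      by (cases D) (simp add: algebra_simps)
    show ?thesis using e[of 1] e[of "-1"] dec[of "exp (- U (s, x))" "DU (s, x)"] dec[of "exp (- V (s, x))" "DV (s, x)"] by simp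
  qed
  have "(d has_vector_derivative 0) (at s within {0..t})" if s: "s \<in> {0..t}" for s
  proof -
    have in_S: "(0, x) + \<sigma> *\<^sub>R (1, 0) \<in> ?S" if "\<sigma> \<in> {0..t}" for \<sigma>
      using that tx by (auto simp: light_cone_iff)
    have sS: "(s, x) \<in> ?S" using in_S[OF s] by simp
    have "(U has_derivative (\<lambda>h. DU (s, x) \<bullet> h)) (at ((0, x) + s *\<^sub>R (1, 0)) within ?S)"
      "(V has_derivative (\<lambda>h. DV (s, x) \<bullet> h)) (at ((0, x) + s *\<^sub>R (1, 0)) within ?S)"
      using u v sS unfolding C2_wave_on_def by auto
    from this[THEN has_derivative_along_line[OF _ in_S]]
    have 1: "((\<lambda>\<sigma>. U ((0, x) + \<sigma> *\<^sub>R (1, 0))) has_real_derivative DU (s, x) \<bullet> (1, 0)) (at s within {0..t})"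
      "((\<lambda>\<sigma>. V ((0, x) + \<sigma> *\<^sub>R (1, 0))) has_real_derivative DV (s, x) \<bullet> (1, 0)) (at s within {0..t})"
      unfolding has_real_derivative_iff_has_vector_derivative by blast+
    have "(d has_real_derivative exp (- U ((0, x) + s *\<^sub>R (1, 0))) * (- (DU (s, x) \<bullet> (1, 0)))
      - exp (- V ((0, x) + s *\<^sub>R (1, 0))) * (- (DV (s, x) \<bullet> (1, 0)))) (at s within {0..t})"
      unfolding d_def by (rule derivative_eq_intros 1 refl | simp)+
    moreover have "exp (- U ((0, x) + s *\<^sub>R (1, 0))) * (- (DU (s, x) \<bullet> (1, 0)))
      - exp (- V ((0, x) + s *\<^sub>R (1, 0))) * (- (DV (s, x) \<bullet> (1, 0))) = 0"
      using eq[OF sS] by simp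
    ultimately show ?thesis by (simp add: has_real_derivative_iff_has_vector_derivative)
  qed
  then have "d t = d 0"
    using has_vector_derivative_zero_constant[of "{0..t}" d] tx(1)
    by (metis atLeastAtMost_iff convex_real_interval(5) order_refl)
  also have "\<dots> = 0" using i0[of x] tx by (simp add: d_def)
  finally show ?thesis by (simp add: d_def)
qed

text \<open>The data fix u and u_t only almost everywhere and do not mention u_x. Continuity extends
  the equality to the whole closed base; u_x is then recovered by differentiating u(0, x) along the
  base, one-sidedly at its end points.\<close>

lemma is_solution_unique:
  assumes u: "is_solution T x0 u u0 u1" and v: "is_solution T x0 v u0 u1" and T: "T > 0"
    and z: "(t, x) \<in> light_cone T x0"
  shows "v t x = u t x"
proof -
  let ?S = "light_cone T x0" and ?U = "\<lambda>(t, x). u t x" and ?V = "\<lambda>(t, x). v t x"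
  obtain DU D2U where U: "C2_wave_on ?S ?U DU D2U"
    and Ui: "AE x in lborel. x \<in> ball x0 T \<longrightarrow> u 0 x = u0 x \<and> fst (DU (0, x)) = u1 x"
    using u unfolding is_solution_def C2_wave_on_def by blast
  obtain DV D2V where V: "C2_wave_on ?S ?V DV D2V"
    and Vi: "AE x in lborel. x \<in> ball x0 T \<longrightarrow> v 0 x = u0 x \<and> fst (DV (0, x)) = u1 x"
    using v unfolding is_solution_def C2_wave_on_def by blast
  let ?I = "{x0 - T..x0 + T}"
  have in_S: "(0, x0) + x *\<^sub>R (0, 1) \<in> ?S" if "x \<in> {-T..T}" for x using that T by (auto simp: light_cone_iff)
  have in_S': "(0, x) \<in> ?S" if "x \<in> ?I" for x using that T by (auto simp: light_cone_iff)
  define A where "A = {x \<in> {x0 - T<..<x0 + T}. u 0 x = v 0 x \<and> fst (DU (0, x)) = fst (DV (0, x))}"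
  have "AE x in lborel. x \<in> {x0 - T<..<x0 + T} \<longrightarrow> u 0 x = v 0 x \<and> fst (DU (0, x)) = fst (DV (0, x))"
    using Ui Vi by eventually_elim (auto simp: ball_eq_greaterThanLessThan)
  from AE_imp_dense[OF this] have "{x0 - T<..<x0 + T} \<subseteq> closure A" unfolding A_def .
  then have "closure {x0 - T<..<x0 + T} \<subseteq> closure A" by (intro closure_minimal) auto
  then have dense: "?I \<subseteq> closure A" using T by simp
  have AI: "A \<subseteq> ?I" by (auto simp: A_def)
  have cl: "continuous_on ?I (\<lambda>x. F (0, x))" if "continuous_on ?S F" for F :: "real \<times> real \<Rightarrow> 'c::real_normed_vector"
    by (rule continuous_on_compose2[OF that]) (use in_S' in \<open>auto intro!: continuous_intros\<close>)
  have cU: "continuous_on ?S ?U" "continuous_on ?S ?V" "continuous_on ?S DU" "continuous_on ?S DV"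
    using U V unfolding C2_wave_on_def by (auto intro!: has_derivative_continuous_on)
  have e0: "u 0 x = v 0 x" if "x \<in> ?I" for x
    using continuous_eq_dense_subset[OF cl[OF cU(1)] cl[OF cU(2)] dense _ AI that] by (auto simp: A_def)
  have e1: "fst (DU (0, x)) = fst (DV (0, x))" if "x \<in> ?I" for x
    by (rule continuous_eq_dense_subset[OF cl[OF continuous_on_fst[OF cU(3)]] cl[OF continuous_on_fst[OF cU(4)]] dense _ AI that])
       (auto simp: A_def)
  have e2: "snd (DU (0, x0 + y)) = snd (DV (0, x0 + y))" if y: "y \<in> {-T..T}" for y
  proof -
    have "(?U has_derivative (\<lambda>h. DU (0, x0 + y) \<bullet> h)) (at ((0, x0) + y *\<^sub>R (0, 1)) within ?S)"
      "(?V has_derivative (\<lambda>h. DV (0, x0 + y) \<bullet> h)) (at ((0, x0) + y *\<^sub>R (0, 1)) within ?S)"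
      using U V in_S[OF y] unfolding C2_wave_on_def by auto
    from this[THEN has_derivative_along_line[where I = "{-T..T}", OF _ in_S]]
    have 1: "((\<lambda>y. u 0 (x0 + y)) has_vector_derivative (DU (0, x0 + y) \<bullet> (0, 1))) (at y within {-T..T})"
      and 2: "((\<lambda>y. v 0 (x0 + y)) has_vector_derivative (DV (0, x0 + y) \<bullet> (0, 1))) (at y within {-T..T})"
      by simp_all
    have "((\<lambda>y. u 0 (x0 + y)) has_vector_derivative (DV (0, x0 + y) \<bullet> (0, 1))) (at y within {-T..T})"
      by (rule has_vector_derivative_transform[OF y _ 2]) (use e0 in auto)
    moreover have nb: "at y within {-T..T} \<noteq> bot"
      using islimpt_Icc[of "-T" T y] y T by (simp add: trivial_limit_within)
    ultimately have "DU (0, x0 + y) \<bullet> (0, 1) = DV (0, x0 + y) \<bullet> (0, 1)"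
      using 1 by (intro vector_derivative_unique_within[OF nb])
    then show ?thesis by (simp add: inner_prod_def)
  qed
  have i1: "DU (0, x) = DV (0, x)" if "\<bar>x - x0\<bar> \<le> T" for x
  proof -
    have "x \<in> ?I" "x - x0 \<in> {-T..T}" using that by auto
    from e1[OF this(1)] e2[OF this(2)] show ?thesis by (simp add: prod_eq_iff)
  qed
  have i0: "?U (0, x) = ?V (0, x)" if "\<bar>x - x0\<bar> \<le> T" for x
  proof -
    have "x \<in> ?I" using that by auto
    then show ?thesis using e0 by simp
  qed
  have "?U (t, x) = ?V (t, x)" by (rule C2_wave_on_unique[OF U V T i0 i1 z])
  then show ?thesis by simp
qed

subsection \<open>The explicit profile\<close>

text \<open>Multiplying the argument of the second logarithm by T - t makes it affine. The formula
  holds wherever the affine factor is positive, also outside the cone, which is needed when the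
  perturbed blow-up time exceeds \<open>T0\<close>.\<close>

lemma ubl_eq_ln:
  assumes "T > 0" "\<beta> > 0" "t < T" "(T - t) + (1 - \<beta>) / (1 + \<beta>) * (x - x0) > 0"
  shows "ubl \<beta> \<kappa> T x0 t x = - ln (exp (- \<kappa>) / T * ((T - t) + (1 - \<beta>) / (1 + \<beta>) * (x - x0)))"
proof -
  let ?P = "(T - t) + (1 - \<beta>) / (1 + \<beta>) * (x - x0)" and ?y = "(x - x0) / (T - t)"
  have r: "T - t > 0" using assms by simp
  have "(1 + X / r) + \<beta> * (1 - X / r) = ((1 + \<beta>) * r + (1 - \<beta>) * X) / r" if "r > 0" for X r :: real
    using that by (simp add: field_simps)
  moreover have "(1 + \<beta>) * ?P = (1 + \<beta>) * (T - t) + (1 - \<beta>) * (x - x0)"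
    using assms(2) by (simp add: distrib_left)
  ultimately have "(1 + ?y) + \<beta> * (1 - ?y) = (1 + \<beta>) * ?P / (T - t)" using r by simp
  then have "ln ((1 + ?y) + \<beta> * (1 - ?y)) = ln (1 + \<beta>) + ln ?P - ln (T - t)"
    using assms r by (simp add: ln_mult ln_div)
  moreover have "ln (1 - t / T) = ln (T - t) - ln T"
  proof -
    have "1 - t / T = (T - t) / T" using assms by (simp add: field_simps)
    then show ?thesis using assms r by (simp add: ln_div)
  qed
  moreover have "ln (exp (- \<kappa>) / T * ?P) = - \<kappa> - ln T + ln ?P"
    using assms by (simp add: ln_mult ln_div)
  ultimately show ?thesis unfolding ubl_def Let_def by simp
qed

text \<open>At t = 0 the derivative in \<open>dt\<close> is one-sided; the filter is still
  nontrivial, so its value is determined.\<close>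

lemma dt_eqI:
  assumes "((\<lambda>s. u s x) has_real_derivative D) (at t within {0..})" "t \<ge> 0"
  shows "dt u t x = D"
proof -
  have "{t<..} \<subseteq> {0..}" using assms(2) by auto
  then have "at t within {0..} \<noteq> bot"
    using trivial_limit_at_right_real[of t] at_le[of "{t<..}" "{0..}" t] by (metis bot_unique)
  then show ?thesis unfolding dt_def
    using assms(1) by (simp add: vector_derivative_within has_real_derivative_iff_has_vector_derivative)
qed

lemma dt_minus_ln:
  assumes "\<And>s. s \<in> S \<Longrightarrow> u s x = - ln (p s)" "open S" "t \<in> S" "0 \<le> t"
    "(p has_real_derivative p') (at t)" "p t > 0"
  shows "dt u t x = - (p' / p t)"
proof (rule dt_eqI)
  have "((\<lambda>s. - ln (p s)) has_real_derivative - (p' / p t)) (at t)"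
    using assms by (auto intro!: derivative_eq_intros)
  moreover have "eventually (\<lambda>s. u s x = - ln (p s)) (nhds t)"
    using eventually_nhds_in_open[OF assms(2,3)] by eventually_elim (use assms(1) in auto)
  ultimately have "((\<lambda>s. u s x) has_real_derivative - (p' / p t)) (at t)"
    by (subst DERIV_cong_ev[OF refl _ refl])
  then show "((\<lambda>s. u s x) has_real_derivative - (p' / p t)) (at t within {0..})"
    by (rule has_field_derivative_at_within)
qed fact

lemma dt_ubl:
  assumes "T > 0" "\<beta> > 0" "0 \<le> t" "t < T" "(T - t) + (1 - \<beta>) / (1 + \<beta>) * (x - x0) > 0"
  shows "dt (ubl \<beta> \<kappa> T x0) t x = 1 / ((T - t) + (1 - \<beta>) / (1 + \<beta>) * (x - x0))"
proof -
  let ?c = "(1 - \<beta>) / (1 + \<beta>)"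
  \<comment> \<open>An open set of times around \<open>t\<close> on which the logarithmic form is
    valid for the fixed \<open>x\<close>.\<close>
  let ?S = "{..<min T (T + ?c * (x - x0))}"
  define A where "A = exp (- \<kappa>) / T"
  have A: "A > 0" using assms by (simp add: A_def)
  have "dt (ubl \<beta> \<kappa> T x0) t x = - ((- A) / (A * ((T - t) + ?c * (x - x0))))"
  proof (rule dt_minus_ln[where S = ?S])
    show "ubl \<beta> \<kappa> T x0 s x = - ln (A * ((T - s) + ?c * (x - x0)))" if "s \<in> ?S" for s
      unfolding A_def by (rule ubl_eq_ln) (use assms that in \<open>auto simp: min_less_iff_conj\<close>)
    show "((\<lambda>s. A * (T - s + ?c * (x - x0))) has_real_derivative - A) (at t)"
      by (auto intro!: derivative_eq_intros)
  qed (use assms A in auto)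
  then show ?thesis using A by simp
qed

subsection \<open>Solutions from null coordinates\<close>

text \<open>No bound is placed on \<open>F\<close> itself: a solution of the wave equation
  determines its two null profiles only up to opposite constants, and the estimates use only
  increments.\<close>

definition C2_profile :: "real \<Rightarrow> real \<Rightarrow> nat \<Rightarrow> real \<Rightarrow> (real \<Rightarrow> real) \<Rightarrow> (real \<Rightarrow> real) \<Rightarrow> (real \<Rightarrow> real) \<Rightarrow> bool" where
  "C2_profile c R m M F F1 F2 \<longleftrightarrow> primitive_on (ball c R) F F1 \<and> primitive_on (ball c R) F1 F2 \<and>
     sobolev_bound c R (Suc m) F2 M \<and> (\<forall>y\<in>ball c R. \<bar>F1 y\<bar> \<le> M)"

lemma C2_profileD:
  assumes "C2_profile c R m M F F1 F2"
  shows "continuous_on (ball c R) F1" "continuous_on (ball c R) F2"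
    "\<And>y. y \<in> ball c R \<Longrightarrow> (F has_real_derivative F1 y) (at y)"
    "\<And>y. y \<in> ball c R \<Longrightarrow> (F1 has_real_derivative F2 y) (at y)"
    "\<And>y. y \<in> ball c R \<Longrightarrow> \<bar>F2 y\<bar> \<le> M"
    "\<And>y. y \<in> ball c R \<Longrightarrow> \<bar>F1 y\<bar> \<le> M"
proof -
  have p: "primitive_on (ball c R) F F1" "primitive_on (ball c R) F1 F2" "sobolev_bound c R (Suc m) F2 M"
    using assms by (auto simp: C2_profile_def)
  show c1: "continuous_on (ball c R) F1" using primitive_on_continuous[OF p(2)] by simp
  show c2: "continuous_on (ball c R) F2" using sobolev_bound_continuous[OF p(3)] .
  show "(F has_real_derivative F1 y) (at y)" if "y \<in> ball c R" for y
    by (rule primitive_on_has_derivative[OF p(1) _ c1 that]) simp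
  show "(F1 has_real_derivative F2 y) (at y)" if "y \<in> ball c R" for y
    by (rule primitive_on_has_derivative[OF p(2) _ c2 that]) simp
  show "\<bar>F2 y\<bar> \<le> M" if "y \<in> ball c R" for y using p(3) that by auto
  show "\<bar>F1 y\<bar> \<le> M" if "y \<in> ball c R" for y using assms that by (auto simp: C2_profile_def)
qed

lemma is_solution_minus_ln:
  assumes F: "C2_profile x0 R m M F F1 F2" and G: "C2_profile x0 R m M G G1 G2" and TR: "T < R"
    and pos: "\<And>t x. (t, x) \<in> light_cone T x0 \<Longrightarrow> F (x + t) + G (x - t) > 0"
    and i: "AE x in lborel. x \<in> ball x0 T \<longrightarrow> - ln (F x + G x) = u0 x \<and> - ((F1 x - G1 x) / (F x + G x)) = u1 x"
  shows "is_solution T x0 (\<lambda>t x. - ln (F (x + t) + G (x - t))) u0 u1"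
proof -
  let ?S = "light_cone T x0"
  define W where "W z = F (snd z + fst z) + G (snd z - fst z)" for z
  \<comment> \<open>\<open>P\<close> and \<open>Q\<close> are w_t and w_x for w = \<open>W\<close>;
    the primed functions are the total derivatives of \<open>W\<close>, \<open>P\<close> and
    \<open>Q\<close>.\<close>
  define P where "P z = F1 (snd z + fst z) - G1 (snd z - fst z)" for z
  define Q where "Q z = F1 (snd z + fst z) + G1 (snd z - fst z)" for z
  define W' where "W' z h = F1 (snd z + fst z) * (snd h + fst h) + G1 (snd z - fst z) * (snd h - fst h)" for z h :: "real \<times> real"
  define P' where "P' z h = F2 (snd z + fst z) * (snd h + fst h) - G2 (snd z - fst z) * (snd h - fst h)" for z h :: "real \<times> real"
  define Q' where "Q' z h = F2 (snd z + fst z) * (snd h + fst h) + G2 (snd z - fst z) * (snd h - fst h)" for z h :: "real \<times> real"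
  define DU where "DU z = (- (P z / W z), - (Q z / W z))" for z
  define D2U where "D2U z h = (- ((P' z h * W z - P z * W' z h) / (W z * W z)), - ((Q' z h * W z - Q z * W' z h) / (W z * W z)))" for z h
  have in_ball: "snd z + fst z \<in> ball x0 R" "snd z - fst z \<in> ball x0 R" if "z \<in> ?S" for z
    using that TR by (auto simp: light_cone_def dist_real_def abs_if split: if_splits)
  have Wpos: "W z > 0" if "z \<in> ?S" for z
    using pos[of "fst z" "snd z"] that by (simp add: W_def)
  have chain: "((\<lambda>z. H (snd z + fst z)) has_derivative (\<lambda>h. H1 (snd z + fst z) * (snd h + fst h))) (at z within ?S)"
    "((\<lambda>z. H (snd z - fst z)) has_derivative (\<lambda>h. H1 (snd z - fst z) * (snd h - fst h))) (at z within ?S)"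
    if z: "z \<in> ?S" and H: "\<And>y. y \<in> ball x0 R \<Longrightarrow> (H has_real_derivative H1 y) (at y)" for z H H1
  proof -
    have 1: "((\<lambda>z::real\<times>real. snd z + fst z) has_derivative (\<lambda>h. snd h + fst h)) (at z within ?S)"
      "((\<lambda>z::real\<times>real. snd z - fst z) has_derivative (\<lambda>h. snd h - fst h)) (at z within ?S)"
      by (auto intro!: derivative_eq_intros)
    have 2: "(H has_derivative (\<lambda>h. H1 y * h)) (at y)" if "y \<in> ball x0 R" for y
      using H[OF that] by (simp add: has_field_derivative_def)
    show "((\<lambda>z. H (snd z + fst z)) has_derivative (\<lambda>h. H1 (snd z + fst z) * (snd h + fst h))) (at z within ?S)"
      by (rule has_derivative_compose[OF 1(1) 2[OF in_ball(1)[OF z]]])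
    show "((\<lambda>z. H (snd z - fst z)) has_derivative (\<lambda>h. H1 (snd z - fst z) * (snd h - fst h))) (at z within ?S)"
      by (rule has_derivative_compose[OF 1(2) 2[OF in_ball(2)[OF z]]])
  qed
  have dW: "(W has_derivative W' z) (at z within ?S)" if z: "z \<in> ?S" for z
    unfolding W_def[abs_def] W'_def[abs_def]
    by (intro has_derivative_add chain[OF z] C2_profileD[OF F] C2_profileD[OF G])
  have dP: "(P has_derivative P' z) (at z within ?S)" if z: "z \<in> ?S" for z
    unfolding P_def[abs_def] P'_def[abs_def]
    by (intro has_derivative_diff chain[OF z] C2_profileD[OF F] C2_profileD[OF G])
  have dQ: "(Q has_derivative Q' z) (at z within ?S)" if z: "z \<in> ?S" for z
    unfolding Q_def[abs_def] Q'_def[abs_def]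
    by (intro has_derivative_add chain[OF z] C2_profileD[OF F] C2_profileD[OF G])
  have cW: "continuous_on ?S W" and cP: "continuous_on ?S P" and cQ: "continuous_on ?S Q"
    by (rule has_derivative_continuous_on, erule dW dP dQ)+
  have cc: "continuous_on ?S (\<lambda>z. H (snd z + fst z))" "continuous_on ?S (\<lambda>z. H (snd z - fst z))"
    if "continuous_on (ball x0 R) H" for H :: "real \<Rightarrow> real"
    by (rule continuous_on_compose2[OF that]; use in_ball in \<open>auto intro!: continuous_intros\<close>)+
  note cs = cc[OF C2_profileD(1)[OF F]] cc[OF C2_profileD(1)[OF G]] cc[OF C2_profileD(2)[OF F]] cc[OF C2_profileD(2)[OF G]]
  have c': "continuous_on ?S (\<lambda>z. W' z h)" "continuous_on ?S (\<lambda>z. P' z h)" "continuous_on ?S (\<lambda>z. Q' z h)" for h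
    unfolding W'_def P'_def Q'_def by (intro continuous_intros cs)+
  have W0: "\<forall>z\<in>?S. W z \<noteq> 0" using Wpos by force
  show ?thesis unfolding is_solution_def
  proof (intro exI[of _ DU] exI[of _ D2U] conjI ballI)
    show "continuous_on ?S DU" unfolding DU_def[abs_def]
      by (intro continuous_intros cW cP cQ) (use W0 in auto)
    show "continuous_on ?S (\<lambda>z. D2U z (1, 0))" "continuous_on ?S (\<lambda>z. D2U z (0, 1))"
      unfolding D2U_def by (intro continuous_intros cW cP cQ c'; use W0 in auto)+
    fix z assume z: "z \<in> ?S"
    have w: "W z > 0" by (rule Wpos[OF z])
    have "((\<lambda>z. - ln (W z)) has_derivative (\<lambda>h. - (W' z h * inverse (W z)))) (at z within ?S)"
      using dW[OF z] w by (auto intro!: derivative_eq_intros simp: divide_inverse mult.commute)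
    moreover have "(\<lambda>h. - (W' z h * inverse (W z))) = (\<lambda>h. DU z \<bullet> h)"
      by (auto simp: fun_eq_iff DU_def W'_def P_def Q_def inner_prod_def divide_inverse algebra_simps)
    moreover have "(\<lambda>z. - ln (W z)) = (\<lambda>(t, x). - ln (F (x + t) + G (x - t)))" by (auto simp: W_def)
    ultimately show "((\<lambda>(t, x). - ln (F (x + t) + G (x - t))) has_derivative (\<lambda>h. DU z \<bullet> h)) (at z within ?S)" by simp
    show "(DU has_derivative D2U z) (at z within ?S)"
      unfolding DU_def[abs_def] D2U_def[abs_def]
      by (intro has_derivative_Pair has_derivative_minus has_derivative_divide' dP[OF z] dQ[OF z] dW[OF z]) (use w in auto)
    \<comment> \<open>The first equation is w_tt = w_xx. It cancels the second-order terms of the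
      quotient rule and leaves (w_t^2 - w_x^2) / w^2.\<close>
    have 1: "P' z (1, 0) = Q' z (0, 1)" "W' z (1, 0) = P z" "W' z (0, 1) = Q z"
      by (auto simp: P'_def Q'_def W'_def P_def Q_def)
    show "fst (D2U z (1, 0)) - snd (D2U z (0, 1)) = (fst (DU z))\<^sup>2 - (snd (DU z))\<^sup>2"
      using w unfolding D2U_def DU_def fst_conv snd_conv 1
      by (simp add: field_simps power2_eq_square)
  next
    show "AE x in lborel. x \<in> ball x0 T \<longrightarrow> - ln (F (x + 0) + G (x - 0)) = u0 x \<and> fst (DU (0, x)) = u1 x"
      using i by (simp add: DU_def P_def W_def)
  qed
qed

text \<open>On the time slice at distance \<open>r\<close> from the vertex, the null coordinates
  differ from those of the vertex by at most 2 * r. The mean value theorem yields the sup bounds 2 *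
  M * r and 4 * M * r^2, and each differentiation loses exactly one power of \<open>r\<close>, as
  the scale-invariant bounds permit. The constants are 3 = 1 + 2 and 7 = 3 + 4.\<close>

lemma taylor_remainder_bound:
  assumes F: "C2_profile c R m M F F1 F2" and r: "0 < r" "r \<le> R" and p: "p \<in> ball c R"
    and sh: "\<And>x. x \<in> ball c r \<Longrightarrow> x + \<tau> \<in> ball c R \<and> \<bar>x + \<tau> - p\<bar> \<le> 2 * r"
  shows "sobolev_bound c r (Suc (Suc m)) (\<lambda>x. F1 (x + \<tau>) - F1 p) (3 * M * r)"
    and "sobolev_bound c r (Suc (Suc (Suc m))) (\<lambda>x. F (x + \<tau>) - F p - F1 p * (x + \<tau> - p)) (7 * M * r\<^sup>2)"
proof -
  note D = C2_profileD[OF F]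
  have M: "0 \<le> M" using D(6)[OF p] by linarith
  have cv: "convex (ball c R)" by simp
  have d1: "\<bar>F1 y - F1 p\<bar> \<le> M * \<bar>y - p\<bar>" if y: "y \<in> ball c R" for y
  proof -
    obtain \<xi> where "\<xi> \<in> ball c R" "F1 y - F1 p = F2 \<xi> * (y - p)"
      using convex_mean_value[OF cv D(4) p y] by metis
    then show ?thesis using D(5)[of \<xi>] by (simp add: abs_mult mult_right_mono)
  qed
  have d0: "\<bar>F y - F p - F1 p * (y - p)\<bar> \<le> M * \<bar>y - p\<bar> * \<bar>y - p\<bar>" if y: "y \<in> ball c R" for y
  proof -
    obtain \<xi> where x: "\<xi> \<in> ball c R" "\<bar>\<xi> - p\<bar> \<le> max \<bar>p - p\<bar> \<bar>y - p\<bar>" "F y - F p = F1 \<xi> * (y - p)"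
      using convex_mean_value[OF cv D(3) p y, of p] by metis
    have "\<bar>F y - F p - F1 p * (y - p)\<bar> = \<bar>F1 \<xi> - F1 p\<bar> * \<bar>y - p\<bar>"
      using x(3) by (simp add: abs_mult[symmetric] left_diff_distrib)
    also have "\<dots> \<le> (M * \<bar>\<xi> - p\<bar>) * \<bar>y - p\<bar>" using d1[OF x(1)] by (intro mult_right_mono) auto
    also have "\<dots> \<le> (M * \<bar>y - p\<bar>) * \<bar>y - p\<bar>" using x(2) M by (intro mult_right_mono mult_left_mono) auto
    finally show ?thesis .
  qed
  have pr: "primitive_on (ball c r) (\<lambda>x. F1 (x + \<tau>)) (\<lambda>x. F2 (x + \<tau>))" "primitive_on (ball c r) (\<lambda>x. F (x + \<tau>)) (\<lambda>x. F1 (x + \<tau>))"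
    using F sh by (auto simp: C2_profile_def intro!: primitive_on_shift[where B = "ball c R"])
  have p1: "primitive_on (ball c r) (\<lambda>x. F1 (x + \<tau>) - F1 p) (\<lambda>x. F2 (x + \<tau>))"
    using primitive_on_add_const[OF pr(1), of "- F1 p"] by simp
  have "primitive_on (ball c r) (\<lambda>x. - F p - F1 p * (x + \<tau> - p)) (\<lambda>x. - F1 p)"
    by (rule primitive_on_FTC) (auto intro!: derivative_eq_intros)
  from primitive_on_add[OF pr(2) this]
  have p0: "primitive_on (ball c r) (\<lambda>x. F (x + \<tau>) - F p - F1 p * (x + \<tau> - p)) (\<lambda>x. F1 (x + \<tau>) - F1 p)"
    by (rule primitive_on_cong) auto
  have "sobolev_bound c r (Suc m) (\<lambda>x. F2 (x + \<tau>)) M"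
    using F sh r by (intro sobolev_bound_localize[of c R]) (auto simp: C2_profile_def simp del: sobolev_bound.simps)
  then have b2: "sobolev_bound c r (Suc m) (\<lambda>x. F2 (x + \<tau>)) (M * r / r)" using r by (simp add: mult.assoc del: sobolev_bound.simps)
  have "sobolev_bound c r (Suc (Suc m)) (\<lambda>x. F1 (x + \<tau>) - F1 p) (M * r + 2 * M * r)"
  proof (rule sobolev_bound_SucI[OF p1 b2])
    show "\<bar>F1 (x + \<tau>) - F1 p\<bar> \<le> 2 * M * r" if "x \<in> ball c r" for x
    proof -
      have "\<bar>F1 (x + \<tau>) - F1 p\<bar> \<le> M * \<bar>x + \<tau> - p\<bar>" using sh[OF that] d1 by blast
      also have "\<dots> \<le> M * (2 * r)" using sh[OF that] M by (intro mult_left_mono) auto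
      finally show ?thesis by simp
    qed
  qed (use r M in auto)
  then show b1: "sobolev_bound c r (Suc (Suc m)) (\<lambda>x. F1 (x + \<tau>) - F1 p) (3 * M * r)"
    by (simp add: mult.assoc del: sobolev_bound.simps)
  then have b1': "sobolev_bound c r (Suc (Suc m)) (\<lambda>x. F1 (x + \<tau>) - F1 p) (3 * M * r\<^sup>2 / r)"
    using r by (simp add: power2_eq_square mult.assoc del: sobolev_bound.simps)
  have "sobolev_bound c r (Suc (Suc (Suc m))) (\<lambda>x. F (x + \<tau>) - F p - F1 p * (x + \<tau> - p)) (3 * M * r\<^sup>2 + 4 * M * r\<^sup>2)"
  proof (rule sobolev_bound_SucI[OF p0 b1'])
    show "\<bar>F (x + \<tau>) - F p - F1 p * (x + \<tau> - p)\<bar> \<le> 4 * M * r\<^sup>2" if "x \<in> ball c r" for x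
    proof -
      have "\<bar>F (x + \<tau>) - F p - F1 p * (x + \<tau> - p)\<bar> \<le> M * \<bar>x + \<tau> - p\<bar> * \<bar>x + \<tau> - p\<bar>" using sh[OF that] d0 by blast
      also have "\<dots> \<le> M * (2 * r) * (2 * r)" using sh[OF that] M r by (intro mult_mono) auto
      finally show ?thesis by (simp add: power2_eq_square mult_ac)
    qed
  qed (use r M in auto)
  then show "sobolev_bound c r (Suc (Suc (Suc m))) (\<lambda>x. F (x + \<tau>) - F p - F1 p * (x + \<tau> - p)) (7 * M * r\<^sup>2)"
    by (simp add: mult.assoc del: sobolev_bound.simps)
qed

text \<open>In the backward cone the coordinate x + t lies to the left of its value at the vertex
  and x - t to the right of its own; the two distances add up to 2 * (T - t). The signs of the
  slopes make both contributions to w positive.\<close>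

lemma null_wave_lower_bound:
  fixes F G :: "real \<Rightarrow> real"
  assumes F: "\<And>y. y \<in> ball x0 R \<Longrightarrow> (F has_real_derivative F1 y) (at y)" "\<And>y. y \<in> ball x0 R \<Longrightarrow> F1 y \<le> - \<mu>"
    and G: "\<And>y. y \<in> ball x0 R \<Longrightarrow> (G has_real_derivative G1 y) (at y)" "\<And>y. y \<in> ball x0 R \<Longrightarrow> \<mu> \<le> G1 y"
    and v: "F (x0 + T) + G (x0 - T) = 0" and T: "T < R" and z: "(t, x) \<in> light_cone T x0"
  shows "2 * \<mu> * (T - t) \<le> F (x + t) + G (x - t)"
proof -
  have cv: "convex (ball x0 R)" by simp
  have tx: "0 \<le> t" "t < T" "\<bar>x - x0\<bar> \<le> T - t" using z by (auto simp: light_cone_iff)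
  have b: "x + t \<in> ball x0 R" "x - t \<in> ball x0 R" "x0 + T \<in> ball x0 R" "x0 - T \<in> ball x0 R"
    using tx T by (auto simp: dist_real_def abs_if split: if_splits)
  obtain \<xi> where 1: "\<xi> \<in> ball x0 R" "F (x + t) - F (x0 + T) = F1 \<xi> * ((x + t) - (x0 + T))"
    using convex_mean_value[OF cv F(1) b(3,1)] by metis
  obtain \<eta> where 2: "\<eta> \<in> ball x0 R" "G (x - t) - G (x0 - T) = G1 \<eta> * ((x - t) - (x0 - T))"
    using convex_mean_value[OF cv G(1) b(4,2)] by metis
  have "F1 \<xi> * ((x + t) - (x0 + T)) \<ge> (- \<mu>) * ((x + t) - (x0 + T))"
    using F(2)[OF 1(1)] tx by (intro mult_right_mono_neg) auto
  moreover have "G1 \<eta> * ((x - t) - (x0 - T)) \<ge> \<mu> * ((x - t) - (x0 - T))"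
    using G(2)[OF 2(1)] tx by (intro mult_right_mono) auto
  moreover have "(- \<mu>) * ((x + t) - (x0 + T)) + \<mu> * ((x - t) - (x0 - T)) = 2 * \<mu> * (T - t)"
    by (simp add: algebra_simps)
  ultimately show ?thesis using 1(2) 2(2) v by linarith
qed

text \<open>With \<open>E\<close> the Taylor remainder \<open>w - w*\<close> at the vertex, the difference of the solutions is
  \<open>- ln (1 + E / w*)\<close>, where \<open>E = O(r\<^sup>2)\<close> and \<open>w* \<sim> r\<close> in the scale-invariant norms.\<close>

lemma blowup_profile_estimate:
  assumes \<mu>: "\<mu> > 0" and R: "R > 0" and M: "M > 0"
  shows "\<exists>C\<ge>0. \<forall>x0 T t F F1 F2 G G1 G2. 0 \<le> t \<longrightarrow> t < T \<longrightarrow> T < R \<longrightarrow>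
     C2_profile x0 R m M F F1 F2 \<longrightarrow> C2_profile x0 R m M G G1 G2 \<longrightarrow>
     (\<forall>y\<in>ball x0 R. F1 y \<le> - \<mu>) \<longrightarrow> (\<forall>y\<in>ball x0 R. \<mu> \<le> G1 y) \<longrightarrow> F (x0 + T) + G (x0 - T) = 0 \<longrightarrow>
     sobolev_bound x0 (T - t) (Suc (Suc (Suc m)))
       (\<lambda>x. ln ((F (x + t) + G (x - t)) / (F1 (x0 + T) * (x + t - (x0 + T)) + G1 (x0 - T) * (x - t - (x0 - T))))) (C * (T - t)) \<and>
     sobolev_bound x0 (T - t) (Suc (Suc m))
       (\<lambda>x. (F1 (x + t) - G1 (x - t)) / (F (x + t) + G (x - t)) -
          (F1 (x0 + T) - G1 (x0 - T)) / (F1 (x0 + T) * (x + t - (x0 + T)) + G1 (x0 - T) * (x - t - (x0 - T)))) C"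
proof -
  let ?K = "Suc (Suc (Suc m))" and ?k = "Suc (Suc m)"
  obtain C1 where C1: "C1 \<ge> 0" "\<And>c r v. 0 < r \<Longrightarrow> sobolev_bound c r ?K v (8 * M) \<Longrightarrow> (\<forall>x\<in>ball c r. 2 * \<mu> \<le> v x) \<Longrightarrow>
    sobolev_bound c r ?K (\<lambda>x. inverse (v x)) C1"
    using sobolev_bound_inverse[of "2 * \<mu>" ?k "8 * M"] \<mu> by auto
  \<comment> \<open>The size allowed for w / r, which is the sum of the affine part, of size 8 * M,
    and the remainder, of size 28 * M * r with r \<le> R.\<close>
  obtain C4 where C4: "C4 \<ge> 0" "\<And>c r v. 0 < r \<Longrightarrow> sobolev_bound c r ?K v (2 * (8 * M + 28 * M * R)) \<Longrightarrow> (\<forall>x\<in>ball c r. 2 * \<mu> \<le> v x) \<Longrightarrow>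
    sobolev_bound c r ?K (\<lambda>x. inverse (v x)) C4"
    using sobolev_bound_inverse[of "2 * \<mu>" ?k "2 * (8 * M + 28 * M * R)"] \<mu> by auto
  define C2 where "C2 = 8 ^ ?K * (28 * M * C1)"
  have C2: "0 \<le> C2" using C1 M by (simp add: C2_def)
  \<comment> \<open>A lower bound for \<open>w / ws\<close>: the numerator is at least 2 * \<mu> * r
    and the denominator at most 8 * M * r.\<close>
  define a where "a = min 1 (\<mu> / (4 * M))"
  have a: "0 < a" "a \<le> 1" using \<mu> M by (auto simp: a_def)
  obtain C3 where C3: "C3 \<ge> 0" "\<And>c r v \<rho>. 0 < r \<Longrightarrow> \<rho> \<le> C2 * R \<Longrightarrow> sobolev_bound c r ?K v \<rho> \<Longrightarrow> (\<forall>x\<in>ball c r. a \<le> 1 + v x) \<Longrightarrow>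
    sobolev_bound c r ?K (\<lambda>x. ln (1 + v x)) (C3 * \<rho>)"
    using sobolev_bound_ln[OF a, of "C2 * R" ?k] by metis
  define N1 where "N1 = 2 * (8 ^ ?k * (12 * M * (2 * (8 * M))) + (2 * M) * (2 * (28 * M)))"
  define C5 where "C5 = 8 ^ ?k * (8 ^ ?k * (N1 * (2 * C1)) * (2 * C4))"
  have N1: "0 \<le> N1" using M by (simp add: N1_def)
  have C5: "0 \<le> C5" using N1 C1 C4 by (simp add: C5_def)
  define C where "C = C3 * C2 + C5"
  have main: "sobolev_bound x0 (T - t) ?K
       (\<lambda>x. ln ((F (x + t) + G (x - t)) / (F1 (x0 + T) * (x + t - (x0 + T)) + G1 (x0 - T) * (x - t - (x0 - T))))) (C * (T - t)) \<and>
     sobolev_bound x0 (T - t) ?k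
       (\<lambda>x. (F1 (x + t) - G1 (x - t)) / (F (x + t) + G (x - t)) -
          (F1 (x0 + T) - G1 (x0 - T)) / (F1 (x0 + T) * (x + t - (x0 + T)) + G1 (x0 - T) * (x - t - (x0 - T)))) C"
    if t: "0 \<le> t" "t < T" "T < R" and F: "C2_profile x0 R m M F F1 F2" and G: "C2_profile x0 R m M G G1 G2"
      and Fm: "\<forall>y\<in>ball x0 R. F1 y \<le> - \<mu>" and Gm: "\<forall>y\<in>ball x0 R. \<mu> \<le> G1 y" and ve: "F (x0 + T) + G (x0 - T) = 0"
    for x0 T t F F1 F2 G G1 G2
  proof -
    define r where "r = T - t"
    have r: "0 < r" "r \<le> R" using t by (auto simp: r_def)
    define p q where "p = x0 + T" and "q = x0 - T"
    have pq: "p \<in> ball x0 R" "q \<in> ball x0 R" using t by (auto simp: p_def q_def dist_real_def)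
    define p1 q1 where "p1 = F1 p" and "q1 = G1 q"
    have p1: "p1 \<le> - \<mu>" "\<bar>p1\<bar> \<le> M" and q1: "\<mu> \<le> q1" "\<bar>q1\<bar> \<le> M"
      using pq Fm Gm C2_profileD(6)[OF F] C2_profileD(6)[OF G] by (auto simp: p1_def q1_def)
    define w where "w x = F (x + t) + G (x - t)" for x
    define ws where "ws x = p1 * (x + t - p) + q1 * (x - t - q)" for x
    define E where "E x = w x - ws x" for x
    define Et where "Et x = (F1 (x + t) - G1 (x - t)) - (p1 - q1)" for x
    have shF: "x + t \<in> ball x0 R \<and> \<bar>x + t - p\<bar> \<le> 2 * r" if "x \<in> ball x0 r" for x
      using that t by (auto simp: dist_real_def r_def p_def abs_if split: if_splits)
    have shG: "x + - t \<in> ball x0 R \<and> \<bar>x + - t - q\<bar> \<le> 2 * r" if "x \<in> ball x0 r" for x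
      using that t by (auto simp: dist_real_def r_def q_def abs_if split: if_splits)
    note tF = taylor_remainder_bound[OF F r pq(1) shF] and tG = taylor_remainder_bound[OF G r pq(2) shG]
    have Mr: "0 \<le> M * r" "0 \<le> M * r\<^sup>2" using M r by auto
    have "sobolev_bound x0 r ?K (\<lambda>x. (F (x + t) - F p - F1 p * (x + t - p)) + (G (x + - t) - G q - G1 q * (x + - t - q)))
        (2 * (7 * M * r\<^sup>2 + 7 * M * r\<^sup>2))"
      by (rule sobolev_bound_add[OF tF(2) tG(2)]) (use M r in auto)
    \<comment> \<open>The two remainders add up to \<open>E\<close> because the constants
      \<open>F p\<close> and \<open>G q\<close> cancel at the vertex.\<close>
    then have "sobolev_bound x0 r ?K E (2 * (7 * M * r\<^sup>2 + 7 * M * r\<^sup>2))"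
      by (rule sobolev_bound_cong) (use ve in \<open>auto simp: E_def w_def ws_def p1_def q1_def p_def q_def algebra_simps\<close>)
    then have bE: "sobolev_bound x0 r ?K E (28 * M * r\<^sup>2)" by (simp add: mult.assoc del: sobolev_bound.simps)
    have "sobolev_bound x0 r ?k (\<lambda>x. (F1 (x + t) - F1 p) + (-1) * (G1 (x + - t) - G1 q)) (2 * (3 * M * r + \<bar>-1\<bar> * (3 * M * r)))"
      by (rule sobolev_bound_add[OF tF(1) sobolev_bound_cmult[OF tG(1)]]) (use M r in auto)
    then have "sobolev_bound x0 r ?k Et (2 * (3 * M * r + \<bar>-1\<bar> * (3 * M * r)))"
      by (rule sobolev_bound_cong) (auto simp: Et_def p1_def q1_def)
    then have bEt: "sobolev_bound x0 r ?k Et (12 * M * r)" by (simp add: mult.assoc del: sobolev_bound.simps)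
    have X: "\<bar>(x - x0) / r\<bar> \<le> 1" if "x \<in> ball x0 r" for x
      using that r by (auto simp: dist_real_def field_simps abs_minus_commute)
    \<comment> \<open>In the self-similar variable (x - x0) / r, which stays in [-1, 1], the
      rescaled affine part no longer depends on \<open>r\<close>; hence its bounds from above and
      below are uniform in time.\<close>
    have ws_eq: "ws x / r = p1 * ((x - x0) / r - 1) + q1 * ((x - x0) / r + 1)" for x
    proof -
      have "ws x = p1 * ((x - x0) - r) + q1 * ((x - x0) + r)"
        by (simp add: ws_def p_def q_def r_def algebra_simps)
      moreover have "(x - x0) / r - 1 = ((x - x0) - r) / r" "(x - x0) / r + 1 = ((x - x0) + r) / r"
        using r by (simp_all add: diff_divide_distrib add_divide_distrib)
      ultimately show ?thesis by (metis add_divide_distrib times_divide_eq_right)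
    qed
    have bws: "sobolev_bound x0 r ?K (\<lambda>x. ws x / r) (8 * M)"
    proof -
      have pr: "primitive_on (ball x0 r) (\<lambda>x. ws x / r) (\<lambda>_. (p1 + q1) / r)"
        unfolding ws_def using r
        by (intro primitive_on_FTC) (auto intro!: derivative_eq_intros simp: field_simps)
      have pq: "\<bar>p1 + q1\<bar> \<le> 2 * M" using p1 q1 by linarith
      have "sobolev_bound x0 r ?k (\<lambda>_. (p1 + q1) / r) (4 * M / r)"
        by (rule sobolev_bound_mono[OF sobolev_bound_const[OF r(1)]])
           (use r pq in \<open>auto simp: divide_right_mono\<close>)
      then have "sobolev_bound x0 r ?K (\<lambda>x. ws x / r) (4 * M + 4 * M)"
      proof (rule sobolev_bound_SucI[OF pr])
        show "\<bar>ws x / r\<bar> \<le> 4 * M" if "x \<in> ball x0 r" for x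
        proof -
          have "\<bar>p1 * ((x - x0) / r - 1)\<bar> \<le> M * 2" "\<bar>q1 * ((x - x0) / r + 1)\<bar> \<le> M * 2"
            unfolding abs_mult using p1 q1 X[OF that] M by (intro mult_mono; linarith)+
          then show ?thesis unfolding ws_eq by linarith
        qed
      qed (use r M in auto)
      then show ?thesis by (simp add: mult.assoc del: sobolev_bound.simps)
    qed
    have ws_lo: "2 * \<mu> \<le> ws x / r" if "x \<in> ball x0 r" for x
    proof -
      have "(- \<mu>) * ((x - x0) / r - 1) \<le> p1 * ((x - x0) / r - 1)"
        using p1 X[OF that] by (intro mult_right_mono_neg) linarith+
      moreover have "\<mu> * ((x - x0) / r + 1) \<le> q1 * ((x - x0) / r + 1)"
        using q1 X[OF that] by (intro mult_right_mono) linarith+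
      moreover have "(- \<mu>) * (y - 1) + \<mu> * (y + 1) = 2 * \<mu>" for y :: real by (simp add: algebra_simps)
      ultimately show ?thesis unfolding ws_eq by (metis add_mono)
    qed
    have ws_pos: "0 < ws x" if "x \<in> ball x0 r" for x
    proof -
      have "0 < ws x / r" using ws_lo[OF that] \<mu> by linarith
      then show ?thesis using r by (simp add: zero_less_divide_iff)
    qed
    have w_lo: "2 * \<mu> \<le> w x / r" if "x \<in> ball x0 r" for x
    proof -
      have "(t, x) \<in> light_cone T x0" using that t by (auto simp: light_cone_iff r_def dist_real_def abs_minus_commute)
      then have "2 * \<mu> * r \<le> w x"
        unfolding w_def r_def
        by (intro null_wave_lower_bound[where R = R and ?F1.0 = F1 and ?G1.0 = G1 and ?x0.0 = x0])
           (use C2_profileD(3)[OF F] C2_profileD(3)[OF G] Fm Gm ve t in auto)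
      then show ?thesis using r by (simp add: field_simps)
    qed
    have w_pos: "0 < w x" if "x \<in> ball x0 r" for x
    proof -
      have "0 < w x / r" using w_lo[OF that] \<mu> by linarith
      then show ?thesis using r by (simp add: zero_less_divide_iff)
    qed
    have biws: "sobolev_bound x0 r ?K (\<lambda>x. inverse (ws x / r)) C1"
      using C1(2)[OF r(1) bws] ws_lo by blast
    have bEr: "sobolev_bound x0 r ?K (\<lambda>x. E x / r) (28 * M * r)"
    proof -
      have "sobolev_bound x0 r ?K (\<lambda>x. (1 / r) * E x) (\<bar>1 / r\<bar> * (28 * M * r\<^sup>2))"
        by (rule sobolev_bound_cmult[OF bE r(1)])
      then show ?thesis using r by (simp add: power2_eq_square mult.assoc del: sobolev_bound.simps)
    qed
    \<comment> \<open>The relative error \<open>E / ws\<close>, of size \<open>r\<close>; its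
      factors are rescaled by \<open>r\<close> so that the inverse is bounded uniformly.\<close>
    define v where "v x = E x / r * inverse (ws x / r)" for x
    have bv: "sobolev_bound x0 r ?K v (C2 * r)"
    proof -
      have "sobolev_bound x0 r ?K (\<lambda>x. E x / r * inverse (ws x / r)) (8 ^ ?K * (28 * M * r * C1))"
        by (rule sobolev_bound_mult[OF bEr biws r(1)])
      then show ?thesis unfolding v_def C2_def by (simp add: mult_ac del: sobolev_bound.simps power_Suc)
    qed
    have v1: "1 + v x = w x / ws x" if "x \<in> ball x0 r" for x
      using ws_pos[OF that] r by (simp add: v_def E_def field_simps)
    have av: "a \<le> 1 + v x" if "x \<in> ball x0 r" for x
    proof -
      have "ws x / r \<le> 8 * M" using sobolev_bound_sup[OF bws that] by linarith
      then have "\<mu> / (4 * M) * (ws x / r) \<le> \<mu> / (4 * M) * (8 * M)" using \<mu> M by (intro mult_left_mono) auto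
      also have "\<dots> = 2 * \<mu>" using M by simp
      also have "\<dots> \<le> w x / r" by (rule w_lo[OF that])
      finally have "\<mu> / (4 * M) * ws x \<le> w x" using r by (simp add: field_simps)
      then have "\<mu> / (4 * M) \<le> w x / ws x" using ws_pos[OF that] by (simp add: pos_le_divide_eq)
      then show ?thesis unfolding v1[OF that] a_def by linarith
    qed
    have "sobolev_bound x0 r ?K (\<lambda>x. ln (1 + v x)) (C3 * (C2 * r))"
      by (rule C3(2)[OF r(1) _ bv]) (use r C2 av in \<open>auto simp: mult_left_mono\<close>)
    then have "sobolev_bound x0 r ?K (\<lambda>x. ln (w x / ws x)) (C3 * (C2 * r))"
      by (rule sobolev_bound_cong) (simp add: v1)
    then have res1: "sobolev_bound x0 r ?K (\<lambda>x. ln (w x / ws x)) (C * r)"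
      by (rule sobolev_bound_mono) (use C2 C3 C5 r in \<open>auto simp: C_def distrib_right\<close>)
    have biw: "sobolev_bound x0 r ?K (\<lambda>x. inverse (w x / r)) C4"
    proof (rule C4(2)[OF r(1)])
      have "sobolev_bound x0 r ?K (\<lambda>x. ws x / r + E x / r) (2 * (8 * M + 28 * M * r))"
        by (rule sobolev_bound_add[OF bws bEr]) (use M r in auto)
      then have "sobolev_bound x0 r ?K (\<lambda>x. w x / r) (2 * (8 * M + 28 * M * r))"
        by (rule sobolev_bound_cong) (simp add: E_def diff_divide_distrib)
      then show "sobolev_bound x0 r ?K (\<lambda>x. w x / r) (2 * (8 * M + 28 * M * R))"
        by (rule sobolev_bound_mono) (use M r in auto)
      show "\<forall>x\<in>ball x0 r. 2 * \<mu> \<le> w x / r" using w_lo by blast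
    qed
    \<comment> \<open>The numerator of the difference of the two quotients over the common
      denominator \<open>w * ws\<close>, divided by \<open>r\<close>; the products of the
      unperturbed quantities have cancelled. It is of size \<open>r\<close>, so the difference
      itself is of size 1 after the division by r * (w / r) * (ws / r).\<close>
    define Z where "Z x = Et x * (ws x / r) + (q1 - p1) * (E x / r)" for x
    have bZ: "sobolev_bound x0 r ?k Z (N1 * r)"
    proof -
      have 1: "sobolev_bound x0 r ?k (\<lambda>x. Et x * (ws x / r)) (8 ^ ?k * (12 * M * r * (2 * (8 * M))))"
        by (rule sobolev_bound_mult[OF bEt sobolev_bound_lower[OF bws r(1)] r(1)])
      have qp: "\<bar>q1 - p1\<bar> \<le> 2 * M" using p1 q1 by linarith
      have "sobolev_bound x0 r ?k (\<lambda>x. (q1 - p1) * (E x / r)) (\<bar>q1 - p1\<bar> * (2 * (28 * M * r)))"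
        by (rule sobolev_bound_cmult[OF sobolev_bound_lower[OF bEr r(1)] r(1)])
      then have 2: "sobolev_bound x0 r ?k (\<lambda>x. (q1 - p1) * (E x / r)) (2 * M * (2 * (28 * M * r)))"
        by (rule sobolev_bound_mono) (use qp M r in \<open>auto intro!: mult_right_mono\<close>)
      have "sobolev_bound x0 r ?k Z (2 * (8 ^ ?k * (12 * M * r * (2 * (8 * M))) + 2 * M * (2 * (28 * M * r))))"
        unfolding Z_def by (rule sobolev_bound_add[OF 1 2]) (use M r in auto)
      moreover have "2 * (8 ^ ?k * (12 * M * r * (2 * (8 * M))) + 2 * M * (2 * (28 * M * r))) = N1 * r"
        unfolding N1_def by (simp only: distrib_right distrib_left mult_ac)
      ultimately show ?thesis by (simp only:)
    qed
    have "sobolev_bound x0 r ?k (\<lambda>x. Z x * inverse (ws x / r) * inverse (w x / r))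
        (8 ^ ?k * (8 ^ ?k * (N1 * r * (2 * C1)) * (2 * C4)))"
      by (intro sobolev_bound_mult bZ sobolev_bound_lower[OF biws r(1)] sobolev_bound_lower[OF biw r(1)] r(1))
    moreover have "8 ^ ?k * (8 ^ ?k * (N1 * r * (2 * C1)) * (2 * C4)) = C5 * r"
      unfolding C5_def by (simp only: mult_ac)
    ultimately have "sobolev_bound x0 r ?k (\<lambda>x. Z x * inverse (ws x / r) * inverse (w x / r)) (C5 * r)" by (simp only:)
    then have "sobolev_bound x0 r ?k (\<lambda>x. (1 / r) * (Z x * inverse (ws x / r) * inverse (w x / r))) (\<bar>1 / r\<bar> * (C5 * r))"
      by (rule sobolev_bound_cmult[OF _ r(1)])
    then have "sobolev_bound x0 r ?k (\<lambda>x. (F1 (x + t) - G1 (x - t)) / w x - (p1 - q1) / ws x) (\<bar>1 / r\<bar> * (C5 * r))"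
    proof (rule sobolev_bound_cong)
      fix x assume x: "x \<in> ball x0 r"
      have "(1 / r) * (Z x * inverse (ws x / r) * inverse (w x / r)) = (Et x * ws x + (q1 - p1) * E x) / (ws x * w x)"
        using r ws_pos[OF x] w_pos[OF x] by (simp add: Z_def field_simps)
      also have "Et x * ws x + (q1 - p1) * E x = (F1 (x + t) - G1 (x - t)) * ws x - (p1 - q1) * w x"
        by (simp add: Et_def E_def algebra_simps)
      also have "\<dots> / (ws x * w x) = (F1 (x + t) - G1 (x - t)) / w x - (p1 - q1) / ws x"
        using ws_pos[OF x] w_pos[OF x] by (simp add: field_simps)
      finally show "(1 / r) * (Z x * inverse (ws x / r) * inverse (w x / r)) = (F1 (x + t) - G1 (x - t)) / w x - (p1 - q1) / ws x" .
    qed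
    then have "sobolev_bound x0 r ?k (\<lambda>x. (F1 (x + t) - G1 (x - t)) / w x - (p1 - q1) / ws x) C5"
      using r by (simp add: mult.assoc del: sobolev_bound.simps)
    then have res2: "sobolev_bound x0 r ?k (\<lambda>x. (F1 (x + t) - G1 (x - t)) / w x - (p1 - q1) / ws x) C"
      by (rule sobolev_bound_mono) (use C2 C3 C5 r in \<open>auto simp: C_def\<close>)
    show ?thesis using res1 res2 unfolding r_def w_def ws_def p_def q_def p1_def q1_def by blast
  qed
  have "0 \<le> C" using C2 C3 C5 by (simp add: C_def)
  then show ?thesis using main by (intro exI[of _ C]) blast
qed

subsection \<open>Perturbed data in null coordinates\<close>

lemma sobolev_bound_affine:
  assumes "r > 0"
  shows "sobolev_bound c r (Suc m) (\<lambda>x. a + b * (x - c)) (2 * \<bar>b\<bar> * r + (\<bar>a\<bar> + \<bar>b\<bar> * r))"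
proof (rule sobolev_bound_SucI)
  show "primitive_on (ball c r) (\<lambda>x. a + b * (x - c)) (\<lambda>_. b)"
    by (rule primitive_on_FTC) (auto intro!: derivative_eq_intros)
  show "sobolev_bound c r m (\<lambda>_. b) (2 * \<bar>b\<bar> * r / r)"
    using sobolev_bound_const[OF assms, of c m b] assms by simp
  show "\<bar>a + b * (x - c)\<bar> \<le> \<bar>a\<bar> + \<bar>b\<bar> * r" if "x \<in> ball c r" for x
  proof -
    have "\<bar>b * (x - c)\<bar> \<le> \<bar>b\<bar> * r"
      unfolding abs_mult using that by (intro mult_left_mono) (auto simp: dist_real_def abs_minus_commute)
    then show ?thesis by linarith
  qed
qed (use assms in auto)

text \<open>A bounded function on the ball, extended by zero, is locally integrable on the whole
  line, where primitives exist.\<close>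

lemma sobolev_bound_primitive_exists:
  assumes w: "sobolev_bound c r (Suc m) w M" and r: "r > 0"
  shows "\<exists>V. primitive_on (ball c r) V w \<and> V c = 0"
proof -
  define w' where "w' x = indicator (ball c r) x *\<^sub>R w x" for x
  have "sobolev_bound c r 0 w (2 * M)"
    by (rule sobolev_bound_0_if_bounded[OF sobolev_bound_continuous[OF w] sobolev_bound_sup[OF w] r sobolev_bound_nonneg[OF w r]])
  then have sq: "sq_int (ball c r) w" by simp
  have e: "(w' x)\<^sup>2 = indicator (ball c r) x *\<^sub>R (w x)\<^sup>2" for x by (auto simp: w'_def indicator_def)
  have "sq_int UNIV w'"
    using sq unfolding sq_int_def set_borel_measurable_def set_integrable_def e
    by (simp add: w'_def[abs_def])
  then have "set_integrable lborel {a..b} w'" for a b by (rule sq_int_set_integrable) simp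
  then obtain V where V: "primitive_on UNIV V w'" using primitive_exists by blast
  have "primitive_on (ball c r) (\<lambda>x. V x + (- V c)) w'"
    by (rule primitive_on_add_const[OF primitive_on_subset[OF V]]) simp
  then have "primitive_on (ball c r) (\<lambda>x. V x - V c) w"
    by (rule primitive_on_cong) (auto simp: w'_def)
  then show ?thesis by (intro exI[of _ "\<lambda>x. V x - V c"]) simp
qed

lemma abs_exp_minus_one_le:
  fixes y :: real
  assumes "\<bar>y\<bar> \<le> 1"
  shows "\<bar>exp y - 1\<bar> \<le> 2 * \<bar>y\<bar>"
proof (cases "y \<ge> 0")
  case True
  have "exp y \<le> 1 + y + y\<^sup>2" using exp_bound[of y] True assms by simp
  moreover have "y\<^sup>2 \<le> y" using True assms by (simp add: power2_eq_square mult_left_le)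
  moreover have "1 \<le> exp y" using True by simp
  ultimately show ?thesis using True by linarith
next
  case False
  have "1 + y \<le> exp y" by (rule exp_ge_add_one_self)
  moreover have "exp y \<le> 1" using False by simp
  ultimately show ?thesis using False by linarith
qed

text \<open>The formula of d'Alembert for w = exp (- u). The initial value is the affine profile
  times exp (- f), and w_t = - u_t * w gives the initial velocity. The slopes (w_x + w_t) / 2 and
  (w_x - w_t) / 2 use one derivative of \<open>f\<close> and none of \<open>g\<close>, which matches
  the unequal orders assumed for them. Both \<open>M\<close> and \<open>L\<close> are independent of
  the perturbation.\<close>

lemma perturbed_null_profiles:
  fixes A T0 c0 :: real
  assumes A: "A > 0" and T0: "T0 > 0" and c0: "\<bar>c0\<bar> \<le> 1" and R: "R > 0"
  shows "\<exists>M>0. \<exists>L>0. \<forall>x0 \<eta> f g. \<eta> \<le> 1 \<longrightarrow>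
    sobolev_bound x0 R (Suc (Suc (Suc m))) f \<eta> \<longrightarrow> sobolev_bound x0 R (Suc (Suc m)) g \<eta> \<longrightarrow>
    (\<exists>F F1 F2 G G1 G2. C2_profile x0 R m M F F1 F2 \<and> C2_profile x0 R m M G G1 G2 \<and>
      (\<forall>x\<in>ball x0 R. \<bar>F1 x - A * (c0 - 1) / 2\<bar> \<le> L * \<eta> \<and> \<bar>G1 x - A * (c0 + 1) / 2\<bar> \<le> L * \<eta> \<and>
         F x + G x = A * (T0 + c0 * (x - x0)) * exp (- f x) \<and>
         F1 x - G1 x = - ((A + A * (T0 + c0 * (x - x0)) * g x) * exp (- f x))))"
proof -
  let ?k = "Suc (Suc m)"
  obtain Ce where Ce: "Ce \<ge> 0" "\<And>c r v. 0 < r \<Longrightarrow> sobolev_bound c r ?k v 2 \<Longrightarrow> sobolev_bound c r ?k (\<lambda>x. exp (v x)) Ce"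
    using sobolev_bound_exp[of "Suc m" 2] by blast
  define Ka where "Ka = 2 * \<bar>A * c0\<bar> * R + (\<bar>A * T0\<bar> + \<bar>A * c0\<bar> * R)"
  define N1 where "N1 = 8 ^ ?k * (Ka * (2 * (1 / R + 1)))"
  define N2 where "N2 = 2 * (4 * A + N1)"
  define N3 where "N3 = 8 ^ ?k * (Ce * N2)"
  have Ka: "0 \<le> Ka" using R by (simp add: Ka_def)
  have N1: "0 \<le> N1" using R Ka by (simp add: N1_def)
  have N2: "0 \<le> N2" using N1 A by (simp add: N2_def)
  have N3: "0 \<le> N3" using N2 Ce by (simp add: N3_def)
  define M where "M = N3 + N3 / R + 1"
  have M: "M > 0" "N3 \<le> M" "N3 / R \<le> M"
    using N3 R by (auto simp: M_def add_nonneg_pos)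
  \<comment> \<open>From \<bar>e - 1\<bar> \<le> 2 * \<eta> on the unperturbed slope and e \<le> 3
    on the terms with \<open>f1\<close> and \<open>g\<close>; the final 1 only ensures
    positivity.\<close>
  define L where "L = 2 * A + 3 / 2 * Ka * (1 / R + 1) + 1"
  have L: "L > 0" using A Ka R by (simp add: L_def add_pos_nonneg add_nonneg_pos)
  have main: "\<exists>F F1 F2 G G1 G2. C2_profile x0 R m M F F1 F2 \<and> C2_profile x0 R m M G G1 G2 \<and>
      (\<forall>x\<in>ball x0 R. \<bar>F1 x - A * (c0 - 1) / 2\<bar> \<le> L * \<eta> \<and> \<bar>G1 x - A * (c0 + 1) / 2\<bar> \<le> L * \<eta> \<and>
         F x + G x = A * (T0 + c0 * (x - x0)) * exp (- f x) \<and>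
         F1 x - G1 x = - ((A + A * (T0 + c0 * (x - x0)) * g x) * exp (- f x)))"
    if \<eta>: "\<eta> \<le> 1" and f: "sobolev_bound x0 R (Suc ?k) f \<eta>" and g: "sobolev_bound x0 R ?k g \<eta>" for x0 \<eta> f g
  proof -
    have \<eta>0: "0 \<le> \<eta>" by (rule sobolev_bound_nonneg[OF g R])
    obtain f1 where f1: "primitive_on (ball x0 R) f f1" "sobolev_bound x0 R ?k f1 (\<eta> / R)"
      using f unfolding sobolev_bound.simps(2)[of _ _ ?k] by blast
    define e where "e x = exp (- f x)" for x
    define a where "a x = A * T0 + (A * c0) * (x - x0)" for x
    have a_eq: "a x = A * (T0 + c0 * (x - x0))" for x by (simp add: a_def algebra_simps)
    have be: "sobolev_bound x0 R ?k e Ce"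
    proof -
      have "sobolev_bound x0 R ?k (\<lambda>x. (-1) * f x) (\<bar>-1\<bar> * (2 * \<eta>))"
        by (rule sobolev_bound_cmult[OF sobolev_bound_lower[OF f R] R])
      then have "sobolev_bound x0 R ?k (\<lambda>x. (-1) * f x) 2"
        by (rule sobolev_bound_mono) (use \<eta> \<eta>0 R in auto)
      from Ce(2)[OF R this] show ?thesis unfolding e_def by (simp del: sobolev_bound.simps)
    qed
    have ba: "sobolev_bound x0 R ?k a Ka" unfolding a_def Ka_def by (rule sobolev_bound_affine[OF R])
    have f1': "sobolev_bound x0 R ?k f1 (1 / R)"
      by (rule sobolev_bound_mono[OF f1(2)]) (use \<eta> \<eta>0 R in \<open>auto simp: divide_right_mono\<close>)
    have g': "sobolev_bound x0 R ?k g 1" by (rule sobolev_bound_mono[OF g]) (use \<eta> \<eta>0 R in auto)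
    \<comment> \<open>This is (w_x + s * w_t) / 2 at time 0, so that s = 1 gives the derivative of
      \<open>F\<close> and s = -1 that of \<open>G\<close>.\<close>
    define P where "P s x = (1 / 2) * (e x * (A * (c0 - s) + (-1) * (a x * (f1 x + s * g x))))" for s x
    have bP: "sobolev_bound x0 R ?k (P s) N3" if s: "\<bar>s\<bar> = 1" for s
    proof -
      have "sobolev_bound x0 R ?k (\<lambda>x. s * g x) (\<bar>s\<bar> * 1)" by (rule sobolev_bound_cmult[OF g' R])
      then have sg: "sobolev_bound x0 R ?k (\<lambda>x. s * g x) 1" using s by (simp del: sobolev_bound.simps)
      have "sobolev_bound x0 R ?k (\<lambda>x. f1 x + s * g x) (2 * (1 / R + 1))"
        by (rule sobolev_bound_add[OF f1' sg]) (use R in auto)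
      from sobolev_bound_cmult[OF sobolev_bound_mult[OF ba this R] R, of "-1"]
      have 1: "sobolev_bound x0 R ?k (\<lambda>x. (-1) * (a x * (f1 x + s * g x))) N1"
        unfolding N1_def by (simp only: abs_minus abs_one mult_1)
      have "\<bar>A * (c0 - s)\<bar> \<le> A * 2" unfolding abs_mult using A c0 s by (intro mult_mono) auto
      then have 2: "sobolev_bound x0 R ?k (\<lambda>_. A * (c0 - s)) (4 * A)"
        by (intro sobolev_bound_mono[OF sobolev_bound_const[OF R]]) (use A R in auto)
      have "sobolev_bound x0 R ?k (\<lambda>x. A * (c0 - s) + (-1) * (a x * (f1 x + s * g x))) N2"
        unfolding N2_def by (rule sobolev_bound_add[OF 2 1]) (use A N1 R in auto)
      from sobolev_bound_cmult[OF sobolev_bound_mult[OF be this R] R, of "1 / 2"]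
      have "sobolev_bound x0 R ?k (P s) (\<bar>1 / 2\<bar> * N3)" unfolding P_def N3_def .
      then show ?thesis by (rule sobolev_bound_mono) (use N3 R in auto)
    qed
    have cl: "\<bar>P s x - A * (c0 - s) / 2\<bar> \<le> L * \<eta>" if s: "\<bar>s\<bar> = 1" and x: "x \<in> ball x0 R" for s x
    proof -
      have fx: "\<bar>f x\<bar> \<le> \<eta>" by (rule sobolev_bound_sup[OF f x])
      have ex: "\<bar>e x - 1\<bar> \<le> 2 * \<eta>" using abs_exp_minus_one_le[of "- f x"] fx \<eta> unfolding e_def by auto
      have e3: "0 \<le> e x" "e x \<le> 3" using ex \<eta> by (auto simp: e_def)
      have ax: "\<bar>a x\<bar> \<le> Ka" by (rule sobolev_bound_sup[OF ba x])
      have "\<bar>f1 x\<bar> \<le> \<eta> / R" "\<bar>g x\<bar> \<le> \<eta>" using sobolev_bound_sup[OF f1(2) x] sobolev_bound_sup[OF g x] by auto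
      moreover have "\<bar>s * g x\<bar> = \<bar>g x\<bar>" using s by (simp add: abs_mult)
      ultimately have fg: "\<bar>f1 x + s * g x\<bar> \<le> \<eta> * (1 / R + 1)"
        using abs_triangle_ineq[of "f1 x" "s * g x"] by (simp add: distrib_left)
      have "\<bar>A * (c0 - s)\<bar> \<le> A * 2" unfolding abs_mult using A c0 s by (intro mult_mono) auto
      then have t1: "\<bar>(e x - 1) * (A * (c0 - s))\<bar> \<le> (2 * \<eta>) * (A * 2)"
        unfolding abs_mult[of "e x - 1"] using ex \<eta>0 by (intro mult_mono) auto
      have t2: "\<bar>e x * (a x * (f1 x + s * g x))\<bar> \<le> 3 * (Ka * (\<eta> * (1 / R + 1)))"
        unfolding abs_mult using e3 ax fg Ka \<eta>0 R by (intro mult_mono) auto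
      have "P s x - A * (c0 - s) / 2 = ((e x - 1) * (A * (c0 - s)) - e x * (a x * (f1 x + s * g x))) / 2"
        by (simp add: P_def field_simps)
      moreover have "\<bar>(X - Y) / 2\<bar> \<le> (d + d') / 2" if "\<bar>X\<bar> \<le> d" "\<bar>Y\<bar> \<le> d'" for X Y d d' :: real
        using that by (auto simp: abs_le_iff)
      ultimately have "\<bar>P s x - A * (c0 - s) / 2\<bar> \<le> ((2 * \<eta>) * (A * 2) + 3 * (Ka * (\<eta> * (1 / R + 1)))) / 2"
        using t1 t2 by presburger
      also have "\<dots> = (2 * A + 3 / 2 * Ka * (1 / R + 1)) * \<eta>" by (simp add: field_simps)
      also have "\<dots> \<le> L * \<eta>" using \<eta>0 unfolding L_def by (intro mult_right_mono) auto
      finally show ?thesis .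
    qed
    have two: "\<exists>H2. primitive_on (ball x0 R) (P s) H2 \<and> sobolev_bound x0 R (Suc m) H2 (N3 / R)" if "\<bar>s\<bar> = 1" for s
      using bP[OF that] unfolding sobolev_bound.simps(2)[of _ _ "Suc m"] by blast
    obtain F2 where F2: "primitive_on (ball x0 R) (P 1) F2" "sobolev_bound x0 R (Suc m) F2 (N3 / R)"
      using two[of 1] by auto
    obtain G2 where G2: "primitive_on (ball x0 R) (P (-1)) G2" "sobolev_bound x0 R (Suc m) G2 (N3 / R)"
      using two[of "-1"] by auto
    \<comment> \<open>The difference \<open>P 1 - P (-1)\<close> is w_t at time 0. Half the initial
      value plus or minus half of its primitive \<open>W\<close> gives the two null
      profiles.\<close>
    have "sobolev_bound x0 R ?k (\<lambda>x. P 1 x + (-1) * P (-1) x) (2 * (N3 + \<bar>-1\<bar> * N3))"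
      by (rule sobolev_bound_add[OF bP sobolev_bound_cmult[OF bP]]) (use R N3 in auto)
    then obtain W where W: "primitive_on (ball x0 R) W (\<lambda>x. P 1 x + (-1) * P (-1) x)"
      using sobolev_bound_primitive_exists[OF _ R] by blast
    have pe: "primitive_on (ball x0 R) e (\<lambda>x. - exp (- f x) * f1 x)"
      unfolding e_def
      by (rule primitive_on_comp[OF f1(1), of UNIV "\<lambda>y. exp (- y)" "\<lambda>y. - exp (- y)"])
         (auto intro!: derivative_eq_intros continuous_intros)
    have pa: "primitive_on (ball x0 R) a (\<lambda>_. A * c0)"
      unfolding a_def by (rule primitive_on_FTC) (auto intro!: derivative_eq_intros)
    note pw = primitive_on_mult[OF pa pe]
    define F where "F x = (1 / 2) * (a x * e x) + (1 / 2) * W x" for x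
    define G where "G x = (1 / 2) * (a x * e x) + (- (1 / 2)) * W x" for x
    have pF: "primitive_on (ball x0 R) F (P 1)"
      by (rule primitive_on_cong[OF primitive_on_add[OF primitive_on_cmult[OF pw, of "1 / 2"] primitive_on_cmult[OF W, of "1 / 2"]]])
         (auto simp: F_def P_def e_def field_simps)
    have pG: "primitive_on (ball x0 R) G (P (-1))"
      by (rule primitive_on_cong[OF primitive_on_add[OF primitive_on_cmult[OF pw, of "1 / 2"] primitive_on_cmult[OF W, of "- (1 / 2)"]]])
         (auto simp: G_def P_def e_def field_simps)
    have prof: "C2_profile x0 R m M H (P s) H2" if "primitive_on (ball x0 R) H (P s)" "primitive_on (ball x0 R) (P s) H2"
      "sobolev_bound x0 R (Suc m) H2 (N3 / R)" "\<bar>s\<bar> = 1" for H H2 s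
    proof -
      have "sobolev_bound x0 R (Suc m) H2 M" by (rule sobolev_bound_mono[OF that(3)]) (use M N3 R in auto)
      moreover have "\<bar>P s y\<bar> \<le> M" if "y \<in> ball x0 R" for y
        using sobolev_bound_sup[OF bP[OF \<open>\<bar>s\<bar> = 1\<close>] that] M by linarith
      ultimately show ?thesis using that unfolding C2_profile_def by blast
    qed
    show ?thesis
    proof (intro exI conjI ballI)
      show "C2_profile x0 R m M F (P 1) F2" by (rule prof[OF pF F2]) simp
      show "C2_profile x0 R m M G (P (-1)) G2" by (rule prof[OF pG G2]) simp
      fix x assume x: "x \<in> ball x0 R"
      show "\<bar>P 1 x - A * (c0 - 1) / 2\<bar> \<le> L * \<eta>" by (rule cl[OF _ x]) simp
      show "\<bar>P (-1) x - A * (c0 + 1) / 2\<bar> \<le> L * \<eta>" using cl[OF _ x, of "-1"] by simp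
      show "F x + G x = A * (T0 + c0 * (x - x0)) * exp (- f x)" by (simp add: F_def G_def e_def a_eq)
      show "P 1 x - P (-1) x = - ((A + A * (T0 + c0 * (x - x0)) * g x) * exp (- f x))"
        unfolding a_eq[symmetric] by (simp add: P_def e_def field_simps)
    qed
  qed
  show ?thesis using M(1) L main by blast
qed

text \<open>On the axis x = x0 the function w differs from the unperturbed A * (T0 - y) by at most A
  * s, so it changes sign between T0 - s and T0 + s. The assumption on \<open>s\<close> keeps both
  times positive and below 2 * T0.\<close>

lemma vertex_exists:
  fixes F G :: "real \<Rightarrow> real"
  assumes F: "\<And>y. y \<in> ball x0 (2 * T0) \<Longrightarrow> (F has_real_derivative F1 y) (at y)"
      "\<And>y. y \<in> ball x0 (2 * T0) \<Longrightarrow> \<bar>F1 y - P0\<bar> \<le> \<rho>"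
    and G: "\<And>y. y \<in> ball x0 (2 * T0) \<Longrightarrow> (G has_real_derivative G1 y) (at y)"
      "\<And>y. y \<in> ball x0 (2 * T0) \<Longrightarrow> \<bar>G1 y - Q0\<bar> \<le> \<rho>"
    and A: "Q0 - P0 = A" "A > 0" and T0: "T0 > 0" and i: "\<bar>F x0 + G x0 - A * T0\<bar> \<le> \<sigma>"
    and s: "(\<sigma> + 4 * \<rho> * T0) / A \<le> T0 / 2"
  shows "\<exists>T. \<bar>T - T0\<bar> \<le> (\<sigma> + 4 * \<rho> * T0) / A \<and> F (x0 + T) + G (x0 - T) = 0"
proof -
  define s where "s = (\<sigma> + 4 * \<rho> * T0) / A"
  have \<rho>0: "0 \<le> \<rho>" using F(2)[of x0] T0 by (smt (verit) centre_in_ball)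
  have \<sigma>0: "0 \<le> \<sigma>" using i by linarith
  have s0: "0 \<le> s" "s \<le> T0 / 2" using \<rho>0 \<sigma>0 A T0 s by (auto simp: s_def)
  have b: "x0 + y \<in> ball x0 (2 * T0)" "x0 - y \<in> ball x0 (2 * T0)" if "y \<in> {0..<2 * T0}" for y
    using that by (auto simp: dist_real_def)
  have dF: "((\<lambda>y. F (x0 + y) + G (x0 - y)) has_real_derivative F1 (x0 + y) - G1 (x0 - y)) (at y)" if "y \<in> {0..<2 * T0}" for y
  proof -
    have "((\<lambda>y. F (x0 + y)) has_real_derivative F1 (x0 + y) * 1) (at y)"
      by (rule DERIV_chain2[where f = F and g = "\<lambda>y. x0 + y", OF F(1)[OF b(1)[OF that]]]) (auto intro!: derivative_eq_intros)
    moreover have "((\<lambda>y. G (x0 - y)) has_real_derivative G1 (x0 - y) * (-1)) (at y)"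
      by (rule DERIV_chain2[where f = G and g = "\<lambda>y. x0 - y", OF G(1)[OF b(2)[OF that]]]) (auto intro!: derivative_eq_intros)
    ultimately show ?thesis using DERIV_add by fastforce
  qed
  \<comment> \<open>The deviation from the unperturbed w on the axis: at most \<sigma> at y = 0,
    with derivative at most 2 * \<rho>, over a time less than 2 * T0.\<close>
  define \<phi> where "\<phi> y = (F (x0 + y) + G (x0 - y)) - A * (T0 - y)" for y
  have d\<phi>: "(\<phi> has_real_derivative F1 (x0 + y) - G1 (x0 - y) + A) (at y)" if "y \<in> {0..<2 * T0}" for y
    unfolding \<phi>_def by (rule derivative_eq_intros dF[OF that] refl | simp)+
  have bd: "\<bar>\<phi> y\<bar> \<le> A * s" if y: "y \<in> {0..<2 * T0}" for y
  proof -
    have "0 \<in> {0..<2 * T0}" using T0 by simp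
    then obtain \<xi> where x: "\<xi> \<in> {0..<2 * T0}" "\<phi> y - \<phi> 0 = (F1 (x0 + \<xi>) - G1 (x0 - \<xi>) + A) * (y - 0)"
      using convex_mean_value[of "{0..<2 * T0}" \<phi> "\<lambda>y. F1 (x0 + y) - G1 (x0 - y) + A" 0 y] d\<phi> y
      by (metis convex_real_interval(7))
    have "\<bar>F1 (x0 + \<xi>) - G1 (x0 - \<xi>) + A\<bar> \<le> 2 * \<rho>"
      using F(2)[OF b(1)[OF x(1)]] G(2)[OF b(2)[OF x(1)]] A(1) by linarith
    then have "\<bar>\<phi> y - \<phi> 0\<bar> \<le> (2 * \<rho>) * (2 * T0)"
      unfolding x(2) abs_mult using y \<rho>0 by (intro mult_mono) auto
    moreover have "\<bar>\<phi> 0\<bar> \<le> \<sigma>" using i by (simp add: \<phi>_def)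
    ultimately have "\<bar>\<phi> y\<bar> \<le> \<sigma> + 4 * \<rho> * T0" by linarith
    then show ?thesis using A by (simp add: s_def)
  qed
  have "\<exists>T\<ge>T0 - s. T \<le> T0 + s \<and> F (x0 + T) + G (x0 - T) = 0"
  proof (rule IVT2)
    show "F (x0 + (T0 + s)) + G (x0 - (T0 + s)) \<le> 0"
      using bd[of "T0 + s"] s0 T0 unfolding \<phi>_def by (auto simp: algebra_simps)
    show "0 \<le> F (x0 + (T0 - s)) + G (x0 - (T0 - s))"
      using bd[of "T0 - s"] s0 T0 unfolding \<phi>_def by (auto simp: algebra_simps)
    show "T0 - s \<le> T0 + s" using s0 by simp
    show "\<forall>T. T0 - s \<le> T \<and> T \<le> T0 + s \<longrightarrow> isCont (\<lambda>T. F (x0 + T) + G (x0 - T)) T"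
      using s0 T0 by (auto intro!: DERIV_isCont[OF dF])
  qed
  then obtain T where "T0 - s \<le> T" "T \<le> T0 + s" "F (x0 + T) + G (x0 - T) = 0" by blast
  then show ?thesis by (intro exI[of _ T]) (auto simp: s_def)
qed

text \<open>Because P0 + \<beta>0 * Q0 = 0, the numerator of the error in \<beta> consists of slope
  errors only. The error in \<kappa> is the logarithm of the ratio \<open>Q\<close> of T * (q1 - p1)
  to its unperturbed value, which is bounded below by \<mu> / A and close to 1.\<close>

lemma blowup_parameters_close:
  fixes p1 q1 P0 Q0 A T T0 \<mu> \<rho> \<tau> :: real
  assumes A: "Q0 - P0 = A" "A > 0" and T0: "T0 > 0" and \<mu>: "0 < \<mu>" "\<mu> \<le> A" "\<mu> \<le> q1" "p1 \<le> - \<mu>"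
    and c: "\<bar>p1 - P0\<bar> \<le> \<rho>" "\<bar>q1 - Q0\<bar> \<le> \<rho>" and T: "\<bar>T - T0\<bar> \<le> \<tau>" "\<tau> \<le> T0 / 2" and \<beta>0: "\<beta>0 > 0" "P0 = - \<beta>0 * Q0"
    and \<kappa>0: "\<kappa>0 = - ln (T0 * A)"
  shows "\<bar>- p1 / q1 - \<beta>0\<bar> \<le> (1 + \<beta>0) / \<mu> * \<rho>"
    "\<bar>- ln (T * (q1 - p1)) - \<kappa>0\<bar> \<le> (4 * T0 * \<rho> + A * \<tau>) / (T0 * \<mu>)" "\<bar>T / T0 - 1\<bar> \<le> \<tau> / T0"
proof -
  have q1: "q1 > 0" using \<mu> by linarith
  have "- p1 / q1 - \<beta>0 = (- (p1 - P0) - \<beta>0 * (q1 - Q0)) / q1"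
    using q1 \<beta>0(2) by (simp add: field_simps)
  also have "\<bar>\<dots>\<bar> = \<bar>- (p1 - P0) - \<beta>0 * (q1 - Q0)\<bar> / q1" using q1 by simp
  also have "\<dots> \<le> ((1 + \<beta>0) * \<rho>) / \<mu>"
  proof (rule frac_le)
    have "\<bar>\<beta>0 * (q1 - Q0)\<bar> \<le> \<beta>0 * \<rho>" unfolding abs_mult using \<beta>0 c by (intro mult_mono) auto
    then show "\<bar>- (p1 - P0) - \<beta>0 * (q1 - Q0)\<bar> \<le> (1 + \<beta>0) * \<rho>"
      using c(1) by (simp add: distrib_right)
    have "0 \<le> \<rho>" using c by linarith
    then show "0 \<le> (1 + \<beta>0) * \<rho>" using \<beta>0 by simp
  qed (use \<mu> in auto)
  finally show "\<bar>- p1 / q1 - \<beta>0\<bar> \<le> (1 + \<beta>0) / \<mu> * \<rho>" by simp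
  have Tp: "T0 / 2 \<le> T" "T \<le> 2 * T0" using T T0 by linarith+
  have As: "2 * \<mu> \<le> q1 - p1" "\<bar>(q1 - p1) - A\<bar> \<le> 2 * \<rho>" using \<mu> c A by linarith+
  define Q where "Q = T * (q1 - p1) / (T0 * A)"
  have TA: "T0 * A > 0" using T0 A by simp
  have "T0 / 2 * (2 * \<mu>) \<le> T * (q1 - p1)" using Tp As \<mu> T0 by (intro mult_mono) auto
  then have "T0 * \<mu> / (T0 * A) \<le> Q" unfolding Q_def using TA by (intro divide_right_mono) auto
  then have Qlo: "\<mu> / A \<le> Q" using T0 by simp
  have Qpos: "0 < \<mu> / A" "\<mu> / A \<le> 1" using \<mu> A by auto
  have "T * (q1 - p1) - T0 * A = T * ((q1 - p1) - A) + A * (T - T0)" by (simp add: algebra_simps)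
  moreover have "\<bar>T * ((q1 - p1) - A)\<bar> \<le> (2 * T0) * (2 * \<rho>)"
    unfolding abs_mult using Tp T0 As by (intro mult_mono) auto
  moreover have "\<bar>A * (T - T0)\<bar> \<le> A * \<tau>" unfolding abs_mult using A T by (intro mult_mono) auto
  ultimately have n: "\<bar>T * (q1 - p1) - T0 * A\<bar> \<le> 4 * T0 * \<rho> + A * \<tau>" by linarith
  have "Q - 1 = (T * (q1 - p1) - T0 * A) / (T0 * A)" using T0 A(2) unfolding Q_def by (simp add: diff_divide_distrib)
  then have Q1: "\<bar>Q - 1\<bar> \<le> (4 * T0 * \<rho> + A * \<tau>) / (T0 * A)"
    using n TA by (simp add: divide_right_mono abs_divide)
  have "T * (q1 - p1) > 0" using Tp T0 As \<mu> by (intro mult_pos_pos) auto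
  then have "- ln (T * (q1 - p1)) - \<kappa>0 = - ln Q"
    using TA T0 A(2) As(1) Tp \<mu>(1) unfolding \<kappa>0 Q_def by (subst ln_divide_pos) auto
  then have "\<bar>- ln (T * (q1 - p1)) - \<kappa>0\<bar> = \<bar>ln Q\<bar>" by simp
  also have "\<dots> \<le> \<bar>Q - 1\<bar> / (\<mu> / A)" by (rule abs_ln_le[OF Qpos Qlo])
  also have "\<dots> \<le> (4 * T0 * \<rho> + A * \<tau>) / (T0 * A) / (\<mu> / A)" using Q1 Qpos by (intro divide_right_mono) auto
  also have "\<dots> = (4 * T0 * \<rho> + A * \<tau>) / (T0 * \<mu>)" using A \<mu> T0 by simp
  finally show "\<bar>- ln (T * (q1 - p1)) - \<kappa>0\<bar> \<le> (4 * T0 * \<rho> + A * \<tau>) / (T0 * \<mu>)" .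
  have "T / T0 - 1 = (T - T0) / T0" using T0 by (simp add: diff_divide_distrib)
  then show "\<bar>T / T0 - 1\<bar> \<le> \<tau> / T0" using T T0 by (simp add: divide_right_mono abs_divide)
qed

text \<open>Matching the affine function with exp (- \<kappa>) / T * (T - t + c * (x - x0)) forces
  exp (- \<kappa>) / T = q1 - p1 and c = (q1 + p1) / (q1 - p1); solving c = (1 - \<beta>) / (1 +
  \<beta>) yields \<beta> = - p1 / q1.\<close>

lemma ubl_from_slopes:
  fixes p1 q1 T :: real
  assumes "T > 0" "p1 < 0" "0 < q1" "t < T" "\<bar>x - x0\<bar> < T - t"
  defines "\<beta> \<equiv> - p1 / q1" and "\<kappa> \<equiv> - ln (T * (q1 - p1))"
  shows "0 < p1 * (x + t - (x0 + T)) + q1 * (x - t - (x0 - T))"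
    "ubl \<beta> \<kappa> T x0 t x = - ln (p1 * (x + t - (x0 + T)) + q1 * (x - t - (x0 - T)))"
    "0 \<le> t \<Longrightarrow> dt (ubl \<beta> \<kappa> T x0) t x = - ((p1 - q1) / (p1 * (x + t - (x0 + T)) + q1 * (x - t - (x0 - T))))"
proof -
  let ?w = "p1 * (x + t - (x0 + T)) + q1 * (x - t - (x0 - T))" and ?P = "(T - t) + (1 - \<beta>) / (1 + \<beta>) * (x - x0)"
  have "0 < p1 * (x + t - (x0 + T))" using assms by (intro mult_neg_neg) auto
  moreover have "0 < q1 * (x - t - (x0 - T))" using assms by (intro mult_pos_pos) auto
  ultimately show w: "0 < ?w" by linarith
  have A: "q1 - p1 > 0" using assms by simp
  have \<beta>: "\<beta> > 0" using divide_neg_pos[OF assms(2,3)] by (simp add: \<beta>_def)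
  have "1 - \<beta> = (q1 + p1) / q1" "1 + \<beta> = (q1 - p1) / q1"
    using assms(3) by (simp_all add: \<beta>_def field_simps)
  then have c: "(1 - \<beta>) / (1 + \<beta>) = (q1 + p1) / (q1 - p1)" using assms(3) by simp
  have "(q1 - p1) * ?P = (q1 - p1) * (T - t) + (q1 + p1) * (x - x0)"
    unfolding c using A by (simp add: distrib_left)
  also have "\<dots> = ?w" by (simp add: algebra_simps)
  finally have wP: "(q1 - p1) * ?P = ?w" .
  then have P: "?P > 0" using w A by (metis zero_less_mult_pos)
  have e: "exp (- \<kappa>) / T = q1 - p1" using assms(1) A by (simp add: \<kappa>_def)
  show "ubl \<beta> \<kappa> T x0 t x = - ln ?w"
    using ubl_eq_ln[OF assms(1) \<beta> assms(4) P, of \<kappa>] unfolding e wP .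
  show "dt (ubl \<beta> \<kappa> T x0) t x = - ((p1 - q1) / ?w)" if "0 \<le> t"
  proof -
    have "dt (ubl \<beta> \<kappa> T x0) t x = 1 / ?P" by (rule dt_ubl[OF assms(1) \<beta> that assms(4) P])
    also have "\<dots> = (q1 - p1) / ?w" unfolding wP[symmetric] using A by simp
    finally show ?thesis by (simp add: minus_divide_left)
  qed
qed

text \<open>Weakens the rate \<open>r\<close> to r powr (1 - \<delta>); the constant depends only on
  the largest radius.\<close>

lemma le_powr_split:
  fixes r :: real
  assumes "0 < r" "r \<le> R" "0 < \<delta>"
  shows "r \<le> R powr \<delta> * r powr (1 - \<delta>)"
proof -
  have "r powr \<delta> * r powr (1 - \<delta>) = r powr 1" using powr_add[of r \<delta> "1 - \<delta>"] by simp
  then have "r = r powr \<delta> * r powr (1 - \<delta>)" using assms by (simp only: powr_one)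
  also have "\<dots> \<le> R powr \<delta> * r powr (1 - \<delta>)" using assms by (intro mult_right_mono powr_mono2) auto
  finally show ?thesis .
qed

subsection \<open>Stability of the blow-up\<close>

text \<open>Both \<epsilon>0 and \<open>C\<close> are chosen before \<epsilon>, the perturbation and
  the time, so \<open>C\<close> is a uniform constant in all estimates, and the last one is linear
  in every \<epsilon> up to \<epsilon>0.\<close>

theorem theorem1p3:
  fixes \<beta>0 T0 \<kappa>0 x0 \<delta> :: real and k :: nat
  assumes "\<beta>0 > 0" and "T0 > 0"
    and "real k \<ge> 2 + 1 / \<beta>0 + \<beta>0"
    and "0 < \<delta>" and "\<delta> < 1"
  shows "\<exists>\<epsilon>0 > 0. \<exists>C > 0. \<forall>\<epsilon> \<in> {0<..\<epsilon>0}. \<forall>f g :: real \<Rightarrow> real.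
     data_small k f g \<epsilon> \<longrightarrow>
     (\<exists>\<beta>s Ts \<kappa>s u.
        \<beta>s > 0 \<and> Ts > 0 \<and>
        is_solution Ts x0 u (\<lambda>x. ubl \<beta>0 \<kappa>0 T0 x0 0 x + f x)
                            (\<lambda>x. dt (ubl \<beta>0 \<kappa>0 T0 x0) 0 x + g x) \<and>
        (\<forall>v. is_solution Ts x0 v (\<lambda>x. ubl \<beta>0 \<kappa>0 T0 x0 0 x + f x)
                                (\<lambda>x. dt (ubl \<beta>0 \<kappa>0 T0 x0) 0 x + g x)
             \<longrightarrow> (\<forall>(t, x) \<in> light_cone Ts x0. v t x = u t x)) \<and>
        (\<forall>t \<in> {0..<Ts}.
           (\<forall>s \<le> k + 1.
              has_Hdot (ball x0 (Ts - t)) s (\<lambda>x. u t x - ubl \<beta>s \<kappa>s Ts x0 t x) \<and>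
              (Ts - t) powr (real s - 1 / 2) *
                Hdot_norm (ball x0 (Ts - t)) s (\<lambda>x. u t x - ubl \<beta>s \<kappa>s Ts x0 t x)
                \<le> C * (Ts - t) powr (1 - \<delta>)) \<and>
           (\<forall>s \<in> {1..k + 1}.
              has_Hdot (ball x0 (Ts - t)) (s - 1) (\<lambda>x. dt u t x - dt (ubl \<beta>s \<kappa>s Ts x0) t x) \<and>
              (Ts - t) powr (real s - 1 / 2) *
                Hdot_norm (ball x0 (Ts - t)) (s - 1) (\<lambda>x. dt u t x - dt (ubl \<beta>s \<kappa>s Ts x0) t x)
                \<le> C * (Ts - t) powr (1 - \<delta>))) \<and>
        \<bar>\<beta>s - \<beta>0\<bar> + \<bar>\<kappa>s - \<kappa>0\<bar> + \<bar>Ts / T0 - 1\<bar> \<le> C * \<epsilon>)"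
proof -
  define m where "m = k - 2"
  have "2 + 1 / \<beta>0 + \<beta>0 > 2" using assms by (simp add: add_pos_pos)
  then have "real k > 2" using assms(3) by linarith
  \<comment> \<open>Two orders are spent on reaching the second derivatives of the profiles, which
    retain order m + 1 and are therefore continuous.\<close>
  then have k: "k = Suc (Suc m)" by (simp add: m_def)
  \<comment> \<open>The perturbed blow-up time is at most 3 / 2 * T0, so the base of its cone stays
    inside this ball.\<close>
  define R where "R = 2 * T0"
  define A where "A = exp (- \<kappa>0) / T0"
  define c0 where "c0 = (1 - \<beta>0) / (1 + \<beta>0)"
  have R: "R > 0" and A: "A > 0" using assms by (auto simp: R_def A_def)
  have c0: "\<bar>c0\<bar> \<le> 1" using assms unfolding c0_def by (simp add: abs_divide divide_le_eq)
  define P0 Q0 where "P0 = A * (c0 - 1) / 2" and "Q0 = A * (c0 + 1) / 2"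
  have "(c0 - 1) / 2 = - (\<beta>0 / (1 + \<beta>0))" "(c0 + 1) / 2 = 1 / (1 + \<beta>0)"
    using assms(1) unfolding c0_def by (simp_all add: field_simps)
  then have PQ: "P0 = A * (- (\<beta>0 / (1 + \<beta>0)))" "Q0 = A * (1 / (1 + \<beta>0))"
    unfolding P0_def Q0_def by (metis times_divide_eq_right)+
  have PQ0: "P0 < 0" "Q0 > 0" using PQ A assms(1) by auto
  have PQA: "Q0 - P0 = A" by (simp add: P0_def Q0_def field_simps)
  have P0\<beta>: "P0 = - \<beta>0 * Q0" using PQ by simp
  \<comment> \<open>Half of the smaller unperturbed slope in absolute value: a perturbation of the
    slopes by at most \<mu> preserves their signs with margin \<mu>.\<close>
  define \<mu> where "\<mu> = min (- P0) Q0 / 2"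
  have \<mu>: "\<mu> > 0" "P0 \<le> - 2 * \<mu>" "2 * \<mu> \<le> Q0" "\<mu> \<le> A" using PQ0 PQA by (auto simp: \<mu>_def)
  obtain M L where M: "M > 0" and L: "L > 0" and prof: "\<And>\<eta> f g. \<eta> \<le> 1 \<Longrightarrow>
    sobolev_bound x0 R (Suc (Suc (Suc m))) f \<eta> \<Longrightarrow> sobolev_bound x0 R (Suc (Suc m)) g \<eta> \<Longrightarrow>
    (\<exists>F F1 F2 G G1 G2. C2_profile x0 R m M F F1 F2 \<and> C2_profile x0 R m M G G1 G2 \<and>
      (\<forall>x\<in>ball x0 R. \<bar>F1 x - P0\<bar> \<le> L * \<eta> \<and> \<bar>G1 x - Q0\<bar> \<le> L * \<eta> \<and>
         F x + G x = A * (T0 + c0 * (x - x0)) * exp (- f x) \<and>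
         F1 x - G1 x = - ((A + A * (T0 + c0 * (x - x0)) * g x) * exp (- f x))))"
    using perturbed_null_profiles[OF A assms(2) c0 R, of m] unfolding P0_def Q0_def by blast
  obtain Kf where Kf: "Kf \<ge> 0" "\<And>f D \<epsilon>. \<epsilon> > 0 \<Longrightarrow> H_witness (Suc k) f D \<Longrightarrow> H_sq (Suc k) D \<le> \<epsilon>\<^sup>2 \<Longrightarrow>
     (\<exists>h. (AE x in lborel. f x = h x) \<and> sobolev_bound x0 R (Suc k) h (Kf * \<epsilon>))"
    using H_witness_representative[OF R, of k] by blast
  obtain Kg where Kg: "Kg \<ge> 0" "\<And>f D \<epsilon>. \<epsilon> > 0 \<Longrightarrow> H_witness k f D \<Longrightarrow> H_sq k D \<le> \<epsilon>\<^sup>2 \<Longrightarrow>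
     (\<exists>h. (AE x in lborel. f x = h x) \<and> sobolev_bound x0 R k h (Kg * \<epsilon>))"
    using H_witness_representative[OF R, of "Suc m"] unfolding k by blast
  obtain C0 where C0: "C0 \<ge> 0" and est: "\<forall>x0 T t F F1 F2 G G1 G2. 0 \<le> t \<longrightarrow> t < T \<longrightarrow> T < R \<longrightarrow>
     C2_profile x0 R m M F F1 F2 \<longrightarrow> C2_profile x0 R m M G G1 G2 \<longrightarrow>
     (\<forall>y\<in>ball x0 R. F1 y \<le> - \<mu>) \<longrightarrow> (\<forall>y\<in>ball x0 R. \<mu> \<le> G1 y) \<longrightarrow> F (x0 + T) + G (x0 - T) = 0 \<longrightarrow>
     sobolev_bound x0 (T - t) (Suc k)
       (\<lambda>x. ln ((F (x + t) + G (x - t)) / (F1 (x0 + T) * (x + t - (x0 + T)) + G1 (x0 - T) * (x - t - (x0 - T))))) (C0 * (T - t)) \<and>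
     sobolev_bound x0 (T - t) k
       (\<lambda>x. (F1 (x + t) - G1 (x - t)) / (F (x + t) + G (x - t)) -
          (F1 (x0 + T) - G1 (x0 - T)) / (F1 (x0 + T) * (x + t - (x0 + T)) + G1 (x0 - T) * (x - t - (x0 - T)))) C0"
    using blowup_profile_estimate[OF \<mu>(1) R M, of m] unfolding k by blast
  define K where "K = Kf + Kg + 1"
  have K: "K > 0" "Kf \<le> K" "Kg \<le> K" using Kf(1) Kg(1) by (auto simp: K_def)
  \<comment> \<open>Shift of the blow-up time per unit of \<eta>: the initial value on the axis
    contributes 2 * A * T0, the slopes contribute 4 * L * T0.\<close>
  define L' where "L' = (2 * A * T0 + 4 * L * T0) / A"
  have L': "L' > 0" using A L assms(2) by (simp add: L'_def add_pos_pos)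
  define B where "B = (1 + \<beta>0) / \<mu> * L + (4 * T0 * L + A * L') / (T0 * \<mu>) + L' / T0"
  have B: "B > 0" using A L L' \<mu> assms(1,2) unfolding B_def by (intro add_pos_pos mult_pos_pos divide_pos_pos) auto
  \<comment> \<open>The first summand serves the decay estimates, its 2 coming from the passage to
    seminorms; the second serves the parameters, with K converting \<epsilon> into \<eta>.\<close>
  define C where "C = 2 * C0 * R powr \<delta> + B * K"
  have C: "C > 0" "2 * C0 * R powr \<delta> \<le> C" "B * K \<le> C"
    using C0 B K(1) by (auto simp: C_def intro!: add_nonneg_pos)
  \<comment> \<open>The three caps keep the exponentials in their linear range, the slopes beyond
    \<mu> in absolute value, and the blow-up time within T0 / 2 of \<open>T0\<close>.\<close>
  define \<epsilon>0 where "\<epsilon>0 = min 1 (min (\<mu> / L) (T0 / (2 * L'))) / K"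
  have \<epsilon>0: "\<epsilon>0 > 0" using \<mu> L L' assms(2) K by (simp add: \<epsilon>0_def)
  show ?thesis
  proof (rule exI[of _ \<epsilon>0], rule conjI[OF \<epsilon>0], rule exI[of _ C], rule conjI[OF C(1)], intro ballI allI impI)
    fix \<epsilon> f g assume e: "\<epsilon> \<in> {0<..\<epsilon>0}" and small: "data_small k f g \<epsilon>"
    define \<eta> where "\<eta> = K * \<epsilon>"
    have e0: "\<epsilon> > 0" using e by simp
    have "\<eta> \<le> K * \<epsilon>0" unfolding \<eta>_def using e K by (intro mult_left_mono) auto
    also have "\<dots> = min 1 (min (\<mu> / L) (T0 / (2 * L')))" using K by (simp add: \<epsilon>0_def)
    finally have "\<eta> \<le> 1" "\<eta> \<le> \<mu> / L" "\<eta> \<le> T0 / (2 * L')" by auto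
    then have \<eta>: "\<eta> \<le> 1" "L * \<eta> \<le> \<mu>" "L' * \<eta> \<le> T0 / 2"
      using L L' by (auto simp: field_simps)
    have \<eta>0: "\<eta> > 0" using e0 K by (simp add: \<eta>_def)
    obtain Df Dg where D: "H_witness (Suc k) f Df" "H_witness k g Dg" "sqrt (H_sq (Suc k) Df + H_sq k Dg) \<le> \<epsilon>"
      using small unfolding data_small_def by auto
    have Hn: "0 \<le> H_sq n D" for n D unfolding H_sq_def by (intro sum_nonneg) auto
    have "H_sq (Suc k) Df + H_sq k Dg \<le> \<epsilon>\<^sup>2"
      using D(3) Hn[of "Suc k" Df] Hn[of k Dg] by (metis add_nonneg_nonneg real_sqrt_le_iff real_sqrt_unique real_sqrt_pow2 sqrt_le_D)
    then have H: "H_sq (Suc k) Df \<le> \<epsilon>\<^sup>2" "H_sq k Dg \<le> \<epsilon>\<^sup>2"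
      using Hn[of "Suc k" Df] Hn[of k Dg] by linarith+
    obtain h where h: "AE x in lborel. f x = h x" "sobolev_bound x0 R (Suc k) h (Kf * \<epsilon>)"
      using Kf(2)[OF e0 D(1) H(1)] by blast
    obtain l where l: "AE x in lborel. g x = l x" "sobolev_bound x0 R k l (Kg * \<epsilon>)"
      using Kg(2)[OF e0 D(2) H(2)] by blast
    have bh: "sobolev_bound x0 R (Suc k) h \<eta>"
      by (rule sobolev_bound_mono[OF h(2)]) (use Kf(1) K e0 R in \<open>auto simp: \<eta>_def\<close>)
    have bl: "sobolev_bound x0 R k l \<eta>"
      by (rule sobolev_bound_mono[OF l(2)]) (use Kg(1) K e0 R in \<open>auto simp: \<eta>_def\<close>)
    obtain F F1 F2 G G1 G2 where F: "C2_profile x0 R m M F F1 F2" and G: "C2_profile x0 R m M G G1 G2"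
      and FG: "\<And>x. x \<in> ball x0 R \<Longrightarrow> \<bar>F1 x - P0\<bar> \<le> L * \<eta> \<and> \<bar>G1 x - Q0\<bar> \<le> L * \<eta> \<and>
         F x + G x = A * (T0 + c0 * (x - x0)) * exp (- h x) \<and>
         F1 x - G1 x = - ((A + A * (T0 + c0 * (x - x0)) * l x) * exp (- h x))"
      using prof[OF \<eta>(1) bh[unfolded k] bl[unfolded k]] by blast
    have Fm: "\<forall>y\<in>ball x0 R. F1 y \<le> - \<mu>"
    proof
      fix y assume "y \<in> ball x0 R"
      then have "\<bar>F1 y - P0\<bar> \<le> L * \<eta>" using FG by blast
      then show "F1 y \<le> - \<mu>" using \<eta>(2) \<mu>(2) by linarith
    qed
    have Gm: "\<forall>y\<in>ball x0 R. \<mu> \<le> G1 y"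
    proof
      fix y assume "y \<in> ball x0 R"
      then have "\<bar>G1 y - Q0\<bar> \<le> L * \<eta>" using FG by blast
      then show "\<mu> \<le> G1 y" using \<eta>(2) \<mu>(3) by linarith
    qed
    have "\<exists>T. \<bar>T - T0\<bar> \<le> (2 * A * T0 * \<eta> + 4 * (L * \<eta>) * T0) / A \<and> F (x0 + T) + G (x0 - T) = 0"
    proof (rule vertex_exists[OF _ _ _ _ PQA A assms(2)])
      show "(F has_real_derivative F1 y) (at y)" "\<bar>F1 y - P0\<bar> \<le> L * \<eta>"
        "(G has_real_derivative G1 y) (at y)" "\<bar>G1 y - Q0\<bar> \<le> L * \<eta>" if "y \<in> ball x0 (2 * T0)" for y
        using that FG C2_profileD(3)[OF F] C2_profileD(3)[OF G] unfolding R_def by blast+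
      have x0: "x0 \<in> ball x0 R" using R by simp
      have hx: "\<bar>h x0\<bar> \<le> \<eta>" by (rule sobolev_bound_sup[OF bh x0])
      have "F x0 + G x0 - A * T0 = A * T0 * (exp (- h x0) - 1)" using FG[OF x0] by (simp add: algebra_simps)
      also have "\<bar>\<dots>\<bar> \<le> A * T0 * (2 * \<eta>)"
        unfolding abs_mult[of "A * T0"] using A assms(2) abs_exp_minus_one_le[of "- h x0"] hx \<eta>(1)
        by (intro mult_mono) auto
      finally show "\<bar>F x0 + G x0 - A * T0\<bar> \<le> 2 * A * T0 * \<eta>" by simp
      have "(2 * A * T0 * \<eta> + 4 * (L * \<eta>) * T0) / A = L' * \<eta>" by (simp add: L'_def algebra_simps)
      then show "(2 * A * T0 * \<eta> + 4 * (L * \<eta>) * T0) / A \<le> T0 / 2" using \<eta>(3) by simp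
    qed
    moreover have "(2 * A * T0 * \<eta> + 4 * (L * \<eta>) * T0) / A = L' * \<eta>" by (simp add: L'_def algebra_simps)
    ultimately obtain T where T: "\<bar>T - T0\<bar> \<le> L' * \<eta>" and vx: "F (x0 + T) + G (x0 - T) = 0" by auto
    have Tb: "0 < T" "T < R" using T \<eta>(3) assms(2) unfolding R_def by linarith+
    define p1 q1 where "p1 = F1 (x0 + T)" and "q1 = G1 (x0 - T)"
    have pqb: "x0 + T \<in> ball x0 R" "x0 - T \<in> ball x0 R" using Tb by (auto simp: dist_real_def)
    have p1: "p1 \<le> - \<mu>" "\<bar>p1 - P0\<bar> \<le> L * \<eta>" and q1: "\<mu> \<le> q1" "\<bar>q1 - Q0\<bar> \<le> L * \<eta>"
      using FG pqb Fm Gm by (auto simp: p1_def q1_def)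
    have sg: "p1 < 0" "0 < q1" using p1 q1 \<mu> by linarith+
    define \<beta>s where "\<beta>s = - p1 / q1"
    define \<kappa>s where "\<kappa>s = - ln (T * (q1 - p1))"
    define u where "u t x = - ln (F (x + t) + G (x - t))" for t x
    have pos: "F (x + t) + G (x - t) > 0" if "(t, x) \<in> light_cone T x0" for t x
    proof -
      have "2 * \<mu> * (T - t) \<le> F (x + t) + G (x - t)"
        by (rule null_wave_lower_bound[where R = R and ?F1.0 = F1 and ?G1.0 = G1 and ?x0.0 = x0])
           (use C2_profileD(3)[OF F] C2_profileD(3)[OF G] Fm Gm vx Tb that in auto)
      moreover have "0 < 2 * \<mu> * (T - t)" using that \<mu> by (simp add: light_cone_iff)
      ultimately show ?thesis by linarith
    qed
    have sol: "is_solution T x0 u (\<lambda>x. ubl \<beta>0 \<kappa>0 T0 x0 0 x + f x) (\<lambda>x. dt (ubl \<beta>0 \<kappa>0 T0 x0) 0 x + g x)"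
      unfolding u_def
    proof (rule is_solution_minus_ln[OF F G Tb(2) pos])
      show "AE x in lborel. x \<in> ball x0 T \<longrightarrow> - ln (F x + G x) = ubl \<beta>0 \<kappa>0 T0 x0 0 x + f x \<and>
         - ((F1 x - G1 x) / (F x + G x)) = dt (ubl \<beta>0 \<kappa>0 T0 x0) 0 x + g x"
        using h(1) l(1)
      proof eventually_elim
        case (elim x)
        show ?case
        proof (rule impI)
          assume x: "x \<in> ball x0 T"
          have xR: "x \<in> ball x0 R" using x Tb by auto
          define P where "P = T0 + c0 * (x - x0)"
          have FGx: "F x + G x = A * P * exp (- h x)" "F1 x - G1 x = - ((A + A * P * l x) * exp (- h x))"
            using FG[OF xR] by (auto simp: P_def)
          have "(0, x) \<in> light_cone T x0" using x Tb by (auto simp: light_cone_iff dist_real_def abs_minus_commute)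
          from pos[OF this] have "0 < A * P * exp (- h x)" using FGx by simp
          \<comment> \<open>If T > T0, then \<open>x\<close> may lie outside the base of the
            unperturbed cone, so \<bar>x - x0\<bar> < T alone does not give this sign; it is read
            off from the positivity of w.\<close>
          then have P: "P > 0" using A by (simp add: zero_less_mult_iff)
          then have P': "0 < (T0 - 0) + (1 - \<beta>0) / (1 + \<beta>0) * (x - x0)" by (simp add: P_def c0_def)
          have "ubl \<beta>0 \<kappa>0 T0 x0 0 x = - ln (A * P)"
            using ubl_eq_ln[OF assms(2,1,2) P', of \<kappa>0] by (simp add: A_def P_def c0_def)
          then have 1: "- ln (F x + G x) = ubl \<beta>0 \<kappa>0 T0 x0 0 x + h x"
            unfolding FGx using A P by (simp add: ln_mult)
          have "dt (ubl \<beta>0 \<kappa>0 T0 x0) 0 x = 1 / P"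
            using dt_ubl[OF assms(2,1) _ assms(2) P', of \<kappa>0] by (simp add: P_def c0_def)
          then have 2: "- ((F1 x - G1 x) / (F x + G x)) = dt (ubl \<beta>0 \<kappa>0 T0 x0) 0 x + l x"
            unfolding FGx using A P by (simp add: field_simps)
          show "- ln (F x + G x) = ubl \<beta>0 \<kappa>0 T0 x0 0 x + f x \<and>
             - ((F1 x - G1 x) / (F x + G x)) = dt (ubl \<beta>0 \<kappa>0 T0 x0) 0 x + g x"
            using 1 2 elim by simp
        qed
      qed
    qed
    have bounds: "(\<forall>s\<le>k + 1. has_Hdot (ball x0 (T - t)) s (\<lambda>x. u t x - ubl \<beta>s \<kappa>s T x0 t x) \<and>
          (T - t) powr (real s - 1 / 2) * Hdot_norm (ball x0 (T - t)) s (\<lambda>x. u t x - ubl \<beta>s \<kappa>s T x0 t x)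
            \<le> C * (T - t) powr (1 - \<delta>)) \<and>
        (\<forall>s\<in>{1..k + 1}. has_Hdot (ball x0 (T - t)) (s - 1) (\<lambda>x. dt u t x - dt (ubl \<beta>s \<kappa>s T x0) t x) \<and>
          (T - t) powr (real s - 1 / 2) * Hdot_norm (ball x0 (T - t)) (s - 1) (\<lambda>x. dt u t x - dt (ubl \<beta>s \<kappa>s T x0) t x)
            \<le> C * (T - t) powr (1 - \<delta>))" if t: "t \<in> {0..<T}" for t
    proof -
      define r where "r = T - t"
      have r: "0 < r" "r \<le> R" using t Tb by (auto simp: r_def)
      define w where "w x = F (x + t) + G (x - t)" for x
      define ws where "ws x = p1 * (x + t - (x0 + T)) + q1 * (x - t - (x0 - T))" for x
      have E: "sobolev_bound x0 r (Suc k) (\<lambda>x. ln (w x / ws x)) (C0 * r)"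
        "sobolev_bound x0 r k (\<lambda>x. (F1 (x + t) - G1 (x - t)) / w x - (p1 - q1) / ws x) C0"
        using est[rule_format, OF _ _ Tb(2) F G _ _ vx, of t] Fm Gm t by (auto simp: r_def w_def ws_def p1_def q1_def)
      have pt: "0 < ws x" "0 < w x" "ubl \<beta>s \<kappa>s T x0 t x = - ln (ws x)"
          "dt (ubl \<beta>s \<kappa>s T x0) t x = - ((p1 - q1) / ws x)" "dt u t x = - ((F1 (x + t) - G1 (x - t)) / w x)"
        if x: "x \<in> ball x0 r" for x
      proof -
        have xr: "\<bar>x - x0\<bar> < T - t" using x by (auto simp: dist_real_def r_def abs_minus_commute)
        note us = ubl_from_slopes[OF Tb(1) sg _ xr]
        show "0 < ws x" "ubl \<beta>s \<kappa>s T x0 t x = - ln (ws x)" "dt (ubl \<beta>s \<kappa>s T x0) t x = - ((p1 - q1) / ws x)"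
          using us t unfolding ws_def \<beta>s_def \<kappa>s_def by auto
        have "(t, x) \<in> light_cone T x0" using xr t by (simp add: light_cone_iff)
        then show wp: "0 < w x" using pos by (simp add: w_def)
        have xb: "x + t \<in> ball x0 R" "x - t \<in> ball x0 R" using xr t Tb by (auto simp: dist_real_def abs_if split: if_splits)
        have dF: "((\<lambda>s. F (x + s)) has_real_derivative F1 (x + t) * 1) (at t)"
          by (rule DERIV_chain2[where f = F and g = "\<lambda>s. x + s", OF C2_profileD(3)[OF F xb(1)]]) (auto intro!: derivative_eq_intros)
        have dG: "((\<lambda>s. G (x - s)) has_real_derivative G1 (x - t) * (-1)) (at t)"
          by (rule DERIV_chain2[where f = G and g = "\<lambda>s. x - s", OF C2_profileD(3)[OF G xb(2)]]) (auto intro!: derivative_eq_intros)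
        have "((\<lambda>s. F (x + s) + G (x - s)) has_real_derivative F1 (x + t) - G1 (x - t)) (at t)"
          using DERIV_add[OF dF dG] by simp
        from dt_minus_ln[where S = UNIV and u = u and x = x, OF _ _ _ _ this]
        show "dt u t x = - ((F1 (x + t) - G1 (x - t)) / w x)"
          using t wp by (simp add: u_def w_def)
      qed
      have "sobolev_bound x0 r (Suc k) (\<lambda>x. (-1) * ln (w x / ws x)) (\<bar>-1\<bar> * (C0 * r))"
        by (rule sobolev_bound_cmult[OF E(1) r(1)])
      then have "sobolev_bound x0 r (Suc k) (\<lambda>x. u t x - ubl \<beta>s \<kappa>s T x0 t x) (\<bar>-1\<bar> * (C0 * r))"
        by (rule sobolev_bound_cong) (simp add: pt u_def w_def[symmetric] ln_divide_pos)
      then have b1: "sobolev_bound x0 r (Suc k) (\<lambda>x. u t x - ubl \<beta>s \<kappa>s T x0 t x) (C0 * r)" by (simp only: abs_minus abs_one mult_1)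
      have "sobolev_bound x0 r k (\<lambda>x. (-1) * ((F1 (x + t) - G1 (x - t)) / w x - (p1 - q1) / ws x)) (\<bar>-1\<bar> * C0)"
        by (rule sobolev_bound_cmult[OF E(2) r(1)])
      then have "sobolev_bound x0 r k (\<lambda>x. dt u t x - dt (ubl \<beta>s \<kappa>s T x0) t x) (\<bar>-1\<bar> * C0)"
        by (rule sobolev_bound_cong) (simp add: pt)
      then have b2: "sobolev_bound x0 r k (\<lambda>x. dt u t x - dt (ubl \<beta>s \<kappa>s T x0) t x) C0" by (simp only: abs_minus abs_one mult_1)
      \<comment> \<open>The estimates hold with the full power \<open>r\<close>; only here is it
        weakened to the claimed one.\<close>
      have "2 * (C0 * r) \<le> 2 * (C0 * (R powr \<delta> * r powr (1 - \<delta>)))"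
        using le_powr_split[OF r assms(4)] C0 by (intro mult_left_mono) auto
      also have "\<dots> = 2 * C0 * R powr \<delta> * r powr (1 - \<delta>)" by simp
      also have "\<dots> \<le> C * r powr (1 - \<delta>)" using C(2) by (intro mult_right_mono) auto
      finally have Cr: "2 * (C0 * r) \<le> C * r powr (1 - \<delta>)" .
      show ?thesis unfolding r_def[symmetric]
      proof (intro conjI allI ballI impI)
        fix s assume s: "s \<le> k + 1"
        have Cr0: "0 \<le> C0 * r" using C0 r by simp
        note H = sobolev_bound_Hdot[OF b1 _ r(1) Cr0, of s]
        show "has_Hdot (ball x0 r) s (\<lambda>x. u t x - ubl \<beta>s \<kappa>s T x0 t x)" using H(1) s by simp
        show "r powr (real s - 1 / 2) * Hdot_norm (ball x0 r) s (\<lambda>x. u t x - ubl \<beta>s \<kappa>s T x0 t x) \<le> C * r powr (1 - \<delta>)"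
          using H(2) s Cr by simp
      next
        fix s assume s: "s \<in> {1..k + 1}"
        then have s1: "s - 1 \<le> k" by auto
        note H = sobolev_bound_Hdot[OF b2 s1 r(1) C0]
        show "has_Hdot (ball x0 r) (s - 1) (\<lambda>x. dt u t x - dt (ubl \<beta>s \<kappa>s T x0) t x)" using H(1) .
        \<comment> \<open>The seminorm has order s - 1 but the weight belongs to s. The surplus
          factor \<open>r\<close> turns the bound of size 1 for the time derivative into the
          required decay.\<close>
        have "real s - 1 / 2 = 1 + (real (s - 1) - 1 / 2)" using s by (simp add: of_nat_diff)
        moreover have "r powr (1 + b) = r * r powr b" for b using r by (simp add: powr_add)
        ultimately have "r powr (real s - 1 / 2) = r * r powr (real (s - 1) - 1 / 2)" by (simp only:)
        then have "r powr (real s - 1 / 2) * Hdot_norm (ball x0 r) (s - 1) (\<lambda>x. dt u t x - dt (ubl \<beta>s \<kappa>s T x0) t x)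
          = r * (r powr (real (s - 1) - 1 / 2) * Hdot_norm (ball x0 r) (s - 1) (\<lambda>x. dt u t x - dt (ubl \<beta>s \<kappa>s T x0) t x))"
          by (simp only: mult.assoc)
        also have "\<dots> \<le> r * (2 * C0)" using H(2) r by (intro mult_left_mono) auto
        also have "\<dots> \<le> C * r powr (1 - \<delta>)" using Cr by (simp add: mult_ac)
        finally show "r powr (real s - 1 / 2) * Hdot_norm (ball x0 r) (s - 1) (\<lambda>x. dt u t x - dt (ubl \<beta>s \<kappa>s T x0) t x)
          \<le> C * r powr (1 - \<delta>)" .
      qed
    qed
    have "\<kappa>0 = - ln (T0 * A)" using assms(2) by (simp add: A_def)
    note close = blowup_parameters_close[OF PQA A assms(2) \<mu>(1,4) q1(1) p1(1) p1(2) q1(2) T \<eta>(3) assms(1) P0\<beta> this]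
    have "\<bar>\<beta>s - \<beta>0\<bar> + \<bar>\<kappa>s - \<kappa>0\<bar> + \<bar>T / T0 - 1\<bar>
        \<le> (1 + \<beta>0) / \<mu> * (L * \<eta>) + (4 * T0 * (L * \<eta>) + A * (L' * \<eta>)) / (T0 * \<mu>) + L' * \<eta> / T0"
      unfolding \<beta>s_def \<kappa>s_def by (intro add_mono close)
    also have "\<dots> = B * K * \<epsilon>" by (simp add: B_def \<eta>_def algebra_simps add_divide_distrib)
    also have "\<dots> \<le> C * \<epsilon>" using C(3) e0 by (intro mult_right_mono) auto
    finally have par: "\<bar>\<beta>s - \<beta>0\<bar> + \<bar>\<kappa>s - \<kappa>0\<bar> + \<bar>T / T0 - 1\<bar> \<le> C * \<epsilon>" .
    have bs: "\<beta>s > 0" using divide_neg_pos[OF sg] by (simp add: \<beta>s_def)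
    have uniq: "\<forall>v. is_solution T x0 v (\<lambda>x. ubl \<beta>0 \<kappa>0 T0 x0 0 x + f x) (\<lambda>x. dt (ubl \<beta>0 \<kappa>0 T0 x0) 0 x + g x)
         \<longrightarrow> (\<forall>(t, x)\<in>light_cone T x0. v t x = u t x)"
      using is_solution_unique[OF sol _ Tb(1)] by auto
    show "\<exists>\<beta>s Ts \<kappa>s u.
        \<beta>s > 0 \<and> Ts > 0 \<and>
        is_solution Ts x0 u (\<lambda>x. ubl \<beta>0 \<kappa>0 T0 x0 0 x + f x)
                            (\<lambda>x. dt (ubl \<beta>0 \<kappa>0 T0 x0) 0 x + g x) \<and>
        (\<forall>v. is_solution Ts x0 v (\<lambda>x. ubl \<beta>0 \<kappa>0 T0 x0 0 x + f x)
                                (\<lambda>x. dt (ubl \<beta>0 \<kappa>0 T0 x0) 0 x + g x)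
             \<longrightarrow> (\<forall>(t, x) \<in> light_cone Ts x0. v t x = u t x)) \<and>
        (\<forall>t \<in> {0..<Ts}.
           (\<forall>s \<le> k + 1.
              has_Hdot (ball x0 (Ts - t)) s (\<lambda>x. u t x - ubl \<beta>s \<kappa>s Ts x0 t x) \<and>
              (Ts - t) powr (real s - 1 / 2) *
                Hdot_norm (ball x0 (Ts - t)) s (\<lambda>x. u t x - ubl \<beta>s \<kappa>s Ts x0 t x)
                \<le> C * (Ts - t) powr (1 - \<delta>)) \<and>
           (\<forall>s \<in> {1..k + 1}.
              has_Hdot (ball x0 (Ts - t)) (s - 1) (\<lambda>x. dt u t x - dt (ubl \<beta>s \<kappa>s Ts x0) t x) \<and>
              (Ts - t) powr (real s - 1 / 2) *
                Hdot_norm (ball x0 (Ts - t)) (s - 1) (\<lambda>x. dt u t x - dt (ubl \<beta>s \<kappa>s Ts x0) t x)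
                \<le> C * (Ts - t) powr (1 - \<delta>))) \<and>
        \<bar>\<beta>s - \<beta>0\<bar> + \<bar>\<kappa>s - \<kappa>0\<bar> + \<bar>Ts / T0 - 1\<bar> \<le> C * \<epsilon>"
      by (rule exI[of _ \<beta>s], rule exI[of _ T], rule exI[of _ \<kappa>s], rule exI[of _ u])
         (intro conjI bs Tb(1) sol uniq ballI[OF bounds] par)
  qed
qed

end
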